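(* There is an absolute constant $C>0$ such that the following holds. Let $k,n,\ell$ be positive integers, let $\delta>0$, and let $V_1,V_2,\ldots,V_n\subset\mathbb{C}^\ell$ be $k$-dimensional complex linear subspaces such that $V_i\cap V_{i'}=\{\vec{0}\}$ for all $i\neq i'\in[n]$. Suppose that for every $i_1\in[n]$ there exist at least $\delta n$ values of $i_2\in[n]\setminus\{i_1\}$ such that $V_{i_1}+V_{i_2}$ contains some $V_{i_3}$ with $i_3\notin\{i_1,i_2\}$. Then $$\dim(V_1+V_2+\cdots+V_n)\leq C\,k^4/\delta^2.$$
   Context: $V+U$ denotes the subspace spanned by all vectors in $V\cup U$. The theorem's conclusion is printed in the paper as $\dim(V_1+\cdots+V_n)=O(k^4/\delta^2)$ with $O$ hiding an absolute constant. *)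

theory Defs
  imports Complex_Main "HOL-Library.Function_Algebras"
begin

text \<open>
  Since the constant in the theorem must not depend on the ambient dimension \<open>l\<close>, the
  dimension cannot be a type. Vectors are functions \<open>nat \<Rightarrow> complex\<close>, and \<open>cspace l\<close>, the
  functions supported on the first \<open>l\<close> coordinates, plays the role of complex \<open>l\<close>-space.
  Subspaces, spans and dimensions are over the complex numbers.
\<close>

definition cscale :: "complex \<Rightarrow> (nat \<Rightarrow> complex) \<Rightarrow> (nat \<Rightarrow> complex)" where
  "cscale c v = (\<lambda>i. c * v i)"

global_interpretation cvec: vector_space cscale
  by unfold_locales (simp_all add: cscale_def fun_eq_iff algebra_simps)

definition cspace :: "nat \<Rightarrow> (nat \<Rightarrow> complex) set" where
  "cspace l = {v. \<forall>i\<ge>l. v i = 0}"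

lemma subspace_cspace: "cvec.subspace (cspace l)"
  by (auto simp: cvec.subspace_def cspace_def cscale_def)

lemma dim_cspace: "cvec.dim (cspace l) = l"
proof -
  define e :: "nat \<Rightarrow> nat \<Rightarrow> complex" where "e = (\<lambda>i j. if j = i then 1 else 0)"
  have inj: "inj e"
    by (rule injI) (metis e_def zero_neq_one)
  have eval: "(\<Sum>i\<in>A. cscale (u i) (e i)) j = (if j \<in> A then u j else 0)"
    if "finite A" for A u j
    using that by (induction A rule: finite_induct) (auto simp: cscale_def e_def)
  have ind: "cvec.independent (e ` {..<l})"
  proof (rule cvec.independent_if_scalars_zero)
    fix f x assume z: "(\<Sum>x\<in>e ` {..<l}. cscale (f x) x) = 0" and x: "x \<in> e ` {..<l}"
    then obtain i where i: "i < l" "x = e i" by auto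
    have "(\<Sum>i<l. cscale (f (e i)) (e i)) = 0"
      using z inj by (simp add: sum.reindex inj_on_subset)
    from fun_cong[OF this, of i] show "f x = 0"
      using i eval[of "{..<l}" "\<lambda>i. f (e i)" i] by simp
  qed simp
  have "v \<in> cvec.span (e ` {..<l})" if "v \<in> cspace l" for v
  proof -
    have "v = (\<Sum>i<l. cscale (v i) (e i))"
      using that by (auto simp: fun_eq_iff eval cspace_def)
    also have "\<dots> \<in> cvec.span (e ` {..<l})"
      by (intro cvec.span_sum cvec.span_scale cvec.span_base) auto
    finally show ?thesis .
  qed
  then have "cspace l \<subseteq> cvec.span (e ` {..<l})" by blast
  moreover have "e ` {..<l} \<subseteq> cspace l"
    by (auto simp: e_def cspace_def)
  ultimately have "cvec.dim (cspace l) = card (e ` {..<l})"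
    using ind by (metis cvec.basis_card_eq_dim)
  also have "\<dots> = l"
    using inj by (simp add: card_image inj_on_subset)
  finally show ?thesis .
qed

end

theory Submission
  imports Defs "Jordan_Normal_Form.Schur_Decomposition" "HOL-Analysis.Function_Topology"
begin

text \<open>
  Write \<open>X\<close> for the span of all \<open>V\<^sub>i\<close>, viewed through the restriction maps \<open>r\<^sub>i\<close> of functionals to \<open>V\<^sub>i\<close>.
  Among the nonzero subspaces \<open>Y\<close> of functionals choose one of least slope
  \<open>\<sigma> = (\<Sum>\<^sub>i dim r\<^sub>i(Y)) / dim Y\<close>; then \<open>\<sigma> \<le> n k / dim X\<close>, and the maps \<open>r\<^sub>i\<close> on \<open>Y\<close>, of ranks \<open>k\<^sub>i \<le> k\<close>, are
  semistable. With \<open>d = dim Y\<close>, operator scaling therefore provides an inner product in which the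
  orthogonal projections \<open>P\<^sub>i\<close> attached to the \<open>r\<^sub>i\<close> almost satisfy \<open>\<Sum>\<^sub>i P\<^sub>i = \<sigma> 1\<close>; in particular
  \<open>\<Sum>\<^sub>i\<^sub>,\<^sub>j tr(P\<^sub>i P\<^sub>j) \<le> 2 \<sigma>\<^sup>2 d\<close> and \<open>\<Sum>\<^sub>i tr P\<^sub>i = \<sigma> d\<close>.

  The \<open>2k\<close>-dimensional spaces \<open>V\<^sub>a + V\<^sub>b\<close> behave like lines: any two of their members span them. On a
  line with \<open>r \<ge> 3\<close> members the sum \<open>Q\<close> of the projections has rank at most \<open>k\<^sub>a + k\<^sub>b\<close> for any two members
  \<open>a\<close>, \<open>b\<close>. Hence \<open>tr Q\<^sup>2 \<ge> r s / 2\<close> for \<open>s = tr Q\<close>, and the off-diagonal terms contribute at least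
  \<open>s (r - 1) / 4\<close>. Summing over all lines gives \<open>2 \<sigma>\<^sup>2 d \<ge> (\<delta> n / 4) \<sigma> d\<close>, that is \<open>\<sigma> \<ge> \<delta> n / 8\<close>, and so
  \<open>dim X \<le> 8 k / \<delta>\<close>; finally \<open>\<delta> \<le> 1 \<le> k\<close>.
\<close>

section \<open>Complex matrices and positive definiteness\<close>

text \<open>Isotropic position cannot be expected on all of \<open>X\<close>: when too many
  \<open>V i\<close> crowd into a small subspace, rescaling degenerates and the determinantal
  capacity has infimum 0. On a subspace of least slope every further subspace has slope at least
  \<sigma>, which keeps the capacity away from 0. The infimum may still not be attained, so an
  almost-minimiser is used. This costs the factor 2 in the trace bound; the lines cost a factor 4,
  whence the constant 8. Restricting to \<open>Y\<close> makes the ranks unequal, and some may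
  become 0. What survives is that a containment of \<open>V c\<close> in \<open>V a + V b\<close>
  makes the map of \<open>c\<close> factor through those of \<open>a\<close> and \<open>b\<close>.
  The line estimate uses only such factorisations and is averaged over all pairs of members, since
  no single pair controls the rank well. Positivity of the capacity comes from splitting
  \<open>H\<close> into a Cholesky factor, which stays in a compact set, and decreasing pivots,
  which are handled by summation by parts.\<close>

definition cadj :: "complex mat \<Rightarrow> complex mat" where
  "cadj A = map_mat cnj (transpose_mat A)"

lemma cadj_carrier [simp]: "cadj A \<in> carrier_mat m n \<longleftrightarrow> A \<in> carrier_mat n m"
  by (auto simp: cadj_def)

lemma cadj_dim [simp]: "dim_row (cadj A) = dim_col A" "dim_col (cadj A) = dim_row A"
  by (auto simp: cadj_def)

lemma cadj_index [simp]: "i < dim_col A \<Longrightarrow> j < dim_row A \<Longrightarrow> cadj A $$ (i,j) = cnj (A $$ (j,i))"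
  by (simp add: cadj_def)

lemma cadj_cadj [simp]: "cadj (cadj A) = A"
  by (intro eq_matI) auto

lemma cadj_one [simp]: "cadj (1\<^sub>m n) = 1\<^sub>m n"
  by (intro eq_matI) auto

lemma mult_mat_index:
  "A \<in> carrier_mat n m \<Longrightarrow> B \<in> carrier_mat m l \<Longrightarrow> i < n \<Longrightarrow> j < l \<Longrightarrow>
   (A * B) $$ (i,j) = (\<Sum>a<m. A $$ (i,a) * B $$ (a,j))"
  by (auto simp: scalar_prod_def atLeast0LessThan intro!: sum.cong)

lemma mult_mat_vec_index_sum:
  "A \<in> carrier_mat n m \<Longrightarrow> v \<in> carrier_vec m \<Longrightarrow> i < n \<Longrightarrow> (A *\<^sub>v v) $ i = (\<Sum>a<m. A $$ (i,a) * v $ a)"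
  by (auto simp: scalar_prod_def atLeast0LessThan intro!: sum.cong)

lemma cadj_mult:
  assumes "A \<in> carrier_mat n m" "B \<in> carrier_mat m l"
  shows "cadj (A * B) = cadj B * cadj A"
proof (rule eq_matI)
  fix i j assume "i < dim_row (cadj B * cadj A)" "j < dim_col (cadj B * cadj A)"
  then have ij: "i < l" "j < n" using assms by auto
  then have "cadj (A * B) $$ (i,j) = cnj ((A * B) $$ (j,i))" using assms by auto
  also have "\<dots> = (\<Sum>a<m. cadj B $$ (i,a) * cadj A $$ (a,j))"
    using assms ij by (subst mult_mat_index[of _ n m _ l]) (auto intro!: sum.cong)
  also have "\<dots> = (cadj B * cadj A) $$ (i,j)"
    by (rule mult_mat_index[symmetric]) (use assms ij in auto)
  finally show "cadj (A * B) $$ (i,j) = (cadj B * cadj A) $$ (i,j)" .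
qed (use assms in auto)

lemma cadj_add:
  assumes "A \<in> carrier_mat n m" "B \<in> carrier_mat n m"
  shows "cadj (A + B) = cadj A + cadj B"
  using assms by (intro eq_matI) auto

lemma cadj_smult: "cadj (c \<cdot>\<^sub>m A) = cnj c \<cdot>\<^sub>m cadj A"
  by (intro eq_matI) auto

lemma cscalar_sum: "v \<in> carrier_vec n \<Longrightarrow> w \<in> carrier_vec n \<Longrightarrow> v \<bullet>c w = (\<Sum>i<n. v $ i * cnj (w $ i))"
  by (auto simp: scalar_prod_def atLeast0LessThan intro!: sum.cong)

lemma cadj_inner:
  assumes "A \<in> carrier_mat n m" "v \<in> carrier_vec m" "w \<in> carrier_vec n"
  shows "(A *\<^sub>v v) \<bullet>c w = v \<bullet>c (cadj A *\<^sub>v w)"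
proof -
  have "(A *\<^sub>v v) \<bullet>c w = (\<Sum>i<n. \<Sum>a<m. A $$ (i,a) * v $ a * cnj (w $ i))"
    using assms by (subst cscalar_sum[of _ n])
      (auto simp: mult_mat_vec_index_sum[OF assms(1,2)] sum_distrib_right simp del: index_mult_mat_vec intro!: sum.cong)
  also have "\<dots> = (\<Sum>a<m. \<Sum>i<n. A $$ (i,a) * v $ a * cnj (w $ i))" by (rule sum.swap)
  also have "\<dots> = v \<bullet>c (cadj A *\<^sub>v w)"
    using assms by (subst cscalar_sum[of _ m])
      (auto simp: mult_mat_vec_index_sum[of "cadj A" m n] sum_distrib_left simp del: index_mult_mat_vec intro!: sum.cong)
  finally show ?thesis .
qed

definition mtrace :: "complex mat \<Rightarrow> complex" where
  "mtrace A = (\<Sum>i<dim_row A. A $$ (i,i))"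

lemma mtrace_comm:
  assumes "A \<in> carrier_mat n m" "B \<in> carrier_mat m n"
  shows "mtrace (A * B) = mtrace (B * A)"
proof -
  have "mtrace (A * B) = (\<Sum>i<n. \<Sum>a<m. A $$ (i,a) * B $$ (a,i))"
    using assms by (auto simp: mtrace_def mult_mat_index[OF assms] simp del: index_mult_mat(1) intro!: sum.cong)
  also have "\<dots> = (\<Sum>a<m. \<Sum>i<n. A $$ (i,a) * B $$ (a,i))" by (rule sum.swap)
  also have "\<dots> = mtrace (B * A)"
    using assms by (auto simp: mtrace_def mult_mat_index[OF assms(2,1)] mult.commute simp del: index_mult_mat(1) intro!: sum.cong)
  finally show ?thesis .
qed

lemma mtrace_one [simp]: "mtrace (1\<^sub>m n) = of_nat n"
  by (simp add: mtrace_def)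

lemma mtrace_smult: "A \<in> carrier_mat n n \<Longrightarrow> mtrace (c \<cdot>\<^sub>m A) = c * mtrace A"
  by (auto simp: mtrace_def sum_distrib_left)

text \<open>Matrices of unspecified size form no additive monoid, hence this sum with explicit dimensions.\<close>

definition msum :: "nat \<Rightarrow> nat \<Rightarrow> ('i \<Rightarrow> complex mat) \<Rightarrow> 'i set \<Rightarrow> complex mat" where
  "msum n m f I = mat n m (\<lambda>p. \<Sum>i\<in>I. f i $$ p)"

lemma msum_carrier [simp]: "msum n m f I \<in> carrier_mat n m"
  by (simp add: msum_def)

lemma msum_dim [simp]: "dim_row (msum n m f I) = n" "dim_col (msum n m f I) = m"
  by (simp_all add: msum_def)

lemma msum_index [simp]: "i < n \<Longrightarrow> j < m \<Longrightarrow> msum n m f I $$ (i,j) = (\<Sum>a\<in>I. f a $$ (i,j))"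
  by (simp add: msum_def)

lemma msum_mult_right:
  assumes "\<And>i. i \<in> I \<Longrightarrow> f i \<in> carrier_mat n m" "B \<in> carrier_mat m l"
  shows "msum n m f I * B = msum n l (\<lambda>i. f i * B) I"
proof (rule eq_matI)
  fix i j assume "i < dim_row (msum n l (\<lambda>i. f i * B) I)" "j < dim_col (msum n l (\<lambda>i. f i * B) I)"
  then have ij: "i < n" "j < l" by auto
  have "(msum n m f I * B) $$ (i,j) = (\<Sum>a<m. \<Sum>t\<in>I. f t $$ (i,a) * B $$ (a,j))"
    using ij assms by (subst mult_mat_index[of _ n m _ l]) (auto simp: sum_distrib_right)
  also have "\<dots> = (\<Sum>t\<in>I. \<Sum>a<m. f t $$ (i,a) * B $$ (a,j))" by (rule sum.swap)
  also have "\<dots> = (\<Sum>t\<in>I. (f t * B) $$ (i,j))"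
    using ij assms by (intro sum.cong) (auto simp: mult_mat_index[of _ n m _ l] simp del: index_mult_mat(1))
  finally show "(msum n m f I * B) $$ (i,j) = msum n l (\<lambda>i. f i * B) I $$ (i,j)"
    using ij by simp
qed (use assms in auto)

lemma msum_mult_left:
  assumes "\<And>i. i \<in> I \<Longrightarrow> f i \<in> carrier_mat n m" "B \<in> carrier_mat l n"
  shows "B * msum n m f I = msum l m (\<lambda>i. B * f i) I"
proof (rule eq_matI)
  fix i j assume "i < dim_row (msum l m (\<lambda>i. B * f i) I)" "j < dim_col (msum l m (\<lambda>i. B * f i) I)"
  then have ij: "i < l" "j < m" by auto
  have "(B * msum n m f I) $$ (i,j) = (\<Sum>a<n. \<Sum>t\<in>I. B $$ (i,a) * f t $$ (a,j))"
    using ij assms by (subst mult_mat_index[of _ l n _ m]) (auto simp: sum_distrib_left)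
  also have "\<dots> = (\<Sum>t\<in>I. \<Sum>a<n. B $$ (i,a) * f t $$ (a,j))" by (rule sum.swap)
  also have "\<dots> = (\<Sum>t\<in>I. (B * f t) $$ (i,j))"
    using ij assms by (intro sum.cong) (auto simp: mult_mat_index[of _ l n _ m] simp del: index_mult_mat(1))
  finally show "(B * msum n m f I) $$ (i,j) = msum l m (\<lambda>i. B * f i) I $$ (i,j)"
    using ij by simp
qed (use assms in auto)

lemma mtrace_msum:
  assumes "\<And>i. i \<in> I \<Longrightarrow> f i \<in> carrier_mat n n"
  shows "mtrace (msum n n f I) = (\<Sum>i\<in>I. mtrace (f i))"
proof -
  have "mtrace (msum n n f I) = (\<Sum>j<n. \<Sum>i\<in>I. f i $$ (j,j))" by (simp add: mtrace_def)
  also have "\<dots> = (\<Sum>i\<in>I. \<Sum>j<n. f i $$ (j,j))" by (rule sum.swap)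
  also have "\<dots> = (\<Sum>i\<in>I. mtrace (f i))"
    using assms by (intro sum.cong) (auto simp: mtrace_def)
  finally show ?thesis .
qed

lemma cadj_msum:
  assumes "\<And>i. i \<in> I \<Longrightarrow> f i \<in> carrier_mat n m"
  shows "cadj (msum n m f I) = msum m n (\<lambda>i. cadj (f i)) I"
  using assms by (intro eq_matI) (auto intro!: sum.cong, metis cadj_index carrier_matD)

lemma msum_cong:
  "(\<And>i. i \<in> I \<Longrightarrow> f i = g i) \<Longrightarrow> msum n m f I = msum n m g I"
  by (simp add: msum_def)

lemma msum_inner:
  assumes "\<And>i. i \<in> I \<Longrightarrow> f i \<in> carrier_mat n n" "v \<in> carrier_vec n"
  shows "(msum n n f I *\<^sub>v v) \<bullet>c v = (\<Sum>i\<in>I. (f i *\<^sub>v v) \<bullet>c v)"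
proof -
  have "msum n n f I *\<^sub>v v \<in> carrier_vec n"
    using assms by (auto intro!: mult_mat_vec_carrier[of _ n n])
  then have "(msum n n f I *\<^sub>v v) \<bullet>c v = (\<Sum>a<n. \<Sum>b<n. \<Sum>i\<in>I. f i $$ (a,b) * v $ b * cnj (v $ a))"
    using assms by (subst cscalar_sum[of _ n])
      (auto simp: mult_mat_vec_index_sum[of _ n n] sum_distrib_right simp del: index_mult_mat_vec intro!: sum.cong)
  also have "\<dots> = (\<Sum>i\<in>I. \<Sum>a<n. \<Sum>b<n. f i $$ (a,b) * v $ b * cnj (v $ a))"
  proof -
    have "(\<Sum>i\<in>I. \<Sum>a<n. \<Sum>b<n. f i $$ (a,b) * v $ b * cnj (v $ a))
        = (\<Sum>a<n. \<Sum>i\<in>I. \<Sum>b<n. f i $$ (a,b) * v $ b * cnj (v $ a))" by (rule sum.swap)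
    also have "\<dots> = (\<Sum>a<n. \<Sum>b<n. \<Sum>i\<in>I. f i $$ (a,b) * v $ b * cnj (v $ a))"
      by (intro sum.cong[OF refl] sum.swap)
    finally show ?thesis by simp
  qed
  also have "\<dots> = (\<Sum>i\<in>I. (f i *\<^sub>v v) \<bullet>c v)"
  proof (rule sum.cong[OF refl])
    fix i assume i: "i \<in> I"
    show "(\<Sum>a<n. \<Sum>b<n. f i $$ (a,b) * v $ b * cnj (v $ a)) = (f i *\<^sub>v v) \<bullet>c v"
      using assms(2) assms(1)[OF i] by (subst cscalar_sum[of _ n])
        (auto simp: mult_mat_vec_index_sum[of _ n n] sum_distrib_right simp del: index_mult_mat_vec intro!: sum.cong)
  qed
  finally show ?thesis .
qed

section \<open>Hermitian forms, positivity and congruence\<close>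

definition herm :: "nat \<Rightarrow> complex mat \<Rightarrow> bool" where
  "herm n A \<longleftrightarrow> A \<in> carrier_mat n n \<and> cadj A = A"

text \<open>The inequality is in the partial order of the complex numbers, so it also says that the
  value is real.\<close>

definition psd :: "nat \<Rightarrow> complex mat \<Rightarrow> bool" where
  "psd n A \<longleftrightarrow> herm n A \<and> (\<forall>v\<in>carrier_vec n. 0 \<le> (A *\<^sub>v v) \<bullet>c v)"

definition pdef :: "nat \<Rightarrow> complex mat \<Rightarrow> bool" where
  "pdef n A \<longleftrightarrow> herm n A \<and> (\<forall>v\<in>carrier_vec n. v \<noteq> 0\<^sub>v n \<longrightarrow> 0 < (A *\<^sub>v v) \<bullet>c v)"

lemma pdef_psd: "pdef n A \<Longrightarrow> psd n A"
  unfolding pdef_def psd_def herm_def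
  by (metis carrier_vec_conjugate carrier_vecI dim_mult_mat_vec carrier_matD(1) conjugate_zero_vec less_imp_le order_refl scalar_prod_right_zero)

lemma hermD: "herm n A \<Longrightarrow> A \<in> carrier_mat n n" "herm n A \<Longrightarrow> cadj A = A"
  by (auto simp: herm_def)

lemma psd_herm: "psd n A \<Longrightarrow> herm n A" by (simp add: psd_def)

lemma pdef_herm: "pdef n A \<Longrightarrow> herm n A" by (simp add: pdef_def)

lemma pdef_carrier: "pdef n A \<Longrightarrow> A \<in> carrier_mat n n" by (simp add: pdef_def herm_def)

lemma psd_carrier: "psd n A \<Longrightarrow> A \<in> carrier_mat n n" by (simp add: psd_def herm_def)

lemma pdef_one: "pdef n (1\<^sub>m n)"
  by (auto simp: pdef_def herm_def)

lemma pdef_add_psd: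
  assumes "pdef n A" "psd n B" shows "pdef n (A + B)"
proof -
  have c: "A \<in> carrier_mat n n" "B \<in> carrier_mat n n" using assms by (auto simp: pdef_carrier psd_carrier)
  have "0 < ((A + B) *\<^sub>v v) \<bullet>c v" if "v \<in> carrier_vec n" "v \<noteq> 0\<^sub>v n" for v
  proof -
    have "((A + B) *\<^sub>v v) \<bullet>c v = (A *\<^sub>v v) \<bullet>c v + (B *\<^sub>v v) \<bullet>c v"
      using c that by (simp add: add_mult_distrib_mat_vec[of _ n n] add_scalar_prod_distrib[of _ n])
    then show ?thesis using assms that by (auto simp: pdef_def psd_def intro: add_pos_nonneg)
  qed
  then show ?thesis using assms c by (auto simp: pdef_def psd_def herm_def cadj_add[OF c])
qed

lemma psd_msum:
  assumes "\<And>i. i \<in> I \<Longrightarrow> psd n (f i)" shows "psd n (msum n n f I)"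
proof -
  have c: "\<And>i. i \<in> I \<Longrightarrow> f i \<in> carrier_mat n n" using assms psd_carrier by auto
  have "cadj (msum n n f I) = msum n n f I"
    using assms by (subst cadj_msum) (auto simp: c psd_def herm_def intro!: msum_cong)
  moreover have "0 \<le> (msum n n f I *\<^sub>v v) \<bullet>c v" if "v \<in> carrier_vec n" for v
    using assms that by (subst msum_inner) (auto simp: c psd_def intro!: sum_nonneg)
  ultimately show ?thesis by (auto simp: psd_def herm_def)
qed

lemma herm_congruence:
  assumes "herm n H" "A \<in> carrier_mat m n"
  shows "herm m (A * H * cadj A)"
  using assms hermD[OF assms(1)]
  by (auto simp: herm_def cadj_mult[of A m n _ m] cadj_mult[of H n n _ m])

lemma congruence_inner:
  assumes "H \<in> carrier_mat n n" "A \<in> carrier_mat m n" "v \<in> carrier_vec m"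
  shows "((A * H * cadj A) *\<^sub>v v) \<bullet>c v = (H *\<^sub>v (cadj A *\<^sub>v v)) \<bullet>c (cadj A *\<^sub>v v)"
proof -
  have [simp]: "cadj A \<in> carrier_mat n m" using assms by simp
  have 1: "(A * H * cadj A) *\<^sub>v v = A *\<^sub>v (H *\<^sub>v (cadj A *\<^sub>v v))"
    using assms by (simp add: assoc_mult_mat_vec[of A m n _ m] assoc_mult_mat_vec[of H n n _ m])
  show ?thesis unfolding 1
    by (rule cadj_inner[of A m n]) (use assms in auto)
qed

lemma psd_congruence:
  assumes "psd n H" "A \<in> carrier_mat m n"
  shows "psd m (A * H * cadj A)"
  unfolding psd_def
proof safe
  show "herm m (A * H * cadj A)" using assms herm_congruence psd_herm by blast
  fix v :: "complex vec" assume v: "v \<in> carrier_vec m"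
  have "cadj A *\<^sub>v v \<in> carrier_vec n" using assms v by (auto intro!: mult_mat_vec_carrier[of _ n m])
  then show "0 \<le> ((A * H * cadj A) *\<^sub>v v) \<bullet>c v"
    using assms v by (subst congruence_inner[of H n]) (auto simp: psd_def herm_def)
qed

lemma pdef_congruence:
  assumes "pdef n H" "A \<in> carrier_mat m n"
    and "\<And>v. v \<in> carrier_vec m \<Longrightarrow> cadj A *\<^sub>v v = 0\<^sub>v n \<Longrightarrow> v = 0\<^sub>v m"
  shows "pdef m (A * H * cadj A)"
  unfolding pdef_def
proof safe
  show "herm m (A * H * cadj A)" using assms herm_congruence pdef_herm by blast
  fix v :: "complex vec" assume v: "v \<in> carrier_vec m" "v \<noteq> 0\<^sub>v m"
  have "cadj A *\<^sub>v v \<in> carrier_vec n" using assms v by (auto intro!: mult_mat_vec_carrier[of _ n m])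
  moreover have "cadj A *\<^sub>v v \<noteq> 0\<^sub>v n" using assms(3) v by blast
  ultimately show "0 < ((A * H * cadj A) *\<^sub>v v) \<bullet>c v"
    using assms(1,2) v by (subst congruence_inner[of H n]) (auto simp: pdef_def herm_def)
qed

lemma pdef_smult:
  assumes "pdef n A" "(0::real) < c" shows "pdef n (complex_of_real c \<cdot>\<^sub>m A)"
proof -
  have "0 < ((complex_of_real c \<cdot>\<^sub>m A) *\<^sub>v v) \<bullet>c v" if "v \<in> carrier_vec n" "v \<noteq> 0\<^sub>v n" for v
  proof -
    have "(complex_of_real c \<cdot>\<^sub>m A) *\<^sub>v v = complex_of_real c \<cdot>\<^sub>v (A *\<^sub>v v)"
      using pdef_carrier[OF assms(1)] that by (auto intro!: eq_vecI)
    then have "((complex_of_real c \<cdot>\<^sub>m A) *\<^sub>v v) \<bullet>c v = complex_of_real c * ((A *\<^sub>v v) \<bullet>c v)"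
      using pdef_carrier[OF assms(1)] that by simp
    moreover have "0 < (A *\<^sub>v v) \<bullet>c v" using assms that by (simp add: pdef_def)
    ultimately show ?thesis using assms(2) by (simp add: less_complex_def)
  qed
  then show ?thesis using assms by (auto simp: pdef_def herm_def cadj_smult)
qed

lemma pdef_inverse:
  assumes "pdef n A"
  obtains B where "pdef n B" "A * B = 1\<^sub>m n" "B * A = 1\<^sub>m n"
proof -
  have A: "A \<in> carrier_mat n n" using assms by (rule pdef_carrier)
  have "det A \<noteq> 0"
  proof
    assume "det A = 0"
    then obtain v where v: "v \<in> carrier_vec n" "v \<noteq> 0\<^sub>v n" "A *\<^sub>v v = 0\<^sub>v n"
      using det_0_iff_vec_prod_zero_field[OF A] by auto
    then have "(A *\<^sub>v v) \<bullet>c v = 0" by simp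
    with assms v show False by (auto simp: pdef_def)
  qed
  from det_non_zero_imp_unit[OF A this, of "()"] obtain B where
    B: "B \<in> carrier_mat n n" "A * B = 1\<^sub>m n" "B * A = 1\<^sub>m n"
    by (auto simp: Units_def ring_mat_def)
  have "cadj B * A = 1\<^sub>m n"
    using cadj_mult[OF A B(1)] B(2) hermD(2)[OF pdef_herm[OF assms]] by simp
  then have "cadj B = B" using A B assoc_mult_mat[of "cadj B" n n A n B n]
    by simp
  \<comment> \<open>This matrix equals \<open>B\<close>, so the inverse inherits positivity from
    \<open>A\<close> by congruence.\<close>
  have "pdef n (B * A * cadj B)"
  proof (rule pdef_congruence[OF assms B(1)])
    fix v :: "complex vec" assume v: "v \<in> carrier_vec n" "cadj B *\<^sub>v v = 0\<^sub>v n"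
    have "v = (A * B) *\<^sub>v v" using B v by simp
    also have "\<dots> = A *\<^sub>v (B *\<^sub>v v)" by (rule assoc_mult_mat_vec[OF A B(1) v(1)])
    also have "\<dots> = 0\<^sub>v n" using v \<open>cadj B = B\<close> A by (auto intro!: eq_vecI)
    finally show "v = 0\<^sub>v n" .
  qed
  then have "pdef n B" using B \<open>cadj B = B\<close> by simp
  with B that show ?thesis by blast
qed

section \<open>Spectra of products of Hermitian matrices\<close>

text \<open>Similarity to a triangular matrix preserves all the quantities involved, and for
  triangular matrices they can be read off the diagonal; this includes the trace of the square,
  since squaring a triangular matrix squares its diagonal entries.\<close>

lemma schur_spectrum:
  fixes A :: "complex mat"
  assumes A: "A \<in> carrier_mat n n"
  obtains e where "\<And>i. i < n \<Longrightarrow> eigenvalue A (e i)"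
    "mtrace A = (\<Sum>i<n. e i)" "mtrace (A * A) = (\<Sum>i<n. (e i)\<^sup>2)"
    "det A = (\<Prod>i<n. e i)" "det (1\<^sub>m n + A) = (\<Prod>i<n. 1 + e i)"
proof -
  from char_poly_factorized[OF A] obtain es where
    es: "char_poly A = (\<Prod>e\<leftarrow>es. [:- e, 1:])" "length es = n" by auto
  obtain B P Q where sd: "schur_decomposition A es = (B,P,Q)" by (cases "schur_decomposition A es") auto
  from schur_decomposition[OF A es(1) sd] have
    w: "similar_mat_wit A B P Q" and ut: "upper_triangular B" and dg: "diag_mat B = es" by auto
  from similar_mat_witD2[OF A w] have c: "B \<in> carrier_mat n n" "P \<in> carrier_mat n n" "Q \<in> carrier_mat n n"
    and PQ: "P * Q = 1\<^sub>m n" "Q * P = 1\<^sub>m n" and AB: "A = P * B * Q" by auto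
  define e where "e i = B $$ (i,i)" for i
  have dgi: "es ! i = e i" if "i < n" for i
    using dg c that by (auto simp: diag_mat_def e_def)
  have tr: "mtrace (P * X * Q) = mtrace X" if X: "X \<in> carrier_mat n n" for X
  proof -
    have "mtrace (P * X * Q) = mtrace (Q * (P * X))" by (rule mtrace_comm) (use c X in auto)
    also have "Q * (P * X) = X" using c X PQ by (simp add: assoc_mult_mat[of Q n n P n X n, symmetric] del: assoc_mult_mat)
    finally show ?thesis .
  qed
  have BB: "(B * B) $$ (i,i) = (e i)\<^sup>2" if i: "i < n" for i
  proof -
    have "(B * B) $$ (i,i) = (\<Sum>a<n. B $$ (i,a) * B $$ (a,i))" using c i by (intro mult_mat_index)
    also have "\<dots> = (\<Sum>a<n. if a = i then (e i)\<^sup>2 else 0)"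
    proof (rule sum.cong[OF refl])
      fix a assume "a \<in> {..<n}"
      then show "B $$ (i,a) * B $$ (a,i) = (if a = i then (e i)\<^sup>2 else 0)"
        using ut c i by (cases a i rule: linorder_cases) (auto simp: e_def power2_eq_square upper_triangular_def)
    qed
    finally show ?thesis using i by simp
  qed
  show ?thesis
  proof (rule that)
    show "eigenvalue A (e i)" if i: "i < n" for i
      unfolding eigenvalue_root_char_poly[OF A] es(1)
      using nth_mem[of i es] i es(2) dgi[OF i] by (auto simp: poly_prod_list prod_list_zero_iff)
    show "mtrace A = (\<Sum>i<n. e i)" unfolding AB tr[OF c(1)] using c by (simp add: mtrace_def e_def)
    have "A * A = P * (B * B) * Q"
    proof -
      have "P * B * Q * (P * B * Q) = P * B * (Q * P) * (B * Q)" using c by (simp add: assoc_mult_mat[of _ n n _ n _ n])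
      then show ?thesis unfolding AB PQ using c by (simp add: assoc_mult_mat[of _ n n _ n _ n])
    qed
    then show "mtrace (A * A) = (\<Sum>i<n. (e i)\<^sup>2)" using c BB tr[of "B * B"]
      by (simp add: mtrace_def del: index_mult_mat(1))
    have dB: "det X = (\<Prod>i<n. X $$ (i,i))" if "X \<in> carrier_mat n n" "upper_triangular X" for X :: "complex mat"
      using det_upper_triangular[OF that(2,1)] that prod_list_diag_prod[of X] by (simp add: atLeast0LessThan)
    have "det A = det B" using w by (intro det_similar) (auto simp: similar_mat_def)
    then show "det A = (\<Prod>i<n. e i)" using dB[OF c(1) ut] by (simp add: e_def)
    have "similar_mat_wit (1\<^sub>m n + A) (1\<^sub>m n + B) P Q"
    proof (rule similar_mat_witI[OF PQ])
      have "P * (1\<^sub>m n + B) = P + P * B" using c by (subst mult_add_distrib_mat[of _ n n _ n]) auto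
      moreover have "(P + P * B) * Q = P * Q + P * B * Q"
        using c by (intro add_mult_distrib_mat[of _ n n _ _ n]) auto
      ultimately show "1\<^sub>m n + A = P * (1\<^sub>m n + B) * Q" unfolding AB PQ by simp
    qed (use c A in auto)
    then have "det (1\<^sub>m n + A) = det (1\<^sub>m n + B)" by (intro det_similar) (auto simp: similar_mat_def)
    also have "\<dots> = (\<Prod>i<n. 1 + e i)"
      using c ut by (subst dB) (auto simp: e_def upper_triangular_def)
    finally show "det (1\<^sub>m n + A) = (\<Prod>i<n. 1 + e i)" .
  qed
qed

text \<open>The product \<open>Y * H\<close> is not Hermitian but self-adjoint for the inner product
  given by \<open>H\<close>. Pairing the eigenvector equation with \<open>u = H v\<close> turns the
  eigenvalue into a value of the form \<open>Y\<close> divided by a positive number, so no square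
  root of \<open>H\<close> is required.\<close>

lemma eigenvalue_herm_mult_pdef:
  assumes Y: "herm n Y" and H: "pdef n H" and ev: "eigenvalue (Y * H) x"
  obtains u c where "u \<in> carrier_vec n" "u \<noteq> 0\<^sub>v n" "c > 0" "(Y *\<^sub>v u) \<bullet>c u = x * c" "x \<in> \<real>"
proof -
  have c: "Y \<in> carrier_mat n n" "H \<in> carrier_mat n n" using Y H by (auto simp: hermD pdef_carrier)
  from ev c obtain v where v: "v \<in> carrier_vec n" "v \<noteq> 0\<^sub>v n" "(Y * H) *\<^sub>v v = x \<cdot>\<^sub>v v"
    by (auto simp: eigenvalue_def eigenvector_def)
  define u where "u = H *\<^sub>v v"
  have u: "u \<in> carrier_vec n" using c v by (auto simp: u_def)
  define p where "p = (H *\<^sub>v v) \<bullet>c v"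
  have p: "p > 0" using H v by (auto simp: pdef_def p_def)
  have Yu: "Y *\<^sub>v u = x \<cdot>\<^sub>v v" using v c by (simp add: u_def)
  have vu: "v \<bullet>c u = p"
    using cadj_inner[of H n n v v] c v hermD(2)[OF pdef_herm[OF H]] by (simp add: u_def p_def)
  have Yuu: "(Y *\<^sub>v u) \<bullet>c u = x * p" using u v vu by (simp add: Yu)
  have "u \<noteq> 0\<^sub>v n"
  proof
    assume "u = 0\<^sub>v n" then have "p = 0" using v by (simp add: p_def u_def)
    with p show False by simp
  qed
  moreover have "x \<in> \<real>"
  proof -
    have "(Y *\<^sub>v u) \<bullet>c u = u \<bullet>c (Y *\<^sub>v u)"
      using cadj_inner[of Y n n u u] c u hermD(2)[OF Y] by simp
    also have "\<dots> = cnj ((Y *\<^sub>v u) \<bullet>c u)"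
      using c u cscalar_sum[of u n "Y *\<^sub>v u"] cscalar_sum[of "Y *\<^sub>v u" n u] by (simp add: mult.commute del: index_mult_mat_vec)
    finally have "cnj (x * p) = x * p" unfolding Yuu by simp
    moreover have "cnj p = p" using p by (simp add: less_complex_def complex_eq_iff)
    ultimately have "cnj x = x" using p by auto
    then show ?thesis by (simp add: Reals_cnj_iff)
  qed
  ultimately show ?thesis using u p Yuu that by blast
qed

lemma complex_pos_mult_cancel:
  fixes x c :: complex
  assumes "x \<in> \<real>" "c > 0"
  shows "0 \<le> x * c \<longleftrightarrow> 0 \<le> Re x" "0 < x * c \<longleftrightarrow> 0 < Re x"
  using assms by (auto simp: less_complex_def less_eq_complex_def complex_is_Real_iff zero_le_mult_iff zero_less_mult_iff)

text \<open>The common interface for all later spectral estimates: traces and determinants of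
  \<open>Y * H\<close> become sums and products of real numbers whose signs are governed by
  \<open>Y\<close>.\<close>

lemma spectrum_herm_pdef:
  assumes Y: "herm n Y" and H: "pdef n H"
  obtains x :: "nat \<Rightarrow> real" where
    "mtrace (Y * H) = of_real (\<Sum>i<n. x i)" "mtrace (Y * H * (Y * H)) = of_real (\<Sum>i<n. (x i)\<^sup>2)"
    "det (Y * H) = of_real (\<Prod>i<n. x i)" "det (1\<^sub>m n + Y * H) = of_real (\<Prod>i<n. 1 + x i)"
    "psd n Y \<longrightarrow> (\<forall>i<n. 0 \<le> x i)" "pdef n Y \<longrightarrow> (\<forall>i<n. 0 < x i)"
proof -
  have "Y * H \<in> carrier_mat n n" using hermD(1)[OF Y] pdef_carrier[OF H] by simp
  from schur_spectrum[OF this] obtain e where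
    e: "\<And>i. i < n \<Longrightarrow> eigenvalue (Y * H) (e i)"
    "mtrace (Y * H) = (\<Sum>i<n. e i)" "mtrace (Y * H * (Y * H)) = (\<Sum>i<n. (e i)\<^sup>2)"
    "det (Y * H) = (\<Prod>i<n. e i)" "det (1\<^sub>m n + Y * H) = (\<Prod>i<n. 1 + e i)" by blast
  define x where "x i = Re (e i)" for i
  have ex: "e i = of_real (x i)" if "i < n" for i
    using eigenvalue_herm_mult_pdef[OF Y H e(1)[OF that]] by (metis of_real_Re x_def)
  show ?thesis
  proof (rule that)
    have "0 \<le> x i" if "psd n Y" "i < n" for i
      using eigenvalue_herm_mult_pdef[OF Y H e(1)[OF that(2)]] that(1)
      by (metis complex_pos_mult_cancel(1) psd_def x_def)
    then show "psd n Y \<longrightarrow> (\<forall>i<n. 0 \<le> x i)" by blast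
    have "0 < x i" if "pdef n Y" "i < n" for i
      using eigenvalue_herm_mult_pdef[OF Y H e(1)[OF that(2)]] that(1)
      by (metis complex_pos_mult_cancel(2) pdef_def x_def)
    then show "pdef n Y \<longrightarrow> (\<forall>i<n. 0 < x i)" by blast
  qed (simp_all add: e(2-5) ex)
qed

lemma pdef_det_pos: assumes "pdef n H" shows "0 < det H"
proof -
  have "herm n (1\<^sub>m n)" using pdef_one pdef_herm by blast
  from spectrum_herm_pdef[OF this assms] obtain x :: "nat \<Rightarrow> real" where
    "det (1\<^sub>m n * H) = of_real (\<Prod>i<n. x i)" "pdef n (1\<^sub>m n) \<longrightarrow> (\<forall>i<n. 0 < x i)" by metis
  then show ?thesis using pdef_one[of n] pdef_carrier[OF assms]
    by (auto simp: less_complex_def simp del: of_real_prod intro!: prod_pos)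
qed

lemma pdef_det_Re: "pdef n H \<Longrightarrow> det H = of_real (Re (det H))" "pdef n H \<Longrightarrow> 0 < Re (det H)"
  using pdef_det_pos[of n H] by (auto simp: less_complex_def complex_eq_iff)

text \<open>Factoring out \<open>C\<close> leaves the determinant of \<open>1 + N * B\<close> with
  \<open>B\<close> the inverse of \<open>C\<close>, a product of factors \<open>1 + x i\<close> that
  are at least 1.\<close>

lemma det_mono_psd:
  assumes C: "pdef n C" and N: "psd n N"
  shows "Re (det C) \<le> Re (det (C + N))"
proof -
  have c: "C \<in> carrier_mat n n" "N \<in> carrier_mat n n" using C N by (auto simp: psd_carrier pdef_carrier)
  from pdef_inverse[OF C] obtain B where B: "pdef n B" "C * B = 1\<^sub>m n" "B * C = 1\<^sub>m n" by blast
  note cB = pdef_carrier[OF B(1)]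
  from spectrum_herm_pdef[OF psd_herm[OF N] B(1)] obtain x :: "nat \<Rightarrow> real" where
    x: "det (1\<^sub>m n + N * B) = of_real (\<Prod>i<n. 1 + x i)" "psd n N \<longrightarrow> (\<forall>i<n. 0 \<le> x i)" by metis
  have "C + N = (1\<^sub>m n + N * B) * C"
    using c cB B by (simp add: add_mult_distrib_mat[of _ n n])
  then have "det (C + N) = det (1\<^sub>m n + N * B) * det C"
    using c cB by (simp add: det_mult[of _ n])
  then have "det (C + N) = of_real ((\<Prod>i<n. 1 + x i) * Re (det C))"
    using x(1) pdef_det_Re(1)[OF C] by simp
  moreover have "1 \<le> (\<Prod>i<n. 1 + x i)" using x(2) N by (intro prod_ge_1) auto
  ultimately show ?thesis using pdef_det_Re(2)[OF C] by (simp del: of_real_prod of_real_mult)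
qed

text \<open>The arithmetic-geometric mean inequality in exponential form:
  \<open>x <= exp (x - 1)\<close> is applied to every eigenvalue.\<close>

lemma det_le_exp_trace:
  assumes K: "psd n K" and B: "pdef n B"
  shows "Re (det (K * B)) \<le> exp (Re (mtrace (K * B)) - real n)"
proof -
  from spectrum_herm_pdef[OF psd_herm[OF K] B] obtain x :: "nat \<Rightarrow> real" where
    x: "mtrace (K * B) = of_real (\<Sum>i<n. x i)" "det (K * B) = of_real (\<Prod>i<n. x i)"
    "psd n K \<longrightarrow> (\<forall>i<n. 0 \<le> x i)" by metis
  have "(\<Prod>i<n. x i) \<le> (\<Prod>i<n. exp (x i - 1))"
    using x(3) K exp_ge_add_one_self[of "x _ - 1"] by (intro prod_mono) auto
  also have "\<dots> = exp (\<Sum>i<n. x i - 1)" by (simp add: exp_sum)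
  also have "(\<Sum>i<n. x i - 1) = (\<Sum>i<n. x i) - real n" by (simp add: sum_subtractf)
  finally show ?thesis using x(1,2) by (simp del: of_real_prod of_real_sum)
qed

section \<open>Column selection and weighted Gram matrices\<close>

lemma complex_nonneg_sq: "x * cnj x = of_real ((norm x)\<^sup>2)"
  by (metis complex_norm_square)

text \<open>Columns are padded with zeros to functions on all naturals, which makes the dimension
  theory of \<open>cvec\<close> available for matrices.\<close>

definition colf :: "complex mat \<Rightarrow> nat \<Rightarrow> nat \<Rightarrow> complex" where
  "colf M j = (\<lambda>a. if a < dim_row M then M $$ (a,j) else 0)"

text \<open>The pivot columns of left-to-right elimination, that is, the lexicographically first
  basis among the columns.\<close>

definition greedy :: "complex mat \<Rightarrow> nat set" where
  "greedy M = {j. j < dim_col M \<and> colf M j \<notin> cvec.span (colf M ` {..<j})}"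

definition submat_cols :: "complex mat \<Rightarrow> nat set \<Rightarrow> complex mat" where
  "submat_cols M J = mat (dim_row M) (card J) (\<lambda>(a,b). M $$ (a, sorted_list_of_set J ! b))"

lemma colf_cspace: "colf M j \<in> cspace (dim_row M)"
  by (simp add: colf_def cspace_def)

lemma greedy_independent:
  assumes "m \<le> dim_col M"
  shows "inj_on (colf M) (greedy M \<inter> {..<m}) \<and> cvec.independent (colf M ` (greedy M \<inter> {..<m})) \<and>
    cvec.span (colf M ` (greedy M \<inter> {..<m})) = cvec.span (colf M ` {..<m})"
  using assms
proof (induction m)
  case 0
  then show ?case by (simp add: cvec.independent_empty)
next
  case (Suc m)
  let ?B = "greedy M \<inter> {..<m}"
  have IH: "inj_on (colf M) ?B" "cvec.independent (colf M ` ?B)"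
    "cvec.span (colf M ` ?B) = cvec.span (colf M ` {..<m})" using Suc by auto
  have S: "{..<Suc m} = insert m {..<m}" by auto
  show ?case
  proof (cases "m \<in> greedy M")
    case True
    then have n: "colf M m \<notin> cvec.span (colf M ` ?B)" using IH(3) by (simp add: greedy_def)
    have B: "greedy M \<inter> {..<Suc m} = insert m ?B" using True by auto
    have "colf M m \<notin> colf M ` ?B" using n cvec.span_base[of "colf M m" "colf M ` ?B"] by (rule contrapos_nn)
    then have "inj_on (colf M) (insert m ?B)" using IH(1) by (simp add: image_iff)
    moreover have "cvec.independent (colf M ` insert m ?B)" using IH(2) n by (simp add: cvec.independent_insertI)
    moreover have "cvec.span (colf M ` insert m ?B) = cvec.span (colf M ` insert m {..<m})"
      using IH(3) by (simp add: cvec.span_insert)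
    ultimately show ?thesis unfolding B unfolding S by simp
  next
    case False
    then have n: "colf M m \<in> cvec.span (colf M ` {..<m})" using Suc.prems by (simp add: greedy_def)
    have B: "greedy M \<inter> {..<Suc m} = ?B" using False by (auto simp: less_Suc_eq)
    have "cvec.span (colf M ` insert m {..<m}) = cvec.span (colf M ` {..<m})"
      using n by (simp add: cvec.span_redundant)
    then show ?thesis unfolding B unfolding S using IH by simp
  qed
qed

lemma finite_greedy [simp]: "finite (greedy M)"
  by (rule finite_subset[of _ "{..<dim_col M}"]) (auto simp: greedy_def)

lemma greedy_subset: "greedy M \<subseteq> {..<dim_col M}"
  by (auto simp: greedy_def)

text \<open>One index set records the ranks of all leading blocks of columns at once. Semistability,
  a condition on flags of subspaces, thereby becomes a counting condition on index sets.\<close>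

lemma card_greedy:
  assumes "m \<le> dim_col M"
  shows "card (greedy M \<inter> {..<m}) = cvec.dim (colf M ` {..<m})"
proof -
  note g = greedy_independent[OF assms]
  have "card (greedy M \<inter> {..<m}) = card (colf M ` (greedy M \<inter> {..<m}))"
    using g by (simp add: card_image)
  also have "\<dots> = cvec.dim (cvec.span (colf M ` (greedy M \<inter> {..<m})))"
    using g cvec.dim_eq_card_independent[of "colf M ` (greedy M \<inter> {..<m})"] by (metis cvec.dim_span)
  also have "\<dots> = cvec.dim (colf M ` {..<m})" using g by (metis cvec.dim_span)
  finally show ?thesis .
qed

lemma cspace_basis:
  obtains B where "finite B" "B \<subseteq> cspace l" "cvec.independent B" "cspace l \<subseteq> cvec.span B" "card B = l"
proof -
  obtain B where B: "B \<subseteq> cspace l" "cvec.independent B" "cspace l \<subseteq> cvec.span B" "card B = l"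
    using cvec.basis_exists[of "cspace l"] dim_cspace by metis
  \<comment> \<open>Only \<open>card B = l\<close> is known, and infinite sets have cardinality 0;
    the case \<open>l = 0\<close> therefore has to be excluded separately.\<close>
  have "finite B"
  proof (rule ccontr)
    assume inf: "infinite B"
    then have "l = 0" using B(4) by simp
    then have "cspace l \<subseteq> {0}" by (auto simp: cspace_def fun_eq_iff)
    then show False using B(1) inf by (meson finite.emptyI finite.insertI finite_subset subset_trans)
  qed
  with B that show ?thesis by blast
qed

lemma independent_cspace_finite:
  assumes "cvec.independent S" "S \<subseteq> cspace l"
  shows "finite S"
proof -
  obtain B where "finite B" "cspace l \<subseteq> cvec.span B" "card B = l" by (rule cspace_basis)
  then show ?thesis
    using cvec.independent_span_bound[of B S] assms by auto
qed

lemma dim_cspace_le: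
  assumes "S \<subseteq> cspace l" shows "cvec.dim S \<le> l"
proof -
  obtain B where "finite B" "cspace l \<subseteq> cvec.span B" "card B = l" by (rule cspace_basis)
  then show ?thesis using cvec.dim_le_card[of S B] assms by auto
qed

lemma bij_betw_sorted_list:
  "finite J \<Longrightarrow> bij_betw ((!) (sorted_list_of_set J)) {..<card J} J"
  by (rule bij_betw_nth) auto

lemma independent_family_zero:
  assumes "cvec.independent (f ` J)" "inj_on f J" "finite J" "(\<Sum>j\<in>J. cscale (c j) (f j)) = 0" "j \<in> J"
  shows "c j = 0"
proof -
  define u where "u x = c (the_inv_into J f x)" for x
  have "(\<Sum>x\<in>f ` J. cscale (u x) x) = (\<Sum>j\<in>J. cscale (c j) (f j))"
    using assms(2) by (simp add: sum.reindex u_def the_inv_into_f_f)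
  then have "u (f j) = 0"
    using assms cvec.independentD[of "f ` J" "f ` J" u "f j"] by auto
  then show ?thesis using assms(2,5) by (simp add: u_def the_inv_into_f_f)
qed

lemma sum_cscale_apply: "(\<Sum>j\<in>J. cscale (c j) (f j)) a = (\<Sum>j\<in>J. c j * f j a)"
  by (induction J rule: infinite_finite_induct) (auto simp: cscale_def)

lemma submat_greedy_inj:
  assumes v: "v \<in> carrier_vec (card (greedy M))" "submat_cols M (greedy M) *\<^sub>v v = 0\<^sub>v (dim_row M)"
  shows "v = 0\<^sub>v (card (greedy M))"
proof -
  let ?J = "greedy M" and ?k = "dim_row M" and ?q = "card (greedy M)"
  let ?s = "sorted_list_of_set ?J"
  let ?U = "submat_cols M ?J"
  have U: "?U \<in> carrier_mat ?k ?q" by (simp add: submat_cols_def)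
  have bij: "bij_betw ((!) ?s) {..<?q} ?J" using bij_betw_sorted_list[of ?J] by simp
  define g where "g = the_inv_into {..<?q} ((!) ?s)"
  have g: "g (?s ! b) = b" if "b < ?q" for b
    using bij that by (simp add: g_def the_inv_into_f_f bij_betw_def)
  have JJ: "?J \<inter> {..<dim_col M} = ?J" using greedy_subset by auto
  have ind: "inj_on (colf M) ?J" "cvec.independent (colf M ` ?J)"
    using greedy_independent[of "dim_col M" M] unfolding JJ by auto
  have sum0: "(\<Sum>j\<in>?J. cscale (v $ g j) (colf M j)) = 0"
  proof
    fix a
    have "(\<Sum>j\<in>?J. cscale (v $ g j) (colf M j)) a = (\<Sum>j\<in>?J. v $ g j * colf M j a)"
      by (rule sum_cscale_apply)
    also have "\<dots> = (\<Sum>b<?q. v $ g (?s ! b) * colf M (?s ! b) a)"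
      using sum.reindex_bij_betw[OF bij, of "\<lambda>j. v $ g j * colf M j a"] by simp
    also have "\<dots> = (\<Sum>b<?q. v $ b * colf M (?s ! b) a)" by (simp add: g)
    also have "\<dots> = 0"
    proof (cases "a < ?k")
      case True
      have "(\<Sum>b<?q. v $ b * colf M (?s ! b) a) = (?U *\<^sub>v v) $ a"
        using True by (subst mult_mat_vec_index_sum[OF U v(1) True])
          (auto simp: submat_cols_def colf_def mult.commute intro!: sum.cong)
      then show ?thesis using v True by simp
    qed (simp add: colf_def)
    finally show "(\<Sum>j\<in>?J. cscale (v $ g j) (colf M j)) a = 0 a" by simp
  qed
  have z: "v $ g j = 0" if "j \<in> ?J" for j
    by (rule independent_family_zero[OF ind(2,1) finite_greedy sum0 that])
  show ?thesis
  proof (rule eq_vecI)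
    fix b assume "b < dim_vec (0\<^sub>v ?q)"
    then have b: "b < ?q" by simp
    then have "?s ! b \<in> ?J" using bij by (auto simp: bij_betw_def)
    then show "v $ b = 0\<^sub>v ?q $ b" using z g[OF b] b by fastforce
  qed (use v in simp)
qed

lemma det_submat_greedy:
  assumes card: "card (greedy M) = dim_row M"
  shows "det (submat_cols M (greedy M)) \<noteq> 0"
proof
  have U: "submat_cols M (greedy M) \<in> carrier_mat (dim_row M) (dim_row M)" using card by (simp add: submat_cols_def)
  assume "det (submat_cols M (greedy M)) = 0"
  then show False using det_0_iff_vec_prod_zero_field[OF U] submat_greedy_inj[of _ M] card by auto
qed

text \<open>The matrix \<open>M D cadj M\<close> restricted to the columns in \<open>J\<close>.
  Given entrywise, it splits additively over disjoint sets of columns.\<close>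

definition wgram :: "complex mat \<Rightarrow> (nat \<Rightarrow> real) \<Rightarrow> nat set \<Rightarrow> complex mat" where
  "wgram M D J = mat (dim_row M) (dim_row M) (\<lambda>(a,b). \<Sum>j\<in>J. of_real (D j) * M $$ (a,j) * cnj (M $$ (b,j)))"

definition diagm :: "nat \<Rightarrow> (nat \<Rightarrow> real) \<Rightarrow> complex mat" where
  "diagm d D = mat d d (\<lambda>(i,j). if i = j then of_real (D i) else 0)"

lemma diagm_carrier [simp]: "diagm d D \<in> carrier_mat d d"
  by (simp add: diagm_def)

lemma mult_diagm_adjoint:
  assumes M: "M \<in> carrier_mat k d"
  shows "M * diagm d D * cadj M = wgram M D {..<d}"
proof (rule eq_matI)
  fix a b assume "a < dim_row (wgram M D {..<d})" "b < dim_col (wgram M D {..<d})"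
  then have ab: "a < k" "b < k" using M by (auto simp: wgram_def)
  have MD: "(M * diagm d D) $$ (a,j) = of_real (D j) * M $$ (a,j)" if j: "j < d" for j
  proof -
    have "(M * diagm d D) $$ (a,j) = (\<Sum>i<d. M $$ (a,i) * diagm d D $$ (i,j))"
      using M ab j by (intro mult_mat_index[of _ k d _ d]) auto
    also have "\<dots> = (\<Sum>i<d. if i = j then M $$ (a,j) * of_real (D j) else 0)"
      using ab j by (intro sum.cong) (auto simp: diagm_def)
    finally show ?thesis using j by simp
  qed
  have "(M * diagm d D * cadj M) $$ (a,b) = (\<Sum>j<d. (M * diagm d D) $$ (a,j) * cadj M $$ (j,b))"
    using M ab by (intro mult_mat_index[of _ k d _ k]) auto
  also have "\<dots> = (\<Sum>j<d. of_real (D j) * M $$ (a,j) * cnj (M $$ (b,j)))"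
    using ab M MD by (intro sum.cong[OF refl]) (simp del: index_mult_mat(1))
  finally show "(M * diagm d D * cadj M) $$ (a,b) = wgram M D {..<d} $$ (a,b)" using ab M by (simp add: wgram_def)
qed (use M in \<open>auto simp: wgram_def\<close>)

lemma wgram_submat:
  assumes M: "M \<in> carrier_mat k d" and J: "J \<subseteq> {..<d}"
  shows "submat_cols M J * diagm (card J) (\<lambda>b. D (sorted_list_of_set J ! b)) * cadj (submat_cols M J) = wgram M D J"
proof -
  have fin: "finite J" using J finite_subset by blast
  note bij = bij_betw_sorted_list[OF fin]
  have "submat_cols M J \<in> carrier_mat k (card J)" using M by (simp add: submat_cols_def)
  note mult_diagm_adjoint[OF this, of "\<lambda>b. D (sorted_list_of_set J ! b)"]
  also have "wgram (submat_cols M J) (\<lambda>b. D (sorted_list_of_set J ! b)) {..<card J} = wgram M D J"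
  proof (rule eq_matI)
    fix a b assume "a < dim_row (wgram M D J)" "b < dim_col (wgram M D J)"
    then have ab: "a < dim_row M" "b < dim_row M" using M by (auto simp: wgram_def)
    show "wgram (submat_cols M J) (\<lambda>b. D (sorted_list_of_set J ! b)) {..<card J} $$ (a,b) = wgram M D J $$ (a,b)"
      using ab sum.reindex_bij_betw[OF bij, of "\<lambda>j. of_real (D j) * M $$ (a,j) * cnj (M $$ (b,j))"]
      by (simp add: wgram_def submat_cols_def)
  qed (auto simp: wgram_def submat_cols_def)
  finally show ?thesis .
qed

lemma pdef_diagm:
  assumes "\<And>i. i < d \<Longrightarrow> 0 < D i" shows "pdef d (diagm d D)"
  unfolding pdef_def herm_def
proof (intro conjI ballI impI)
  show "cadj (diagm d D) = diagm d D" by (intro eq_matI) (auto simp: diagm_def)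
  fix v :: "complex vec" assume v: "v \<in> carrier_vec d" "v \<noteq> 0\<^sub>v d"
  have e: "(diagm d D *\<^sub>v v) $ i = of_real (D i) * v $ i" if "i < d" for i
  proof -
    have "(diagm d D *\<^sub>v v) $ i = (\<Sum>a<d. diagm d D $$ (i,a) * v $ a)"
      using that v by (intro mult_mat_vec_index_sum) auto
    also have "\<dots> = (\<Sum>a<d. if a = i then of_real (D i) * v $ i else 0)"
      using that by (intro sum.cong) (auto simp: diagm_def)
    finally show ?thesis using that by simp
  qed
  have "(diagm d D *\<^sub>v v) \<bullet>c v = (\<Sum>i<d. of_real (D i * (norm (v $ i))\<^sup>2))"
    using v by (subst cscalar_sum[of _ d])
      (auto intro!: sum.cong mult_mat_vec_carrier[of _ d d] simp: e complex_nonneg_sq mult.assoc simp del: index_mult_mat_vec)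
  also have "\<dots> = of_real (\<Sum>i<d. D i * (norm (v $ i))\<^sup>2)" by simp
  finally have q: "(diagm d D *\<^sub>v v) \<bullet>c v = of_real (\<Sum>i<d. D i * (norm (v $ i))\<^sup>2)" .
  obtain i where i: "i < d" "v $ i \<noteq> 0" using v by (metis carrier_vecD eq_vecI index_zero_vec(1) index_zero_vec(2))
  have "0 < (\<Sum>i<d. D i * (norm (v $ i))\<^sup>2)"
    using i assms by (intro sum_pos2[of _ i]) (auto simp: less_imp_le)
  then show "0 < (diagm d D *\<^sub>v v) \<bullet>c v" unfolding q by (simp add: less_complex_def del: of_real_sum)
qed simp

lemma det_diagm: "det (diagm d D) = of_real (\<Prod>i<d. D i)"
proof -
  have "det (diagm d D) = prod_list (diag_mat (diagm d D))"
    by (rule det_upper_triangular) (auto simp: diagm_def)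
  then show ?thesis by (simp add: prod_list_diag_prod diagm_def atLeast0LessThan)
qed

lemma det_cadj:
  assumes "A \<in> carrier_mat n n" shows "det (cadj A) = cnj (det A)"
proof -
  interpret cnj_hom: comm_ring_hom cnj by unfold_locales auto
  show ?thesis unfolding cadj_def using assms det_transpose[OF assms] cnj_hom.hom_det[of "A\<^sup>T"] by simp
qed

lemma det_congruence_diagm:
  assumes "U \<in> carrier_mat k k"
  shows "det (U * diagm k D * cadj U) = of_real ((\<Prod>i<k. D i) * (norm (det U))\<^sup>2)"
proof -
  have "det (U * diagm k D * cadj U) = det U * det (diagm k D) * det (cadj U)"
    using assms by (simp add: det_mult[of _ k])
  then show ?thesis using det_cadj[OF assms] det_diagm[of k D] complex_norm_square[of "det U"] by simp
qed

text \<open>The lower bound is a single term of the Cauchy-Binet expansion. Instead of expanding,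
  the columns outside \<open>J\<close> are split off as a positive semidefinite summand, which can
  only increase the determinant.\<close>

lemma wgram_minor:
  assumes M: "M \<in> carrier_mat k d" and J: "J \<subseteq> {..<d}" "card J = k"
    and D: "\<And>j. j < d \<Longrightarrow> 0 < D j" and nz: "det (submat_cols M J) \<noteq> 0"
  shows pdef_wgram: "pdef k (wgram M D {..<d})"
    and det_wgram_ge: "(\<Prod>j\<in>J. D j) * (norm (det (submat_cols M J)))\<^sup>2 \<le> Re (det (wgram M D {..<d}))"
proof -
  let ?U = "submat_cols M J" and ?E = "\<lambda>b. D (sorted_list_of_set J ! b)"
  have fin: "finite J" using J finite_subset by blast
  note bij = bij_betw_sorted_list[OF fin]
  have U: "?U \<in> carrier_mat k k" using M J by (simp add: submat_cols_def)
  have E: "0 < ?E b" if "b < k" for b using bij J that D by (auto simp: bij_betw_def)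
  have WJ: "wgram M D J = ?U * diagm k ?E * cadj ?U" using wgram_submat[OF M J(1)] J(2) by simp
  have pdJ: "pdef k (wgram M D J)" unfolding WJ
  proof (rule pdef_congruence[OF pdef_diagm U])
    fix v assume "v \<in> carrier_vec k" "cadj ?U *\<^sub>v v = 0\<^sub>v k"
    then show "v = 0\<^sub>v k" using det_0_iff_vec_prod_zero_field[of "cadj ?U" k] U nz det_cadj[OF U] by auto
  qed (use E in auto)
  define N where "N = wgram M D ({..<d} - J)"
  let ?K = "{..<d} - J"
  have N: "psd k N"
  proof -
    let ?s = "\<lambda>b. D (sorted_list_of_set ?K ! b)"
    have b: "bij_betw ((!) (sorted_list_of_set ?K)) {..<card ?K} ?K" by (rule bij_betw_sorted_list) simp
    have "psd (card ?K) (diagm (card ?K) ?s)" using b D by (intro pdef_psd pdef_diagm) (auto simp: bij_betw_def)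
    moreover have "submat_cols M ?K \<in> carrier_mat k (card ?K)" using M by (simp add: submat_cols_def)
    ultimately have "psd k (submat_cols M ?K * diagm (card ?K) ?s * cadj (submat_cols M ?K))"
      by (rule psd_congruence)
    then show ?thesis unfolding N_def wgram_submat[OF M Diff_subset] .
  qed
  have "wgram M D {..<d} = wgram M D J + N"
    using J M by (intro eq_matI) (auto simp: wgram_def N_def sum.subset_diff[OF J(1)])
  then show "pdef k (wgram M D {..<d})" using pdef_add_psd[OF pdJ N] by simp
  have "Re (det (wgram M D J)) \<le> Re (det (wgram M D {..<d}))"
    using det_mono_psd[OF pdJ N] \<open>wgram M D {..<d} = wgram M D J + N\<close> by simp
  moreover have "det (wgram M D J) = of_real ((\<Prod>i<k. ?E i) * (norm (det ?U))\<^sup>2)"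
    unfolding WJ by (rule det_congruence_diagm[OF U])
  moreover have "(\<Prod>i<k. ?E i) = (\<Prod>j\<in>J. D j)"
    using prod.reindex_bij_betw[OF bij, of D] J(2) by simp
  ultimately show "(\<Prod>j\<in>J. D j) * (norm (det ?U))\<^sup>2 \<le> Re (det (wgram M D {..<d}))"
    by (simp del: of_real_mult of_real_prod)
qed

section \<open>Pivoted Cholesky factorisation\<close>

text \<open>Diagonal pivoting keeps all entries of the unitriangular factor in the unit disc, so that the factors range over a
  compact set.\<close>

definition pivoted_cholesky_on ::
  "nat set \<Rightarrow> nat \<Rightarrow> (nat \<Rightarrow> nat \<Rightarrow> complex) \<Rightarrow> (nat \<Rightarrow> nat \<Rightarrow> complex) \<Rightarrow> (nat \<Rightarrow> real) \<Rightarrow> nat list \<Rightarrow> bool"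
where
  "pivoted_cholesky_on I d h l D ps \<longleftrightarrow> distinct ps \<and> set ps = I \<and>
    (\<forall>a\<in>I. \<forall>b\<in>I. h a b = (\<Sum>j<d. of_real (D j) * l j a * cnj (l j b))) \<and>
    (\<forall>j<d. \<forall>a\<in>I. norm (l j a) \<le> 1) \<and> (\<forall>j<d. 0 < D j) \<and> (\<forall>i j. i \<le> j \<longrightarrow> j < d \<longrightarrow> D j \<le> D i) \<and>
    (\<forall>M. (\<forall>a\<in>I. Re (h a a) \<le> M) \<longrightarrow> (\<forall>j<d. D j \<le> M)) \<and>
    (\<forall>j<d. l j (ps ! j) = 1) \<and> (\<forall>i j. i < j \<longrightarrow> j < d \<longrightarrow> l j (ps ! i) = 0)"

lemma pivoted_cholesky_onD:
  assumes "pivoted_cholesky_on I d h l D ps"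
  shows "distinct ps" "set ps = I"
    "\<And>a b. a \<in> I \<Longrightarrow> b \<in> I \<Longrightarrow> h a b = (\<Sum>j<d. of_real (D j) * l j a * cnj (l j b))"
    "\<And>j a. j < d \<Longrightarrow> a \<in> I \<Longrightarrow> norm (l j a) \<le> 1" "\<And>j. j < d \<Longrightarrow> 0 < D j"
    "\<And>i j. i \<le> j \<Longrightarrow> j < d \<Longrightarrow> D j \<le> D i"
    "\<And>M j. (\<And>a. a \<in> I \<Longrightarrow> Re (h a a) \<le> M) \<Longrightarrow> j < d \<Longrightarrow> D j \<le> M"
    "\<And>j. j < d \<Longrightarrow> l j (ps ! j) = 1" "\<And>i j. i < j \<Longrightarrow> j < d \<Longrightarrow> l j (ps ! i) = 0"
  using assms by (simp_all add: pivoted_cholesky_on_def)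

lemma pivoted_cholesky_fun:
  fixes h :: "nat \<Rightarrow> nat \<Rightarrow> complex"
  assumes "finite I" and "card I = d"
    and "\<forall>a\<in>I. \<forall>b\<in>I. h b a = cnj (h a b)"
    and "\<forall>x. (\<exists>a\<in>I. x a \<noteq> 0) \<longrightarrow> 0 < (\<Sum>a\<in>I. \<Sum>b\<in>I. cnj (x a) * h a b * x b)"
  shows "\<exists>l D ps. pivoted_cholesky_on I d h l D ps"
  using assms
proof (induction d arbitrary: I h)
  case 0
  have "I = {}" using "0.prems"(1,2) by simp
  then show ?case
    by (intro exI[of _ "\<lambda>_ _. 0"] exI[of _ "\<lambda>_. 0"] exI[of _ "[]"]) (auto simp: pivoted_cholesky_on_def)
next
  case (Suc d)
  note herm = Suc.prems(3)[rule_format] and pos = Suc.prems(4)[rule_format]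
  have "I \<noteq> {}" using Suc.prems(2) by auto
  let ?R = "(\<lambda>a. Re (h a a)) ` I"
  have "Max ?R \<in> ?R" using \<open>I \<noteq> {}\<close> Suc.prems(1) by (intro Max_in) auto
  then obtain p where "p \<in> I" "Max ?R = Re (h p p)" by auto
  then have p: "p \<in> I" and pmax: "\<And>a. a \<in> I \<Longrightarrow> Re (h a a) \<le> Re (h p p)"
    using Max_ge[of ?R] Suc.prems(1) by (blast, metis finite_imageI imageI)
  have diag: "h a a = of_real (Re (h a a))" if "a \<in> I" for a
    using herm[OF that that] by (simp add: complex_eq_iff)
  have dpos: "0 < Re (h a a)" if a: "a \<in> I" for a
  proof -
    have "0 < (\<Sum>c\<in>I. \<Sum>b\<in>I. cnj (if c = a then 1 else 0) * h c b * (if b = a then 1 else 0))"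
      using a by (intro pos[of "\<lambda>c. if c = a then 1 else 0"]) auto
    also have "\<dots> = (\<Sum>c\<in>I. if c = a then h a a else 0)"
      using a Suc.prems(1) by (intro sum.cong) (auto simp: if_distrib[of "\<lambda>x. _ * x"] cong: if_cong)
    also have "\<dots> = h a a" using a Suc.prems(1) by simp
    finally show ?thesis by (simp add: less_complex_def)
  qed
  define P where "P = Re (h p p)"
  have P: "h p p = of_real P" "0 < P" using diag[OF p] dpos[OF p] by (auto simp: P_def)
  define J where "J = I - {p}"
  \<comment> \<open>The Schur complement of the pivot.\<close>
  define g where "g a b = h a b - h a p * h p b / of_real P" for a b
  have IJ: "I = insert p J" "p \<notin> J" "finite J" "card J = d"
    using p Suc.prems(1,2) by (auto simp: J_def)
  have gherm: "g b a = cnj (g a b)" if "a \<in> J" "b \<in> J" for a b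
    using that IJ herm[of a b] herm[of a p] herm[of p b]
    by (simp add: g_def)
  have gpos: "0 < (\<Sum>a\<in>J. \<Sum>b\<in>J. cnj (x a) * g a b * x b)" if x: "\<exists>a\<in>J. x a \<noteq> 0" for x
  proof -
    define q where "q = (\<Sum>b\<in>J. h p b * x b)"
    \<comment> \<open>The coordinate at \<open>p\<close> is the one that minimises the form with the
      others fixed; the minimum is the value of the Schur complement at \<open>x\<close>.\<close>
    define y where "y a = (if a = p then - q / of_real P else x a)" for a
    have y: "y p = - q / of_real P" "\<And>a. a \<in> J \<Longrightarrow> y a = x a" using IJ by (auto simp: y_def)
    have cq: "(\<Sum>a\<in>J. cnj (x a) * h a p) = cnj q"
      unfolding q_def cnj_sum using IJ herm[of p] by (intro sum.cong) (auto simp: mult.commute)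
    define Q where "Q = (\<Sum>a\<in>J. \<Sum>b\<in>J. cnj (x a) * h a b * x b)"
    have "0 < (\<Sum>a\<in>I. \<Sum>b\<in>I. cnj (y a) * h a b * y b)"
      using x IJ by (intro pos) (auto simp: y)
    also have "\<dots> = cnj (y p) * h p p * y p + cnj (y p) * (\<Sum>b\<in>J. h p b * x b)
        + (\<Sum>a\<in>J. cnj (x a) * h a p) * y p + Q"
    proof -
      have inner: "(\<Sum>b\<in>I. cnj (y a) * h a b * y b) = cnj (y a) * h a p * y p + (\<Sum>b\<in>J. cnj (y a) * h a b * x b)" for a
        using IJ(2,3) by (simp add: IJ(1) y(2))
      have "(\<Sum>a\<in>I. \<Sum>b\<in>I. cnj (y a) * h a b * y b)
        = cnj (y p) * h p p * y p + (\<Sum>b\<in>J. cnj (y p) * h p b * x b)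
          + ((\<Sum>a\<in>J. cnj (x a) * h a p * y p) + Q)"
        unfolding inner using IJ(2,3) by (simp add: IJ(1) y(2) Q_def sum.distrib)
      then show ?thesis by (simp add: sum_distrib_left sum_distrib_right mult.assoc)
    qed
    also have "\<dots> = Q - cnj q * q / of_real P"
      unfolding cq q_def[symmetric] y P(1) using P(2) by (simp add: field_simps)
    also have "cnj q * q / of_real P = (\<Sum>a\<in>J. \<Sum>b\<in>J. cnj (x a) * (h a p * h p b / of_real P) * x b)"
      unfolding cq[symmetric] unfolding q_def sum_product sum_divide_distrib by (simp add: mult_ac)
    also have "Q - \<dots> = (\<Sum>a\<in>J. \<Sum>b\<in>J. cnj (x a) * g a b * x b)"
      by (simp add: Q_def g_def sum_subtractf[symmetric] algebra_simps)
    finally show ?thesis .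
  qed
  have "\<forall>a\<in>J. \<forall>b\<in>J. g b a = cnj (g a b)" using gherm by blast
  moreover have "\<forall>x. (\<exists>a\<in>J. x a \<noteq> 0) \<longrightarrow> 0 < (\<Sum>a\<in>J. \<Sum>b\<in>J. cnj (x a) * g a b * x b)"
    using gpos by blast
  ultimately obtain l D ps where C: "pivoted_cholesky_on J d g l D ps"
    using Suc.IH[OF IJ(3,4)] by blast
  note IH = pivoted_cholesky_onD[OF C]
  have len: "length ps = d" using IH(1,2) IJ(4) distinct_card by force
  define l' where "l' j = (case j of 0 \<Rightarrow> (\<lambda>a. h a p / of_real P) | Suc i \<Rightarrow> (\<lambda>a. if a = p then 0 else l i a))" for j
  define D' where "D' j = (case j of 0 \<Rightarrow> P | Suc i \<Rightarrow> D i)" for j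
  have gaa: "Re (g a a) = Re (h a a) - (norm (h a p))\<^sup>2 / P" if "a \<in> J" for a
  proof -
    have "h p a = cnj (h a p)" using that IJ herm[of a p] by auto
    then have "g a a = h a a - of_real ((norm (h a p))\<^sup>2 / P)"
      by (simp add: g_def complex_nonneg_sq del: of_real_power)
    then show ?thesis by simp
  qed
  have gpos': "0 < Re (g a a)" if a: "a \<in> J" for a
  proof -
    have "0 < (\<Sum>c\<in>J. \<Sum>b\<in>J. cnj (if c = a then 1 else 0) * g c b * (if b = a then 1 else 0))"
      using a by (intro gpos[of "\<lambda>c. if c = a then 1 else 0"]) auto
    also have "\<dots> = (\<Sum>c\<in>J. if c = a then g a a else 0)"
      using a IJ(3) by (intro sum.cong) (auto simp: if_distrib[of "\<lambda>x. _ * x"] cong: if_cong)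
    also have "\<dots> = g a a" using a IJ(3) by simp
    finally show ?thesis by (simp add: less_complex_def)
  qed
  have gle: "Re (g a a) \<le> Re (h a a)" if "a \<in> J" for a
    using gaa[OF that] P(2) by simp
  \<comment> \<open>Positive diagonal entries of the Schur complement give
    \<open>(norm (h a p))\<^sup>2 < P * Re (h a a)\<close>, and the choice of the pivot bounds
    \<open>Re (h a a)\<close> by \<open>P\<close>.\<close>
  have small: "norm (h a p / of_real P) \<le> 1" if a: "a \<in> I" for a
  proof (cases "a = p")
    case True then show ?thesis using P by simp
  next
    case False
    then have aJ: "a \<in> J" using a IJ by auto
    have "(norm (h a p))\<^sup>2 / P < Re (h a a)" using gaa[OF aJ] gpos'[OF aJ] by simp
    also have "\<dots> \<le> P" using pmax[OF a] by (simp add: P_def)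
    finally have "(norm (h a p))\<^sup>2 < P\<^sup>2" using P(2) by (simp add: field_simps power2_eq_square)
    then have "norm (h a p) \<le> P" using P(2) by (simp add: power2_less_imp_less less_imp_le)
    then show ?thesis using P(2) by (simp add: norm_divide)
  qed
  have fact: "h a b = (\<Sum>j<Suc d. of_real (D' j) * l' j a * cnj (l' j b))" if ab: "a \<in> I" "b \<in> I" for a b
  proof -
    have hb: "cnj (h b p) = h p b" using herm[OF ab(2) p] by simp
    have "(\<Sum>j<Suc d. of_real (D' j) * l' j a * cnj (l' j b))
      = h a p * h p b / of_real P + (\<Sum>j<d. of_real (D j) * (if a = p then 0 else l j a) * cnj (if b = p then 0 else l j b))"
      using P(2) unfolding sum.lessThan_Suc_shift by (simp add: D'_def l'_def hb)
    also have "\<dots> = h a b"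
    proof (cases "a = p \<or> b = p")
      case True then show ?thesis using P by auto
    next
      case False
      then have "a \<in> J" "b \<in> J" using ab IJ by auto
      then show ?thesis using False by (simp add: IH(3)[symmetric] g_def)
    qed
    finally show ?thesis by simp
  qed
  \<comment> \<open>Elimination does not increase diagonal entries, so later pivots are at most
    \<open>P\<close>. The clause on upper bounds \<open>M\<close> is carried through the induction
    for this purpose.\<close>
  have DleP: "D j \<le> P" if "j < d" for j
  proof (rule IH(7)[OF _ that])
    fix a assume "a \<in> J" then show "Re (g a a) \<le> P" using gle[of a] pmax[of a] IJ by (auto simp: P_def)
  qed
  show ?case
    unfolding pivoted_cholesky_on_def
  proof (rule exI[of _ l'], rule exI[of _ D'], rule exI[of _ "p # ps"], intro conjI allI impI ballI)
    show "distinct (p # ps)" "set (p # ps) = I" using IH(1,2) IJ by auto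
    fix a b assume "a \<in> I" "b \<in> I" then show "h a b = (\<Sum>j<Suc d. of_real (D' j) * l' j a * cnj (l' j b))" by (rule fact)
  next
    fix j a assume "j < Suc d" "a \<in> I"
    then show "norm (l' j a) \<le> 1" using small[of a] IH(4) IJ by (cases j) (auto simp: l'_def)
  next
    fix j assume "j < Suc d" then show "0 < D' j" using P IH(5) by (cases j) (auto simp: D'_def)
  next
    fix i j :: nat assume "i \<le> j" "j < Suc d"
    then show "D' j \<le> D' i" using DleP IH(6) by (cases i; cases j) (auto simp: D'_def)
  next
    fix M j assume M: "\<forall>a\<in>I. Re (h a a) \<le> M" and "j < Suc d"
    have "P \<le> M" using M p by (auto simp: P_def)
    then show "D' j \<le> M" using DleP[of "j - 1"] \<open>j < Suc d\<close> by (cases j) (auto simp: D'_def)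
  next
    fix j assume "j < Suc d" then show "l' j ((p # ps) ! j) = 1"
      using P IH(8) nth_mem[of _ ps] IH(2) IJ len by (cases j) (auto simp: l'_def)
  next
    fix i j :: nat assume "i < j" "j < Suc d" then show "l' j ((p # ps) ! i) = 0"
      using IH(9) by (cases i; cases j) (auto simp: l'_def)
  qed
qed

lemma pivoted_cholesky:
  assumes H: "pdef d H"
  obtains L and D :: "nat \<Rightarrow> real" where
    "L \<in> carrier_mat d d" "\<forall>a<d. \<forall>j<d. norm (L $$ (a,j)) \<le> 1" "norm (det L) = 1"
    "\<forall>j<d. 0 < D j" "\<forall>i j. i \<le> j \<longrightarrow> j < d \<longrightarrow> D j \<le> D i"
    "H = L * diagm d D * cadj L"
proof -
  have c: "H \<in> carrier_mat d d" "cadj H = H" using H by (auto simp: pdef_def herm_def)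
  have herm: "H $$ (b,a) = cnj (H $$ (a,b))" if "a \<in> {..<d}" "b \<in> {..<d}" for a b
    using that c cadj_index[of b H a] by simp
  have pos: "0 < (\<Sum>a\<in>{..<d}. \<Sum>b\<in>{..<d}. cnj (x a) * H $$ (a,b) * x b)" if x: "\<exists>a\<in>{..<d}. x a \<noteq> 0" for x
  proof -
    define v where "v = vec d x"
    have v: "v \<in> carrier_vec d" "v \<noteq> 0\<^sub>v d" using x by (auto simp: v_def vec_eq_iff)
    then have "0 < (H *\<^sub>v v) \<bullet>c v" using H by (auto simp: pdef_def)
    also have "\<dots> = (\<Sum>a\<in>{..<d}. \<Sum>b\<in>{..<d}. cnj (x a) * H $$ (a,b) * x b)"
    proof -
      have "(H *\<^sub>v v) \<bullet>c v = (\<Sum>a<d. (\<Sum>b<d. H $$ (a,b) * v $ b) * cnj (v $ a))"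
        using c(1) v(1) by (subst cscalar_sum[of _ d])
         (auto simp: mult_mat_vec_index_sum[OF c(1) v(1)] simp del: index_mult_mat_vec intro!: sum.cong)
      then show ?thesis by (simp add: v_def sum_distrib_left mult_ac)
    qed
    finally show ?thesis .
  qed
  have "\<exists>l D ps. pivoted_cholesky_on {..<d} d (\<lambda>a b. H $$ (a,b)) l D ps"
    by (rule pivoted_cholesky_fun[OF finite_lessThan card_lessThan]) (use herm pos in blast)+
  then obtain l D ps where C: "pivoted_cholesky_on {..<d} d (\<lambda>a b. H $$ (a,b)) l D ps"
    by blast
  note l = pivoted_cholesky_onD[OF C, unfolded lessThan_iff]
  define L where "L = mat d d (\<lambda>(a,j). l j a)"
  have Lc: "L \<in> carrier_mat d d" by (simp add: L_def)
  have len: "length ps = d" using l(1,2) distinct_card by force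
  define p where "p j = (if j < d then ps ! j else j)" for j
  have perm: "p permutes {0..<d}"
  proof (rule bij_imp_permutes)
    have "inj_on p {0..<d}" using l(1) len by (auto simp: inj_on_def p_def nth_eq_iff_index_eq)
    moreover have "p ` {0..<d} = {0..<d}"
    proof -
      have "p ` {0..<d} = (!) ps ` {0..<length ps}" using len by (auto simp: p_def)
      also have "\<dots> = set ps" by (metis list.set_map map_nth set_upt)
      finally show ?thesis using l(2) by (simp add: atLeast0LessThan)
    qed
    ultimately show "bij_betw p {0..<d} {0..<d}" by (simp add: bij_betw_def)
  qed (auto simp: p_def)
  \<comment> \<open>Listing the rows of \<open>L\<close> in elimination order makes it lower
    unitriangular. Undoing the permutation only introduces a sign, hence the norm in
    \<open>norm (det L) = 1\<close>.\<close>
  define T where "T = mat d d (\<lambda>(i,j). L $$ (p i, j))"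
  have pd: "p i < d" if "i < d" for i using permutes_in_image[OF perm, of i] that by simp
  have "det T = signof p * det L" unfolding T_def by (rule det_permute_rows[OF Lc perm])
  moreover have "det T = prod_list (diag_mat T)"
    by (rule det_lower_triangular[of d]) (auto simp: T_def L_def pd, auto simp: p_def l(9))
  moreover have "prod_list (diag_mat T) = 1"
    unfolding prod_list_diag_prod by (rule prod.neutral) (auto simp: T_def L_def pd, auto simp: p_def l(8))
  ultimately have "signof p * det L = 1" by simp
  then have "norm (signof p :: complex) * norm (det L) = 1" by (metis norm_mult norm_one)
  moreover have "norm (signof p :: complex) = 1" by (simp add: sign_def)
  ultimately have "norm (det L) = 1" by simp
  moreover have "H = L * diagm d D * cadj L"
    unfolding mult_diagm_adjoint[OF Lc] using c(1) Lc
    by (intro eq_matI) (auto simp: wgram_def L_def l(3))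
  moreover have "\<forall>a<d. \<forall>j<d. norm (L $$ (a,j)) \<le> 1" using l(4) by (simp add: L_def)
  moreover have "\<forall>j<d. 0 < D j" "\<forall>i j. i \<le> j \<longrightarrow> j < d \<longrightarrow> D j \<le> D i" using l(5,6) by simp_all
  ultimately show ?thesis using that[OF Lc] by blast
qed

section \<open>Semistable configurations\<close>

lemma continuous_on_det:
  fixes F :: "'a::topological_space \<Rightarrow> nat \<Rightarrow> nat \<Rightarrow> complex"
  assumes "\<And>a b. a < k \<Longrightarrow> b < k \<Longrightarrow> continuous_on S (\<lambda>x. F x a b)"
  shows "continuous_on S (\<lambda>x. det (mat k k (\<lambda>(a,b). F x a b)))"
proof -
  have lt: "p a < k" if "p permutes {0..<k}" "a < k" for p a
    using permutes_in_image[OF that(1), of a] that(2) by simp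
  have "det (mat k k (\<lambda>(a,b). F x a b))
      = (\<Sum>p | p permutes {0..<k}. signof p * (\<Prod>a = 0..<k. F x a (p a)))" for x
    by (subst det_def'[of _ k]) (auto intro!: sum.cong prod.cong simp: lt)
  moreover have "continuous_on S (\<lambda>x. \<Sum>p | p permutes {0..<k}. signof p * (\<Prod>a = 0..<k. F x a (p a)))"
    by (intro continuous_intros) (auto intro!: assms simp: lt)
  ultimately show ?thesis by simp
qed

text \<open>Matrices are parametrised by functions on all pairs of naturals with the product
  topology, so compactness is Tychonoff's theorem. A square replaces the unit disc because it is the
  image of a product of intervals.\<close>

lemma compact_unit_entries:
  "compact {l :: nat \<times> nat \<Rightarrow> complex. \<forall>p. \<bar>Re (l p)\<bar> \<le> 1 \<and> \<bar>Im (l p)\<bar> \<le> 1}"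
proof -
  let ?Q = "(\<lambda>(x,y). Complex x y) ` ({-1..1} \<times> {-1..1})"
  have Q: "?Q = {z. \<bar>Re z\<bar> \<le> 1 \<and> \<bar>Im z\<bar> \<le> 1}"
  proof (intro equalityI subsetI)
    fix z assume "z \<in> {z. \<bar>Re z\<bar> \<le> 1 \<and> \<bar>Im z\<bar> \<le> 1}"
    then show "z \<in> ?Q" by (intro image_eqI[of _ _ "(Re z, Im z)"]) (auto simp: abs_le_iff)
  qed auto
  have "compact ?Q"
    by (intro compact_continuous_image compact_Times compact_Icc)
      (auto simp: case_prod_unfold Complex_eq intro!: continuous_intros)
  then have "compactin (product_topology (\<lambda>_. euclidean) UNIV) (PiE UNIV (\<lambda>_::nat \<times> nat. ?Q))"
    by (subst compactin_PiE) auto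
  then have "compact (PiE UNIV (\<lambda>_::nat \<times> nat. ?Q))"
    by (simp add: euclidean_product_topology)
  also have "PiE UNIV (\<lambda>_::nat \<times> nat. ?Q) = {l. \<forall>p. \<bar>Re (l p)\<bar> \<le> 1 \<and> \<bar>Im (l p)\<bar> \<le> 1}"
    unfolding Q by (auto simp: PiE_def)
  finally show ?thesis .
qed

text \<open>Summation by parts: nonnegative partial sums meet nonnegative differences
  \<open>x m - x (m + 1)\<close>. The vanishing total removes the boundary term, so \<open>x\<close>
  may have any sign, as the logarithms of the pivots do.\<close>

lemma abel_sum_nonneg:
  fixes c x :: "nat \<Rightarrow> real"
  assumes anti: "\<And>i j. i \<le> j \<Longrightarrow> j < d \<Longrightarrow> x j \<le> x i"
    and part: "\<And>m. m \<le> d \<Longrightarrow> 0 \<le> (\<Sum>j<m. c j)" and total: "(\<Sum>j<d. c j) = 0"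
  shows "0 \<le> (\<Sum>j<d. c j * x j)"
proof -
  have *: "(\<Sum>j<Suc m. c j) * x m \<le> (\<Sum>j<Suc m. c j * x j)" if "Suc m \<le> d" for m
    using that
  proof (induction m)
    case (Suc m)
    have "(\<Sum>j<Suc m. c j) * x (Suc m) \<le> (\<Sum>j<Suc m. c j) * x m"
      using Suc.prems part[of "Suc m"] anti[of m "Suc m"] by (intro mult_left_mono) auto
    also have "\<dots> \<le> (\<Sum>j<Suc m. c j * x j)" using Suc by simp
    finally show ?case by (simp add: algebra_simps)
  qed simp
  show ?thesis
  proof (cases d)
    case (Suc m)
    then show ?thesis using *[of m] total by simp
  qed simp
qed

text \<open>The hypotheses say that the linear maps \<open>A i\<close> form a semistable configuration of slope \<open>\<sigma>\<close>.
  Subspaces are given as spans of the first \<open>m\<close> columns of an invertible matrix \<open>L\<close>.\<close>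

locale semistable =
  fixes I :: "'i set" and A :: "'i \<Rightarrow> complex mat" and k :: "'i \<Rightarrow> nat" and d :: nat and \<sigma> :: real
  assumes finI: "finite I" and A: "\<And>i. i \<in> I \<Longrightarrow> A i \<in> carrier_mat (k i) d"
    and d: "0 < d" and \<sigma>: "0 < \<sigma>" and slope: "(\<Sum>i\<in>I. real (k i)) = \<sigma> * real d"
    and inj: "\<And>v. v \<in> carrier_vec d \<Longrightarrow> (\<And>i. i \<in> I \<Longrightarrow> A i *\<^sub>v v = 0\<^sub>v (k i)) \<Longrightarrow> v = 0\<^sub>v d"
    and semistable: "\<And>L m. L \<in> carrier_mat d d \<Longrightarrow> det L \<noteq> 0 \<Longrightarrow> m \<le> d \<Longrightarrow>
        \<sigma> * real m \<le> (\<Sum>i\<in>I. real (cvec.dim (colf (A i * L) ` {..<m})))"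
begin

text \<open>The combinatorial shadow of semistability: the candidates for sets of pivot columns of
  all the \<open>A i * L\<close>. There are finitely many, although \<open>L\<close> varies
  continuously.\<close>

definition frames :: "('i \<Rightarrow> nat set) set" where
  "frames = {J \<in> PiE I (\<lambda>_. Pow {..<d}). (\<forall>i\<in>I. card (J i) = k i) \<and>
     (\<forall>m\<le>d. \<sigma> * real m \<le> (\<Sum>i\<in>I. real (card (J i \<inter> {..<m}))))}"

lemma finite_frames: "finite frames"
  unfolding frames_def by (rule finite_subset[of _ "PiE I (\<lambda>_. Pow {..<d})"]) (auto intro!: finite_PiE finI)

text \<open>Semistability along the flag of \<open>L\<close> is the counting condition on pivot
  columns. At the full space it meets the slope equation, which forces every \<open>A i * L\<close>
  to have full row rank.\<close>

lemma greedy_frame: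
  assumes L: "L \<in> carrier_mat d d" "det L \<noteq> 0"
  shows "(\<lambda>i\<in>I. greedy (A i * L)) \<in> frames"
    and "\<And>i. i \<in> I \<Longrightarrow> det (submat_cols (A i * L) (greedy (A i * L))) \<noteq> 0"
proof -
  have dims: "dim_row (A i * L) = k i" "dim_col (A i * L) = d" if "i \<in> I" for i
    using A[OF that] L by auto
  have sub: "greedy (A i * L) \<subseteq> {..<d}" if "i \<in> I" for i
    using greedy_subset[of "A i * L"] dims[OF that] by simp
  have part: "\<sigma> * real m \<le> (\<Sum>i\<in>I. real (card (greedy (A i * L) \<inter> {..<m})))" if "m \<le> d" for m
    using semistable[OF L that] that card_greedy[of m] dims by simp
  have le: "card (greedy (A i * L)) \<le> k i" if i: "i \<in> I" for i
  proof -
    have "greedy (A i * L) \<inter> {..<d} = greedy (A i * L)" using sub[OF i] by auto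
    then have "card (greedy (A i * L)) = cvec.dim (colf (A i * L) ` {..<d})"
      using card_greedy[of d "A i * L"] dims[OF i] by simp
    also have "\<dots> \<le> k i" using dims[OF i] colf_cspace[of "A i * L"] by (intro dim_cspace_le) auto
    finally show ?thesis .
  qed
  have ge: "(\<Sum>i\<in>I. real (k i)) \<le> (\<Sum>i\<in>I. real (card (greedy (A i * L))))"
  proof -
    have "(\<Sum>i\<in>I. real (card (greedy (A i * L) \<inter> {..<d}))) = (\<Sum>i\<in>I. real (card (greedy (A i * L))))"
      using sub by (intro sum.cong) (auto simp: Int_absorb2)
    then show ?thesis using part[of d] slope by simp
  qed
  \<comment> \<open>No cardinality exceeds \<open>k i\<close>, and the cardinalities sum to at least
    the sum of the \<open>k i\<close>; so all of them are equal.\<close>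
  have eq: "card (greedy (A i * L)) = k i" if i: "i \<in> I" for i
  proof (rule ccontr)
    assume "card (greedy (A i * L)) \<noteq> k i"
    then have "card (greedy (A i * L)) < k i" using le[OF i] by simp
    then have "(\<Sum>i\<in>I. real (card (greedy (A i * L)))) < (\<Sum>i\<in>I. real (k i))"
      using le i by (intro sum_strict_mono_ex1[OF finI]) auto
    then show False using ge by simp
  qed
  then show "(\<lambda>i\<in>I. greedy (A i * L)) \<in> frames"
    using sub part by (auto simp: frames_def)
  show "det (submat_cols (A i * L) (greedy (A i * L))) \<noteq> 0" if "i \<in> I" for i
    using det_submat_greedy[of "A i * L"] eq[OF that] dims[OF that] by simp
qed

definition frame_weight :: "complex mat \<Rightarrow> ('i \<Rightarrow> nat set) \<Rightarrow> real" where
  "frame_weight L J = (\<Prod>i\<in>I. (norm (det (submat_cols (A i * L) (J i))))\<^sup>2)"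

lemma frame_weight_nonneg: "0 \<le> frame_weight L J"
  unfolding frame_weight_def by (intro prod_nonneg) auto

text \<open>With \<open>J\<close> held fixed, the minors are polynomials in the entries of
  \<open>L\<close>.\<close>

lemma continuous_frame_weight:
  assumes J: "J \<in> frames"
  shows "continuous_on UNIV (\<lambda>l. frame_weight (mat d d l) J)"
  unfolding frame_weight_def
proof (intro continuous_intros)
  fix i assume i: "i \<in> I"
  have Ji: "J i \<subseteq> {..<d}" "card (J i) = k i" using J i by (auto simp: frames_def)
  let ?s = "sorted_list_of_set (J i)"
  have "?s ! b < d" if "b < k i" for b
    using bij_betw_sorted_list[of "J i"] Ji that finite_subset[OF Ji(1)] by (auto simp: bij_betw_def)
  then have "submat_cols (A i * mat d d l) (J i) = mat (k i) (k i) (\<lambda>(a,b). \<Sum>c<d. A i $$ (a,c) * l (c, ?s ! b))" for l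
    using A[OF i] Ji(2)
    by (intro eq_matI) (auto simp: submat_cols_def mult_mat_index[of _ "k i" d _ d] simp del: index_mult_mat(1))
  moreover have "continuous_on UNIV (\<lambda>l. det (mat (k i) (k i) (\<lambda>(a,b). \<Sum>c<d. A i $$ (a,c) * l (c, ?s ! b))))"
    by (intro continuous_on_det continuous_intros continuous_on_product_coordinates)
  ultimately show "continuous_on UNIV (\<lambda>l. det (submat_cols (A i * mat d d l) (J i)))" by simp
qed

text \<open>The greedy frame jumps as \<open>L\<close> varies, so its weight alone admits no
  compactness argument. The sum of the weights over all frames is continuous, and it is positive
  because the greedy frame contributes; its minimum over the compact set of factors is therefore
  positive.\<close>

lemma frame_weight_lower_bound:
  obtains c where "0 < c"
    "\<forall>L\<in>carrier_mat d d. (\<forall>a<d. \<forall>b<d. norm (L $$ (a,b)) \<le> 1) \<longrightarrow> norm (det L) = 1 \<longrightarrow>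
      (\<exists>J\<in>frames. c \<le> frame_weight L J)"
proof -
  define f where "f l = (\<Sum>J\<in>frames. frame_weight (mat d d l) J)" for l
  let ?K = "{l :: nat \<times> nat \<Rightarrow> complex. \<forall>p. \<bar>Re (l p)\<bar> \<le> 1 \<and> \<bar>Im (l p)\<bar> \<le> 1} \<inter> {l. norm (det (mat d d l)) = 1}"
  have contf: "continuous_on UNIV f" unfolding f_def
    by (intro continuous_intros continuous_frame_weight)
  have "continuous_on UNIV (\<lambda>l :: nat \<times> nat \<Rightarrow> complex. det (mat d d (\<lambda>(a,b). l (a,b))))"
    by (intro continuous_on_det continuous_on_product_coordinates)
  then have "continuous_on UNIV (\<lambda>l :: nat \<times> nat \<Rightarrow> complex. norm (det (mat d d l)))"
    by (intro continuous_intros) simp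
  then have "closed {l :: nat \<times> nat \<Rightarrow> complex. norm (det (mat d d l)) = 1}"
    by (intro closed_Collect_eq) auto
  then have K: "compact ?K" by (intro compact_Int_closed compact_unit_entries)
  have "(\<lambda>(a,b). if a = b then 1 else 0) \<in> ?K"
  proof -
    have "mat d d (\<lambda>(a,b). if a = b then 1 else 0) = (1\<^sub>m d :: complex mat)" by (intro eq_matI) auto
    then show ?thesis by auto
  qed
  then have "?K \<noteq> {}" by blast
  from continuous_attains_inf[OF K this continuous_on_subset[OF contf]] obtain l0 where
    l0: "l0 \<in> ?K" "\<And>l. l \<in> ?K \<Longrightarrow> f l0 \<le> f l" by auto
  have pos: "0 < f l0"
  proof -
    have L: "mat d d l0 \<in> carrier_mat d d" "det (mat d d l0) \<noteq> 0" using l0(1) by auto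
    note g = greedy_frame[OF L]
    have "0 < frame_weight (mat d d l0) (\<lambda>i\<in>I. greedy (A i * mat d d l0))"
      unfolding frame_weight_def using g(2) by (intro prod_pos) auto
    then show ?thesis unfolding f_def
      using g(1) by (intro sum_pos2[OF finite_frames g(1)]) (auto simp: frame_weight_nonneg)
  qed
  have ne: "frames \<noteq> {}" using pos by (auto simp: f_def)
  then have card: "0 < real (card frames)" using finite_frames by (simp add: card_gt_0_iff)
  \<comment> \<open>Some frame carries at least the average share of the minimal total
    weight.\<close>
  define c where "c = f l0 / real (card frames)"
  have "\<exists>J\<in>frames. c \<le> frame_weight L J"
    if L: "L \<in> carrier_mat d d" "\<forall>a<d. \<forall>b<d. norm (L $$ (a,b)) \<le> 1" "norm (det L) = 1" for L
  proof (rule ccontr)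
    assume neg: "\<not> ?thesis"
    \<comment> \<open>Extension by zero puts the matrix into the compact set of functions on all
      pairs.\<close>
    define l where "l p = (if fst p < d \<and> snd p < d then L $$ p else 0)" for p
    have Ll: "mat d d l = L" using L(1) by (intro eq_matI) (auto simp: l_def)
    have "norm (l p) \<le> 1" for p using L(2) by (cases p) (simp add: l_def)
    then have "l \<in> ?K" using L(3) Ll abs_Re_le_cmod abs_Im_le_cmod order_trans by blast
    then have "f l0 \<le> f l" by (rule l0(2))
    also have "f l < (\<Sum>J\<in>frames. c)" unfolding f_def Ll
      using neg ne finite_frames by (intro sum_strict_mono) (auto simp: not_le)
    also have "\<dots> = f l0" using card by (simp add: c_def)
    finally show False by simp
  qed
  moreover have "0 < c" using pos card by (simp add: c_def)
  ultimately show ?thesis using that by blast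
qed

lemma congruence_cholesky:
  assumes "L \<in> carrier_mat d d" "i \<in> I"
  shows "A i * (L * diagm d D * cadj L) * cadj (A i) = wgram (A i * L) D {..<d}"
proof -
  note Ai = A[OF assms(2)]
  note L = assms(1)
  have c: "cadj L \<in> carrier_mat d d" "cadj (A i) \<in> carrier_mat d (k i)"
    "L * diagm d D \<in> carrier_mat d d" "L * diagm d D * cadj L \<in> carrier_mat d d"
    using L Ai by auto
  have "A i * (L * diagm d D * cadj L) * cadj (A i) = A i * (L * diagm d D * cadj L * cadj (A i))"
    by (rule assoc_mult_mat[OF Ai c(4,2)])
  also have "\<dots> = A i * (L * diagm d D * (cadj L * cadj (A i)))"
    by (subst assoc_mult_mat[OF c(3,1,2)]) simp
  also have "\<dots> = A i * (L * diagm d D) * (cadj L * cadj (A i))"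
    by (rule assoc_mult_mat[OF Ai c(3), symmetric]) (use c in auto)
  also have "A i * (L * diagm d D) = A i * L * diagm d D"
    by (rule assoc_mult_mat[OF Ai L diagm_carrier, symmetric])
  also have "cadj L * cadj (A i) = cadj (A i * L)" using cadj_mult[OF Ai assms(1)] by simp
  also have "A i * L * diagm d D * cadj (A i * L) = wgram (A i * L) D {..<d}"
    by (rule mult_diagm_adjoint[of _ "k i"]) (use assms Ai in auto)
  finally show ?thesis .
qed

text \<open>Definiteness requires \<open>A i\<close> to be onto; the nonvanishing maximal minor of
  \<open>A i * L\<close> selected by the greedy frame guarantees this.\<close>

lemma pdef_gram:
  assumes "pdef d H" "i \<in> I" shows "pdef (k i) (A i * H * cadj (A i))"
proof -
  obtain L and D :: "nat \<Rightarrow> real" where L: "L \<in> carrier_mat d d" "norm (det L) = 1"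
    "\<forall>j<d. 0 < D j" "H = L * diagm d D * cadj L"
    by (rule pivoted_cholesky[OF assms(1)])
  have nz: "det L \<noteq> 0" using L(2) by auto
  note g = greedy_frame[OF L(1) nz]
  have "greedy (A i * L) \<subseteq> {..<d}" "card (greedy (A i * L)) = k i"
    using g(1) assms(2) by (auto simp: frames_def)
  then show ?thesis unfolding L(4) congruence_cholesky[OF L(1) assms(2)]
    using g(2)[OF assms(2)] A[OF assms(2)] L by (intro pdef_wgram[of _ "k i" d "greedy (A i * L)"]) auto
qed

text \<open>A Brascamp-Lieb inequality in determinantal form, which makes the infimum of the scaling
  functional positive. Each determinant is bounded below by one minor times the pivots in
  \<open>J i\<close>; the minors are controlled by compactness, the product of pivots by the frame
  condition.\<close>

lemma capacity_lower_bound: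
  obtains c where "0 < c"
    "\<forall>H. pdef d H \<longrightarrow> c * Re (det H) powr \<sigma> \<le> (\<Prod>i\<in>I. Re (det (A i * H * cadj (A i))))"
proof -
  obtain c where c: "0 < c"
    "\<forall>L\<in>carrier_mat d d. (\<forall>a<d. \<forall>b<d. norm (L $$ (a,b)) \<le> 1) \<longrightarrow> norm (det L) = 1 \<longrightarrow>
      (\<exists>J\<in>frames. c \<le> frame_weight L J)" by (rule frame_weight_lower_bound)
  have "c * Re (det H) powr \<sigma> \<le> (\<Prod>i\<in>I. Re (det (A i * H * cadj (A i))))" if H: "pdef d H" for H
  proof -
    obtain L and D :: "nat \<Rightarrow> real" where L: "L \<in> carrier_mat d d"
      "\<forall>a<d. \<forall>j<d. norm (L $$ (a,j)) \<le> 1" "norm (det L) = 1" and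
      D: "\<forall>j<d. 0 < D j" "\<forall>i j. i \<le> j \<longrightarrow> j < d \<longrightarrow> D j \<le> D i" and
      HL: "H = L * diagm d D * cadj L"
      by (rule pivoted_cholesky[OF H])
    from c(2) L obtain J where J: "J \<in> frames" "c \<le> frame_weight L J" by blast
    have Ji: "J i \<subseteq> {..<d}" "card (J i) = k i" if "i \<in> I" for i using J that by (auto simp: frames_def)
    have nz: "det (submat_cols (A i * L) (J i)) \<noteq> 0" if "i \<in> I" for i
    proof
      assume "det (submat_cols (A i * L) (J i)) = 0"
      then have "frame_weight L J = 0" using that finI by (auto simp: frame_weight_def)
      then show False using J c by simp
    qed
    have detH: "Re (det H) = (\<Prod>j<d. D j)"
      using det_congruence_diagm[OF L(1), of D] L(3) by (simp add: HL del: of_real_prod)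
    have pos: "0 < (\<Prod>j<d. D j)" using D by (intro prod_pos) auto
    have cnt: "(\<Sum>i\<in>I. \<Sum>j\<in>J i \<inter> {..<m}. y j) = (\<Sum>j<m. real (card {i\<in>I. j \<in> J i}) * y j)" for m and y :: "nat \<Rightarrow> real"
    proof -
      have "(\<Sum>i\<in>I. \<Sum>j\<in>J i \<inter> {..<m}. y j) = (\<Sum>i\<in>I. \<Sum>j<m. if j \<in> J i then y j else 0)"
        by (rule sum.cong[OF refl]) (subst Int_commute, rule sum.inter_restrict, simp)
      also have "\<dots> = (\<Sum>j<m. \<Sum>i\<in>I. if j \<in> J i then y j else 0)" by (rule sum.swap)
      also have "\<dots> = (\<Sum>j<m. real (card {i\<in>I. j \<in> J i}) * y j)"
        using finI by (intro sum.cong refl) (simp add: sum.inter_filter[symmetric])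
      finally show ?thesis .
    qed
    \<comment> \<open>The number of sets \<open>J i\<close> that use pivot \<open>j\<close>, in
      excess of \<sigma>. Nonnegative partial sums are the frame condition, and the total is zero by
      the slope equation.\<close>
    define w where "w j = real (card {i\<in>I. j \<in> J i}) - \<sigma>" for j
    have wsum: "(\<Sum>j<m. w j) = (\<Sum>i\<in>I. real (card (J i \<inter> {..<m}))) - \<sigma> * real m" for m
      using cnt[where m = m and y = "\<lambda>_. 1"] by (simp add: w_def sum_subtractf)
    have JJ: "J i \<inter> {..<d} = J i" if "i \<in> I" for i using Ji[OF that] by auto
    have "0 \<le> (\<Sum>j<d. w j * ln (D j))"
    proof (rule abel_sum_nonneg)
      show "ln (D j) \<le> ln (D i)" if "i \<le> j" "j < d" for i j using D that by simp
      show "0 \<le> (\<Sum>j<m. w j)" if "m \<le> d" for m unfolding wsum using J that by (auto simp: frames_def)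
      show "(\<Sum>j<d. w j) = 0" unfolding wsum using slope Ji JJ by simp
    qed
    then have "\<sigma> * (\<Sum>j<d. ln (D j)) \<le> (\<Sum>i\<in>I. \<Sum>j\<in>J i. ln (D j))"
      using cnt[where m = d and y = "\<lambda>j. ln (D j)"] JJ by (simp add: w_def left_diff_distrib sum_subtractf sum_distrib_left)
    then have "exp (\<sigma> * (\<Sum>j<d. ln (D j))) \<le> exp (\<Sum>i\<in>I. \<Sum>j\<in>J i. ln (D j))" by simp
    moreover have "exp (\<sigma> * (\<Sum>j<d. ln (D j))) = (\<Prod>j<d. D j) powr \<sigma>"
    proof -
      have "(\<Sum>j<d. ln (D j)) = ln (\<Prod>j<d. D j)" using D by (subst ln_prod) auto
      then show ?thesis using pos D(1) by (auto simp: powr_def)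
    qed
    moreover have "exp (\<Sum>i\<in>I. \<Sum>j\<in>J i. ln (D j)) = (\<Prod>i\<in>I. \<Prod>j\<in>J i. D j)"
    proof -
      have "exp (\<Sum>j\<in>J i. ln (D j)) = (\<Prod>j\<in>J i. D j)" if "i \<in> I" for i
        using Ji(1)[OF that] D finite_subset[OF Ji(1)[OF that]] by (subst exp_sum) (auto intro!: prod.cong)
      then show ?thesis using finI by (simp add: exp_sum)
    qed
    ultimately have key: "(\<Prod>j<d. D j) powr \<sigma> \<le> (\<Prod>i\<in>I. \<Prod>j\<in>J i. D j)" by simp
    have "c * Re (det H) powr \<sigma> \<le> frame_weight L J * (\<Prod>i\<in>I. \<Prod>j\<in>J i. D j)"
      unfolding detH using key J c by (intro mult_mono) (auto simp: frame_weight_nonneg)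
    also have "\<dots> = (\<Prod>i\<in>I. (\<Prod>j\<in>J i. D j) * (norm (det (submat_cols (A i * L) (J i))))\<^sup>2)"
      by (simp add: frame_weight_def prod.distrib mult.commute)
    also have "\<dots> \<le> (\<Prod>i\<in>I. Re (det (A i * H * cadj (A i))))"
    proof (intro prod_mono conjI)
      fix i assume i: "i \<in> I"
      show "0 \<le> (\<Prod>j\<in>J i. D j) * (norm (det (submat_cols (A i * L) (J i))))\<^sup>2"
        using Ji(1)[OF i] D by (intro mult_nonneg_nonneg prod_nonneg) (auto simp: less_imp_le subset_iff)
      show "(\<Prod>j\<in>J i. D j) * (norm (det (submat_cols (A i * L) (J i))))\<^sup>2 \<le> Re (det (A i * H * cadj (A i)))"
        unfolding HL congruence_cholesky[OF L(1) i]
        using A[OF i] L(1) Ji[OF i] D nz[OF i] by (intro det_wgram_ge[of _ "k i"]) auto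
    qed
    finally show ?thesis .
  qed
  with c(1) that show ?thesis by blast
qed

end

section \<open>Operator scaling\<close>

text \<open>Converts a small entropy defect \<open>x - 1 - ln x\<close> into a small distance from
  1. With \<open>s = sqrt x\<close>, the factor \<open>(s - 1)\<^sup>2\<close> is bounded by the
  defect and \<open>(s + 1)\<^sup>2\<close> by \<open>4 * B\<close>.\<close>

lemma sq_dist_one_le:
  fixes x :: real
  assumes "0 < x" "x \<le> B" "1 \<le> B"
  shows "(x - 1)\<^sup>2 \<le> 4 * B * (x - 1 - ln x)"
proof -
  define s where "s = sqrt x"
  have s: "0 < s" "s\<^sup>2 = x" using assms by (auto simp: s_def)
  have "ln x = 2 * ln s" using s by (metis ln_powr powr_numeral of_nat_numeral ln_realpow)
  also have "\<dots> \<le> 2 * (s - 1)" using ln_le_minus_one[OF s(1)] by simp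
  finally have 1: "(s - 1)\<^sup>2 \<le> x - 1 - ln x" using s by (simp add: power2_eq_square algebra_simps)
  have "s \<le> sqrt B" using assms by (simp add: s_def)
  moreover have "1 \<le> sqrt B" using assms by simp
  ultimately have "s + 1 \<le> 2 * sqrt B" by linarith
  then have "(s + 1)\<^sup>2 \<le> (2 * sqrt B)\<^sup>2" using s by (intro power_mono) auto
  also have "\<dots> = 4 * B" using assms by (simp add: power_mult_distrib)
  finally have 2: "(s + 1)\<^sup>2 \<le> 4 * B" .
  have "(x - 1)\<^sup>2 = (s + 1)\<^sup>2 * (s - 1)\<^sup>2" unfolding s(2)[symmetric] by (simp add: power2_eq_square algebra_simps)
  also have "\<dots> \<le> 4 * B * (x - 1 - ln x)" using 1 2 assms by (intro mult_mono) auto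
  finally show ?thesis .
qed

context semistable
begin

text \<open>With \<open>B i\<close> the inverse of \<open>A i * H * cadj (A i)\<close>, each summand
  times \<open>H\<close> is a projection, and \<open>frame_op B * H\<close> is the sum of
  projections that should be close to \<sigma> times the identity.\<close>

definition frame_op :: "('i \<Rightarrow> complex mat) \<Rightarrow> complex mat" where
  "frame_op B = msum d d (\<lambda>i. cadj (A i) * B i * A i) I"

lemma pdef_frame_op:
  assumes B: "\<And>i. i \<in> I \<Longrightarrow> pdef (k i) (B i)"
  shows "pdef d (frame_op B)"
proof -
  have cA: "cadj (A i) \<in> carrier_mat d (k i)" if "i \<in> I" for i using A[OF that] by simp
  have psd: "psd d (cadj (A i) * B i * A i)" if i: "i \<in> I" for i
    using psd_congruence[OF pdef_psd[OF B[OF i]] cA[OF i]] by simp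
  then have P: "psd d (frame_op B)" unfolding frame_op_def by (rule psd_msum)
  have "0 < (frame_op B *\<^sub>v v) \<bullet>c v" if v: "v \<in> carrier_vec d" "v \<noteq> 0\<^sub>v d" for v
  proof -
    obtain i where i: "i \<in> I" "A i *\<^sub>v v \<noteq> 0\<^sub>v (k i)" using inj[OF v(1)] v(2) by blast
    have inner: "((cadj (A j) * B j * A j) *\<^sub>v v) \<bullet>c v = (B j *\<^sub>v (A j *\<^sub>v v)) \<bullet>c (A j *\<^sub>v v)" if j: "j \<in> I" for j
      using congruence_inner[OF pdef_carrier[OF B[OF j]] cA[OF j] v(1)] by simp
    define q where "q j = ((cadj (A j) * B j * A j) *\<^sub>v v) \<bullet>c v" for j
    have "(frame_op B *\<^sub>v v) \<bullet>c v = (\<Sum>j\<in>I. q j)"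
      unfolding frame_op_def q_def by (rule msum_inner) (use psd psd_carrier v in auto)
    also have "\<dots> = q i + (\<Sum>j\<in>I - {i}. q j)" by (rule sum.remove[OF finI i(1)])
    finally have e: "(frame_op B *\<^sub>v v) \<bullet>c v = q i + (\<Sum>j\<in>I - {i}. q j)" .
    have "0 < q i"
      unfolding q_def inner[OF i(1)] using B[OF i(1)] i(2) mult_mat_vec_carrier[OF A[OF i(1)] v(1)]
      by (simp add: pdef_def)
    moreover have "0 \<le> (\<Sum>j\<in>I - {i}. q j)"
      using psd v by (intro sum_nonneg) (auto simp: psd_def q_def)
    ultimately show ?thesis unfolding e by (rule add_pos_nonneg)
  qed
  then show ?thesis using psd_herm[OF P] by (auto simp: pdef_def)
qed

text \<open>Cyclicity of the trace moves the computation from the common space to the spaces on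
  which the \<open>B i\<close> act.\<close>

lemma mtrace_frame_op_mult:
  assumes B: "\<And>i. i \<in> I \<Longrightarrow> B i \<in> carrier_mat (k i) (k i)" and X: "X \<in> carrier_mat d d"
  shows "mtrace (frame_op B * X) = (\<Sum>i\<in>I. mtrace (A i * X * cadj (A i) * B i))"
proof -
  have c: "cadj (A i) * B i * A i \<in> carrier_mat d d" if "i \<in> I" for i using A[OF that] B[OF that] by auto
  have "mtrace (frame_op B * X) = (\<Sum>i\<in>I. mtrace (cadj (A i) * B i * A i * X))"
    unfolding frame_op_def
    by (subst msum_mult_right[OF c X], simp, subst mtrace_msum) (use c X in \<open>auto intro: mult_carrier_mat[of _ d d]\<close>)
  also have "\<dots> = (\<Sum>i\<in>I. mtrace (A i * X * cadj (A i) * B i))"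
  proof (rule sum.cong[OF refl])
    fix i assume i: "i \<in> I"
    note Ai = A[OF i] and Bi = B[OF i]
    have cB: "cadj (A i) * B i \<in> carrier_mat d (k i)" and AX: "A i * X \<in> carrier_mat (k i) d"
      and cA: "cadj (A i) \<in> carrier_mat d (k i)" using Ai Bi X by auto
    have "cadj (A i) * B i * A i * X = cadj (A i) * B i * (A i * X)"
      by (rule assoc_mult_mat[OF cB Ai X])
    also have "mtrace \<dots> = mtrace (A i * X * (cadj (A i) * B i))" by (rule mtrace_comm[OF cB AX])
    also have "A i * X * (cadj (A i) * B i) = A i * X * cadj (A i) * B i"
      by (rule assoc_mult_mat[OF AX cA Bi, symmetric])
    finally show "mtrace (cadj (A i) * B i * A i * X) = mtrace (A i * X * cadj (A i) * B i)" .
  qed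
  finally show ?thesis .
qed

text \<open>One step of operator scaling, \<open>H \<mapsto> \<sigma> S\<^sup>-\<^sup>1\<close> with \<open>S = frame_op B\<close>, never increases the
  capacity functional. At an almost-minimiser it gains almost nothing, which forces the
  spectrum of \<open>S H\<close> to concentrate near \<open>\<sigma>\<close>.\<close>

lemma almost_isotropic:
  obtains H B where "pdef d H" "\<forall>i\<in>I. pdef (k i) (B i) \<and> A i * H * cadj (A i) * B i = 1\<^sub>m (k i) \<and>
      B i * (A i * H * cadj (A i)) = 1\<^sub>m (k i)"
    "Re (mtrace (frame_op B * H * (frame_op B * H))) \<le> 2 * \<sigma>\<^sup>2 * real d"
proof -
  define G where "G H i = A i * H * cadj (A i)" for H i
  define \<Phi> where "\<Phi> H = (\<Prod>i\<in>I. Re (det (G H i))) / Re (det H) powr \<sigma>" for H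
  obtain c where c: "0 < c"
    "\<forall>H. pdef d H \<longrightarrow> c * Re (det H) powr \<sigma> \<le> (\<Prod>i\<in>I. Re (det (A i * H * cadj (A i))))"
    by (rule capacity_lower_bound)
  have low: "c \<le> \<Phi> H" if H: "pdef d H" for H
    using c(2) H pdef_det_Re(2)[OF H] by (auto simp: \<Phi>_def G_def field_simps)
  define \<mu> where "\<mu> = (INF H\<in>{H. pdef d H}. \<Phi> H)"
  have bdd: "bdd_below (\<Phi> ` {H. pdef d H})" using low by (intro bdd_belowI[of _ c]) auto
  have ne: "{H. pdef d H} \<noteq> {}" using pdef_one[of d] by auto
  have \<mu>_le: "\<mu> \<le> \<Phi> H" if "pdef d H" for H unfolding \<mu>_def using that by (intro cINF_lower[OF bdd]) auto
  have "c \<le> \<mu>" unfolding \<mu>_def using low by (intro cINF_greatest[OF ne]) auto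
  then have \<mu>: "0 < \<mu>" using c by simp
  \<comment> \<open>The margin makes the total entropy defect below less than 1/4, which cancels the
    4 in \<open>sq_dist_one_le\<close>.\<close>
  have "\<mu> < \<mu> * exp (\<sigma> / 4)" using \<mu> \<sigma> by simp
  then obtain H where H: "pdef d H" "\<Phi> H < \<mu> * exp (\<sigma> / 4)"
    unfolding \<mu>_def using cINF_less_iff[OF ne bdd] by auto
  have cH: "H \<in> carrier_mat d d" using H by (simp add: pdef_carrier)
  have Gp: "pdef (k i) (G X i)" if "pdef d X" "i \<in> I" for X i unfolding G_def using that by (rule pdef_gram)
  have "\<exists>B. pdef (k i) B \<and> G H i * B = 1\<^sub>m (k i) \<and> B * G H i = 1\<^sub>m (k i)" if "i \<in> I" for i
    using pdef_inverse[OF Gp[OF H(1) that]] by metis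
  then obtain B where B: "\<And>i. i \<in> I \<Longrightarrow> pdef (k i) (B i) \<and> G H i * B i = 1\<^sub>m (k i) \<and> B i * G H i = 1\<^sub>m (k i)"
    by metis
  have Bp: "pdef (k i) (B i)" and cB: "B i \<in> carrier_mat (k i) (k i)" if "i \<in> I" for i
    using B[OF that] pdef_carrier by auto
  define S where "S = frame_op B"
  have S: "pdef d S" unfolding S_def using Bp by (rule pdef_frame_op)
  have cS: "S \<in> carrier_mat d d" using S by (rule pdef_carrier)
  obtain T where T: "pdef d T" "S * T = 1\<^sub>m d" "T * S = 1\<^sub>m d" by (rule pdef_inverse[OF S])
  have cT: "T \<in> carrier_mat d d" using T(1) by (rule pdef_carrier)
  define H' where "H' = complex_of_real \<sigma> \<cdot>\<^sub>m T"
  have H': "pdef d H'" unfolding H'_def using T(1) \<sigma> by (rule pdef_smult)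
  have cH': "H' \<in> carrier_mat d d" using H' by (rule pdef_carrier)
  \<comment> \<open>The inequality of \<open>det_le_exp_trace\<close> for each \<open>i\<close>
    loses nothing in total: the exponents add up to the trace of \<open>S * H'\<close>, which is
    \<sigma> times \<open>d\<close>, minus the sum of the \<open>k i\<close>, hence to 0.\<close>
  have prodle: "(\<Prod>i\<in>I. Re (det (G H' i))) \<le> (\<Prod>i\<in>I. Re (det (G H i)))"
  proof -
    have det_i: "Re (det (G H' i)) \<le> Re (det (G H i)) * exp (Re (mtrace (G H' i * B i)) - real (k i))" if i: "i \<in> I" for i
    proof -
      note p = Gp[OF H(1) i] Gp[OF H' i]
      have "det (G H i) * det (B i) = 1"
        using B[OF i] det_mult[OF pdef_carrier[OF p(1)] cB[OF i]] by simp
      then have "det (G H' i) = det (G H i) * (det (G H' i * B i))"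
        using det_mult[OF pdef_carrier[OF p(2)] cB[OF i]] by (simp add: mult.left_commute)
      also have "\<dots> = of_real (Re (det (G H i))) * det (G H' i * B i)" using pdef_det_Re(1)[OF p(1)] by simp
      finally have "Re (det (G H' i)) = Re (det (G H i)) * Re (det (G H' i * B i))" by simp
      also have "\<dots> \<le> Re (det (G H i)) * exp (Re (mtrace (G H' i * B i)) - real (k i))"
        using det_le_exp_trace[OF pdef_psd[OF p(2)] Bp[OF i]] pdef_det_Re(2)[OF p(1)] by (intro mult_left_mono) auto
      finally show ?thesis .
    qed
    have "mtrace (S * H') = (\<Sum>i\<in>I. mtrace (G H' i * B i))"
      unfolding S_def G_def by (rule mtrace_frame_op_mult[OF cB cH'])
    moreover have "S * H' = complex_of_real \<sigma> \<cdot>\<^sub>m 1\<^sub>m d"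
      unfolding H'_def T(2)[symmetric] by (rule mult_smult_distrib[OF cS cT])
    ultimately have "(\<Sum>i\<in>I. mtrace (G H' i * B i)) = of_real (\<sigma> * real d)" by (simp add: mtrace_smult[of _ d])
    then have tr: "(\<Sum>i\<in>I. Re (mtrace (G H' i * B i))) = \<sigma> * real d"
      by (metis Re_complex_of_real Re_sum)
    have "(\<Prod>i\<in>I. Re (det (G H' i))) \<le> (\<Prod>i\<in>I. Re (det (G H i)) * exp (Re (mtrace (G H' i * B i)) - real (k i)))"
      using det_i pdef_det_Re(2)[OF Gp[OF H']] by (intro prod_mono) (auto simp: less_imp_le)
    also have "\<dots> = (\<Prod>i\<in>I. Re (det (G H i))) * exp (\<Sum>i\<in>I. Re (mtrace (G H' i * B i)) - real (k i))"
      using finI by (simp add: prod.distrib exp_sum)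
    also have "(\<Sum>i\<in>I. Re (mtrace (G H' i * B i)) - real (k i)) = 0"
      using tr slope by (simp add: sum_subtractf)
    finally show ?thesis by simp
  qed
  obtain x :: "nat \<Rightarrow> real" where x: "mtrace (S * H) = of_real (\<Sum>i<d. x i)"
    "mtrace (S * H * (S * H)) = of_real (\<Sum>i<d. (x i)\<^sup>2)"
    "det (S * H) = of_real (\<Prod>i<d. x i)" "pdef d S \<longrightarrow> (\<forall>i<d. 0 < x i)"
    using spectrum_herm_pdef[OF pdef_herm[OF S] H(1)] by metis
  have xpos: "\<And>i. i < d \<Longrightarrow> 0 < x i" using x(4) S by blast
  have sumx: "(\<Sum>i<d. x i) = \<sigma> * real d"
  proof -
    have "mtrace (S * H) = (\<Sum>i\<in>I. mtrace (G H i * B i))"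
      unfolding S_def G_def by (rule mtrace_frame_op_mult[OF cB cH])
    also have "\<dots> = of_real (\<Sum>i\<in>I. real (k i))" using B by simp
    finally have "complex_of_real (\<Sum>i<d. x i) = of_real (\<Sum>i\<in>I. real (k i))" using x(1) by simp
    then have "(\<Sum>i<d. x i) = (\<Sum>i\<in>I. real (k i))" using of_real_eq_iff by blast
    then show ?thesis using slope by simp
  qed
  \<comment> \<open>The eigenvalues of \<open>H\<close> relative to \<open>H'\<close>. Their mean is
    1 and their product is the ratio of the determinants, so near-optimality of \<open>H\<close>
    bounds the product from below.\<close>
  define y where "y i = x i / \<sigma>" for i
  have ypos: "\<And>i. i < d \<Longrightarrow> 0 < y i" using xpos \<sigma> by (simp add: y_def)
  have sumy: "(\<Sum>i<d. y i) = real d" using sumx \<sigma> by (simp add: y_def sum_divide_distrib[symmetric])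
  have dets: "Re (det H) = Re (det H') * (\<Prod>i<d. y i)"
  proof -
    have "H = T * (S * H)" using cT cS cH T(3) by (simp add: assoc_mult_mat[of T d d S d H d, symmetric] del: assoc_mult_mat)
    then have "det H = det T * det (S * H)" using cT cS cH det_mult[of T d "S * H"] by (metis mult_carrier_mat)
    moreover have "det H' = of_real (\<sigma> ^ d) * det T" using cT by (simp add: H'_def)
    moreover have "(\<Prod>i<d. x i) = \<sigma> ^ d * (\<Prod>i<d. y i)"
    proof -
      have "(\<Prod>i<d. x i) = (\<Prod>i<d. \<sigma> * y i)" using \<sigma> by (simp add: y_def)
      then show ?thesis by (simp add: prod.distrib)
    qed
    ultimately have "det H = det H' * of_real (\<Prod>i<d. y i)" using x(3) by (simp add: mult_ac)
    then show ?thesis by (simp del: of_real_prod)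
  qed
  define Y where "Y = (\<Prod>i<d. y i)"
  have yprod: "0 < Y" unfolding Y_def using ypos by (intro prod_pos) auto
  have "\<mu> \<le> \<Phi> H'" using H' by (rule \<mu>_le)
  also have "\<dots> \<le> (\<Prod>i\<in>I. Re (det (G H i))) / Re (det H') powr \<sigma>"
    unfolding \<Phi>_def using prodle by (intro divide_right_mono) auto
  also have "\<dots> = \<Phi> H * Y powr \<sigma>"
    unfolding \<Phi>_def dets[folded Y_def] using yprod pdef_det_Re(2)[OF H'] by (simp add: powr_mult)
  also have "\<dots> < \<mu> * exp (\<sigma> / 4) * Y powr \<sigma>"
    using H(2) yprod by (intro mult_strict_right_mono) auto
  finally have "1 < exp (\<sigma> / 4) * Y powr \<sigma>" using \<mu> by simp
  also have "\<dots> = exp (\<sigma> / 4 + \<sigma> * ln Y)" using yprod by (simp add: powr_def exp_add)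
  finally have "0 < \<sigma> * (1 / 4 + ln Y)" by (simp add: algebra_simps)
  then have "- ln Y < 1 / 4" using \<sigma> by (simp add: zero_less_mult_iff)
  moreover have "ln Y = (\<Sum>i<d. ln (y i))" unfolding Y_def by (subst ln_prod) (auto dest: ypos)
  ultimately have lny: "(\<Sum>i<d. y i - 1 - ln (y i)) < 1 / 4" using sumy by (simp add: sum_subtractf)
  have d1: "1 \<le> real d" using d by simp
  \<comment> \<open>Positive numbers with sum \<open>d\<close> are at most \<open>d\<close>, which
    supplies the bound \<open>B\<close> of \<open>sq_dist_one_le\<close>.\<close>
  have ylt: "y i \<le> real d" if "i < d" for i
    using member_le_sum[of i "{..<d}" y] ypos that sumy by (auto simp: less_imp_le)
  have "(\<Sum>i<d. (y i - 1)\<^sup>2) \<le> (\<Sum>i<d. 4 * real d * (y i - 1 - ln (y i)))"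
    using ypos ylt d1 by (intro sum_mono sq_dist_one_le) auto
  also have "\<dots> = 4 * real d * (\<Sum>i<d. y i - 1 - ln (y i))" by (simp add: sum_distrib_left)
  also have "\<dots> \<le> real d" using lny d1 by simp
  finally have "(\<Sum>i<d. (y i - 1)\<^sup>2) \<le> real d" .
  moreover have "(\<Sum>i<d. (y i - 1)\<^sup>2) = (\<Sum>i<d. (y i)\<^sup>2) - 2 * (\<Sum>i<d. y i) + real d"
    by (simp add: power2_diff sum.distrib sum_subtractf sum_distrib_left)
  ultimately have "(\<Sum>i<d. (y i)\<^sup>2) \<le> 2 * real d" using sumy by simp
  then have "\<sigma>\<^sup>2 * (\<Sum>i<d. (y i)\<^sup>2) \<le> \<sigma>\<^sup>2 * (2 * real d)" by (rule mult_left_mono) simp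
  moreover have "\<sigma>\<^sup>2 * (\<Sum>i<d. (y i)\<^sup>2) = (\<Sum>i<d. (x i)\<^sup>2)"
    using \<sigma> by (simp add: y_def power_divide sum_divide_distrib[symmetric])
  ultimately have fin: "Re (mtrace (S * H * (S * H))) \<le> 2 * \<sigma>\<^sup>2 * real d" using x(2) by (simp del: of_real_sum)
  show ?thesis
  proof (rule that[of H B])
    show "pdef d H" by (rule H(1))
    show "\<forall>i\<in>I. pdef (k i) (B i) \<and> A i * H * cadj (A i) * B i = 1\<^sub>m (k i) \<and> B i * (A i * H * cadj (A i)) = 1\<^sub>m (k i)"
      using B unfolding G_def by blast
    show "Re (mtrace (frame_op B * H * (frame_op B * H))) \<le> 2 * \<sigma>\<^sup>2 * real d" using fin unfolding S_def .
  qed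
qed

end

section \<open>Overlaps along lines\<close>

lemma sum_square_le_card:
  fixes x :: "nat \<Rightarrow> real"
  shows "(\<Sum>i<n. x i)\<^sup>2 \<le> real n * (\<Sum>i<n. (x i)\<^sup>2)"
proof (cases "n = 0")
  case False
  define m where "m = (\<Sum>i<n. x i) / real n"
  have "0 \<le> (\<Sum>i<n. (x i - m)\<^sup>2)" by (intro sum_nonneg) auto
  also have "\<dots> = (\<Sum>i<n. (x i)\<^sup>2) - 2 * m * (\<Sum>i<n. x i) + real n * m\<^sup>2"
    by (simp add: power2_diff sum.distrib sum_subtractf sum_distrib_left mult_ac)
  also have "\<dots> = (\<Sum>i<n. (x i)\<^sup>2) - (\<Sum>i<n. x i)\<^sup>2 / real n"
    using False by (simp add: m_def field_simps power2_eq_square)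
  finally show ?thesis using False by (simp add: field_simps)
qed simp

text \<open>A rank bound, expressed as a factorisation through \<open>N\<close> coordinates.
  Cyclicity replaces \<open>P * Z\<close> by the \<open>N\<close> by \<open>N\<close> matrix
  \<open>Z * P\<close>, whose nonzero eigenvalues are those of \<open>Y * H\<close> and hence real;
  Cauchy-Schwarz on these \<open>N\<close> numbers gives the claim.\<close>

lemma rank_trace_bound:
  assumes Y: "herm d Y" and H: "pdef d H" and P: "P \<in> carrier_mat d N" and Z: "Z \<in> carrier_mat N d"
    and YH: "Y * H = P * Z"
  shows "(Re (mtrace (Y * H)))\<^sup>2 \<le> real N * Re (mtrace (Y * H * (Y * H)))"
proof -
  have ZP: "Z * P \<in> carrier_mat N N" and PZ: "P * Z \<in> carrier_mat d d" using P Z by auto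
  from schur_spectrum[OF ZP] obtain e where
    e: "\<And>i. i < N \<Longrightarrow> eigenvalue (Z * P) (e i)"
    "mtrace (Z * P) = (\<Sum>i<N. e i)" "mtrace (Z * P * (Z * P)) = (\<Sum>i<N. (e i)\<^sup>2)" by blast
  have real: "e i \<in> \<real>" if i: "i < N" for i
  proof (cases "e i = 0")
    case False
    from e(1)[OF i] ZP P Z obtain v where v: "v \<in> carrier_vec N" "v \<noteq> 0\<^sub>v N" "(Z * P) *\<^sub>v v = e i \<cdot>\<^sub>v v"
      by (auto simp: eigenvalue_def eigenvector_def)
    define u where "u = P *\<^sub>v v"
    have u: "u \<in> carrier_vec d" using P v by (auto simp: u_def)
    have Zu: "Z *\<^sub>v u = e i \<cdot>\<^sub>v v" unfolding u_def using assoc_mult_mat_vec[OF Z P v(1)] v(3) by simp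
    have "u \<noteq> 0\<^sub>v d"
    proof
      assume "u = 0\<^sub>v d"
      moreover have "Z *\<^sub>v 0\<^sub>v d = 0\<^sub>v N" using Z by (intro eq_vecI) auto
      ultimately have "e i \<cdot>\<^sub>v v = 0\<^sub>v N" using Zu by simp
      then have "v = 0\<^sub>v N" using False v(1) by (auto simp: vec_eq_iff)
      then show False using v(2) by simp
    qed
    moreover have "(Y * H) *\<^sub>v u = e i \<cdot>\<^sub>v u"
      unfolding YH using assoc_mult_mat_vec[OF P Z u] Zu mult_mat_vec[OF P v(1)] by (simp add: u_def)
    ultimately have "eigenvalue (Y * H) (e i)"
      using u P YH by (auto simp: eigenvalue_def eigenvector_def intro!: exI[of _ u])
    then show ?thesis using eigenvalue_herm_mult_pdef[OF Y H] by metis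
  qed simp
  define x where "x i = Re (e i)" for i
  have ex: "e i = of_real (x i)" if "i < N" for i using real[OF that] by (simp add: x_def)
  have t1: "mtrace (Y * H) = of_real (\<Sum>i<N. x i)"
    unfolding YH using mtrace_comm[OF P Z] e(2) ex by simp
  have "P * Z * (P * Z) = P * (Z * P * Z)"
    unfolding assoc_mult_mat[OF P Z PZ] assoc_mult_mat[OF Z P Z] ..
  then have "mtrace (Y * H * (Y * H)) = mtrace (Z * P * Z * P)"
    unfolding YH using mtrace_comm[OF P mult_carrier_mat[OF ZP Z]] by simp
  also have "Z * P * Z * P = Z * P * (Z * P)" by (rule assoc_mult_mat[OF ZP Z P])
  finally have t2: "mtrace (Y * H * (Y * H)) = of_real (\<Sum>i<N. (x i)\<^sup>2)" using e(3) ex by simp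
  show ?thesis unfolding t1 t2 Re_complex_of_real by (rule sum_square_le_card)
qed

text \<open>Placing \<open>A1\<close> beside \<open>A2\<close> and \<open>Z1\<close> above
  \<open>Z2\<close> turns the sum of two products into a single product of block matrices.\<close>

lemma add_mult_stacked:
  assumes "A1 \<in> carrier_mat d m1" "A2 \<in> carrier_mat d m2" "Z1 \<in> carrier_mat m1 e" "Z2 \<in> carrier_mat m2 e"
  obtains P Z where "P \<in> carrier_mat d (m1 + m2)" "Z \<in> carrier_mat (m1 + m2) e" "A1 * Z1 + A2 * Z2 = P * Z"
proof -
  define P where "P = mat d (m1 + m2) (\<lambda>(i,j). if j < m1 then A1 $$ (i,j) else A2 $$ (i, j - m1))"
  define Z where "Z = mat (m1 + m2) e (\<lambda>(i,j). if i < m1 then Z1 $$ (i,j) else Z2 $$ (i - m1, j))"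
  have c: "P \<in> carrier_mat d (m1 + m2)" "Z \<in> carrier_mat (m1 + m2) e" by (auto simp: P_def Z_def)
  have "A1 * Z1 + A2 * Z2 = P * Z"
  proof (rule eq_matI)
    fix i j assume "i < dim_row (P * Z)" "j < dim_col (P * Z)"
    then have ij: "i < d" "j < e" using c by auto
    have "(P * Z) $$ (i,j) = (\<Sum>a<m1 + m2. P $$ (i,a) * Z $$ (a,j))" by (rule mult_mat_index[OF c ij])
    also have "\<dots> = (\<Sum>a<m1. P $$ (i,a) * Z $$ (a,j)) + (\<Sum>a<m2. P $$ (i,m1 + a) * Z $$ (m1 + a,j))"
      by (induction m2) (auto simp: add.assoc)
    also have "\<dots> = (A1 * Z1) $$ (i,j) + (A2 * Z2) $$ (i,j)"
      using ij by (simp add: mult_mat_index[OF assms(1,3)] mult_mat_index[OF assms(2,4)] P_def Z_def del: index_mult_mat(1))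
    finally show "(A1 * Z1 + A2 * Z2) $$ (i,j) = (P * Z) $$ (i,j)" using ij assms by simp
  qed (use c assms in auto)
  with c that show ?thesis by blast
qed

context semistable
begin

section \<open>Projections and their overlaps in a fixed inner product\<close>

context
  fixes H B
  assumes H: "pdef d H" and B: "\<forall>i\<in>I. pdef (k i) (B i) \<and> A i * H * cadj (A i) * B i = 1\<^sub>m (k i) \<and>
      B i * (A i * H * cadj (A i)) = 1\<^sub>m (k i)"
begin

text \<open>\<open>fproj i * H\<close> is idempotent and self-adjoint for the inner product of
  \<open>H\<close>; it is the projection \<open>P i\<close> of the overview. Keeping
  \<open>H\<close> apart leaves a Hermitian factor to which \<open>spectrum_herm_pdef\<close>
  applies.\<close>

definition fproj :: "'i \<Rightarrow> complex mat" where
  "fproj i = cadj (A i) * B i * A i"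

definition overlap :: "'i \<Rightarrow> 'i \<Rightarrow> real" where
  "overlap i j = Re (mtrace (fproj i * H * (fproj j * H)))"

lemma cH: "H \<in> carrier_mat d d" using H by (rule pdef_carrier)

lemma cB: "i \<in> I \<Longrightarrow> B i \<in> carrier_mat (k i) (k i)" using B pdef_carrier by blast

lemma cA: "i \<in> I \<Longrightarrow> cadj (A i) \<in> carrier_mat d (k i)" using A by simp

lemma psd_fproj: "i \<in> I \<Longrightarrow> psd d (fproj i)"
  using psd_congruence[OF pdef_psd cA, of i "B i"] B by (simp add: fproj_def)

lemma cF: "i \<in> I \<Longrightarrow> fproj i \<in> carrier_mat d d" using psd_fproj psd_carrier by blast

lemma cFH: "i \<in> I \<Longrightarrow> fproj i * H \<in> carrier_mat d d" by (rule mult_carrier_mat[OF cF cH])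

lemma trace_fproj: assumes i: "i \<in> I" shows "mtrace (fproj i * H) = of_nat (k i)"
proof -
  have "mtrace (fproj i * H) = mtrace (cadj (A i) * B i * (A i * H))"
    unfolding fproj_def using assoc_mult_mat[of "cadj (A i) * B i" d "k i" "A i" d H d] cA[OF i] cB[OF i] A[OF i] cH by simp
  also have "\<dots> = mtrace (A i * H * (cadj (A i) * B i))"
    by (rule mtrace_comm[of _ d "k i"]) (use cA[OF i] cB[OF i] A[OF i] cH in auto)
  also have "A i * H * (cadj (A i) * B i) = A i * H * cadj (A i) * B i"
    by (rule assoc_mult_mat[symmetric, of _ "k i" d _ "k i" _ "k i"]) (use cA[OF i] cB[OF i] A[OF i] cH in auto)
  finally show ?thesis using B i by simp
qed

text \<open>Cyclicity brings the trace to the form semidefinite times definite, on a space of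
  dimension \<open>k i\<close>, from which nonnegativity of overlaps can be read off.\<close>

lemma overlap_eq:
  assumes i: "i \<in> I" and j: "j \<in> I"
  defines "C \<equiv> A i * H * cadj (A j)"
  shows "mtrace (fproj i * H * (fproj j * H)) = mtrace (C * B j * cadj C * B i)"
proof -
  note c = cA[OF i] cB[OF i] A[OF i] cA[OF j] cB[OF j] A[OF j] cH
  have C: "C \<in> carrier_mat (k i) (k j)" using c by (auto simp: C_def)
  have cC: "cadj C = A j * H * cadj (A i)"
    unfolding C_def using c hermD(2)[OF pdef_herm[OF H]]
    by (subst cadj_mult[of _ "k i" d _ "k j"], simp, simp, subst cadj_mult[of _ "k i" d _ d])
      (auto simp: assoc_mult_mat[of "A j" "k j" d H d])
  have e1: "fproj i * H = cadj (A i) * (B i * (A i * H))"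
    unfolding fproj_def using c by (simp add: assoc_mult_mat[of _ d "k i" _ "k i" _ d] assoc_mult_mat[of _ d "k i" _ d _ d] assoc_mult_mat[of _ "k i" "k i" _ d _ d])
  have e2: "fproj j * H = cadj (A j) * (B j * (A j * H))"
    unfolding fproj_def using c by (simp add: assoc_mult_mat[of _ d "k j" _ "k j" _ d] assoc_mult_mat[of _ d "k j" _ d _ d] assoc_mult_mat[of _ "k j" "k j" _ d _ d])
  define W where "W = A i * H * (cadj (A j) * (B j * (A j * H)))"
  have W: "W \<in> carrier_mat (k i) d" using c by (auto simp: W_def)
  have "fproj i * H * (fproj j * H) = cadj (A i) * (B i * W)"
  proof -
    have "cadj (A i) * (B i * (A i * H)) * (fproj j * H) = cadj (A i) * (B i * (A i * H) * (fproj j * H))"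
      by (rule assoc_mult_mat[of _ d "k i" _ d _ d]) (use c cFH[OF j] in auto)
    also have "B i * (A i * H) * (fproj j * H) = B i * (A i * H * (fproj j * H))"
      by (rule assoc_mult_mat[of _ "k i" "k i" _ d _ d]) (use c cFH[OF j] in auto)
    finally show ?thesis unfolding e1 W_def e2 .
  qed
  then have "mtrace (fproj i * H * (fproj j * H)) = mtrace (B i * W * cadj (A i))"
    using mtrace_comm[of "cadj (A i)" d "k i" "B i * W"] c W by simp
  also have "B i * W * cadj (A i) = B i * (W * cadj (A i))"
    by (rule assoc_mult_mat[OF c(2) W c(1)])
  also have "mtrace \<dots> = mtrace (W * cadj (A i) * B i)"
    by (rule mtrace_comm[OF c(2)]) (use W c in auto)
  also have "W * cadj (A i) = C * B j * cadj C"
  proof -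
    have "W = C * (B j * (A j * H))" unfolding W_def C_def
      by (rule assoc_mult_mat[symmetric, of _ "k i" d _ "k j" _ d]) (use c in auto)
    also have "\<dots> = C * B j * (A j * H)"
      by (rule assoc_mult_mat[symmetric, OF C c(5)]) (use c in auto)
    finally have "W = C * B j * (A j * H)" .
    then show ?thesis unfolding cC
      using assoc_mult_mat[of "C * B j" "k i" "k j" "A j * H" d "cadj (A i)" "k i"] C c by auto
  qed
  finally show ?thesis .
qed

lemma overlap_nonneg:
  assumes i: "i \<in> I" and j: "j \<in> I" shows "0 \<le> overlap i j"
proof -
  let ?C = "A i * H * cadj (A j)"
  have C: "?C \<in> carrier_mat (k i) (k j)" using cA[OF j] A[OF i] cH by auto
  have K: "psd (k i) (?C * B j * cadj ?C)" using B j C by (intro psd_congruence[of "k j"] pdef_psd) auto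
  have "pdef (k i) (B i)" using B i by blast
  from spectrum_herm_pdef[OF psd_herm[OF K] this] obtain x :: "nat \<Rightarrow> real" where
    x: "mtrace (?C * B j * cadj ?C * B i) = of_real (\<Sum>a<k i. x a)"
    "psd (k i) (?C * B j * cadj ?C) \<longrightarrow> (\<forall>a<k i. 0 \<le> x a)" by metis
  have "0 \<le> (\<Sum>a<k i. x a)" using x(2) K by (intro sum_nonneg) auto
  then show ?thesis unfolding overlap_def overlap_eq[OF i j] x(1) by (simp del: of_real_sum)
qed

lemma overlap_self:
  assumes i: "i \<in> I" shows "overlap i i = real (k i)"
proof -
  let ?G = "A i * H * cadj (A i)"
  have G: "?G \<in> carrier_mat (k i) (k i)" using cA[OF i] A[OF i] cH by auto
  have "cadj ?G = ?G" using herm_congruence[OF pdef_herm[OF H] A[OF i]] by (simp add: herm_def)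
  then have "?G * B i * cadj ?G * B i = 1\<^sub>m (k i)" using B i left_mult_one_mat[OF G] by simp
  then show ?thesis unfolding overlap_def overlap_eq[OF i i] by simp
qed

lemma trace_msum_fproj:
  assumes L: "L \<subseteq> I"
  defines "Y \<equiv> msum d d fproj L"
  shows "Re (mtrace (Y * H)) = (\<Sum>i\<in>L. real (k i))"
    and "Re (mtrace (Y * H * (Y * H))) = (\<Sum>i\<in>L. \<Sum>j\<in>L. overlap i j)"
proof -
  have f: "\<And>i. i \<in> L \<Longrightarrow> fproj i \<in> carrier_mat d d" and fH: "\<And>i. i \<in> L \<Longrightarrow> fproj i * H \<in> carrier_mat d d"
    using L cF cFH by auto
  have YH: "Y * H = msum d d (\<lambda>i. fproj i * H) L" unfolding Y_def by (rule msum_mult_right[OF f cH])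
  have tr: "mtrace (fproj i * H) = of_nat (k i)" if "i \<in> L" for i using trace_fproj L that by blast
  show "Re (mtrace (Y * H)) = (\<Sum>i\<in>L. real (k i))"
    unfolding YH using mtrace_msum[of L "\<lambda>i. fproj i * H" d] fH tr by simp
  have "mtrace (Y * H * (Y * H)) = (\<Sum>i\<in>L. mtrace (fproj i * H * (Y * H)))"
    unfolding YH
    by (subst msum_mult_right[OF fH msum_carrier], simp, subst mtrace_msum)
      (use fH in \<open>auto intro: mult_carrier_mat[OF _ msum_carrier]\<close>)
  also have "\<dots> = (\<Sum>i\<in>L. \<Sum>j\<in>L. mtrace (fproj i * H * (fproj j * H)))"
  proof (rule sum.cong[OF refl])
    fix i assume i: "i \<in> L"
    show "mtrace (fproj i * H * (Y * H)) = (\<Sum>j\<in>L. mtrace (fproj i * H * (fproj j * H)))"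
      unfolding YH
      by (subst msum_mult_left[OF fH fH[OF i]], simp, subst mtrace_msum)
        (use fH i in \<open>auto intro: mult_carrier_mat[of _ d d]\<close>)
  qed
  finally show "Re (mtrace (Y * H * (Y * H))) = (\<Sum>i\<in>L. \<Sum>j\<in>L. overlap i j)"
    by (simp add: overlap_def)
qed

text \<open>All maps on the line factor through \<open>A a\<close> and \<open>A b\<close>, so the
  sum of the projections factors through \<open>k a + k b\<close> coordinates and
  \<open>rank_trace_bound\<close> applies.\<close>

lemma line_trace_bound:
  assumes L: "L \<subseteq> I" and ab: "a \<in> I" "b \<in> I"
    and dep: "\<And>c. c \<in> L \<Longrightarrow> \<exists>D1\<in>carrier_mat (k c) (k a). \<exists>D2\<in>carrier_mat (k c) (k b). A c = D1 * A a + D2 * A b"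
  shows "(\<Sum>i\<in>L. real (k i))\<^sup>2 \<le> real (k a + k b) * (\<Sum>i\<in>L. \<Sum>j\<in>L. overlap i j)"
proof -
  define Y where "Y = msum d d fproj L"
  have Yh: "herm d Y" unfolding Y_def using L psd_fproj by (intro psd_herm psd_msum) auto
  obtain D1 D2 where D: "\<And>c. c \<in> L \<Longrightarrow> D1 c \<in> carrier_mat (k c) (k a) \<and> D2 c \<in> carrier_mat (k c) (k b) \<and> A c = D1 c * A a + D2 c * A b"
    using dep by metis
  define W where "W c = B c * A c * H" for c
  have W: "W c \<in> carrier_mat (k c) d" if "c \<in> L" for c
    using cB[of c] A[of c] cH L that by (auto simp: W_def)
  define Z1 where "Z1 = msum (k a) d (\<lambda>c. cadj (D1 c) * W c) L"
  define Z2 where "Z2 = msum (k b) d (\<lambda>c. cadj (D2 c) * W c) L"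
  have c1: "cadj (D1 c) * W c \<in> carrier_mat (k a) d" and c2: "cadj (D2 c) * W c \<in> carrier_mat (k b) d" if "c \<in> L" for c
    using D[OF that] W[OF that] by (auto intro: mult_carrier_mat[of _ _ "k c"])
  have expand: "fproj c * H = cadj (A a) * (cadj (D1 c) * W c) + cadj (A b) * (cadj (D2 c) * W c)" if c: "c \<in> L" for c
  proof -
    have cI: "c \<in> I" using c L by auto
    have "fproj c * H = cadj (A c) * W c"
      unfolding fproj_def W_def using cA[OF cI] cB[OF cI] A[OF cI] cH
      by (simp add: assoc_mult_mat[of _ d "k c" _ "k c" _ d] assoc_mult_mat[of _ d "k c" _ d _ d] assoc_mult_mat[of _ "k c" "k c" _ d _ d])
    also have "cadj (A c) = cadj (A a) * cadj (D1 c) + cadj (A b) * cadj (D2 c)"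
    proof -
      have d: "D1 c * A a \<in> carrier_mat (k c) d" "D2 c * A b \<in> carrier_mat (k c) d"
        using D[OF c] A[OF ab(1)] A[OF ab(2)] by auto
      have "cadj (A c) = cadj (D1 c * A a + D2 c * A b)" using D[OF c] by simp
      also have "\<dots> = cadj (D1 c * A a) + cadj (D2 c * A b)" by (rule cadj_add[OF d])
      finally show ?thesis
        using D[OF c] cadj_mult[of "D1 c" "k c" "k a" "A a" d] cadj_mult[of "D2 c" "k c" "k b" "A b" d] A[OF ab(1)] A[OF ab(2)] by simp
    qed
    also have "\<dots> * W c = cadj (A a) * cadj (D1 c) * W c + cadj (A b) * cadj (D2 c) * W c"
      by (rule add_mult_distrib_mat[of _ d "k c"]) (use D[OF c] W[OF c] cA[OF ab(1)] cA[OF ab(2)] in auto)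
    also have "cadj (A a) * cadj (D1 c) * W c = cadj (A a) * (cadj (D1 c) * W c)"
      by (rule assoc_mult_mat[OF cA[OF ab(1)] _ W[OF c]]) (use D[OF c] in auto)
    also have "cadj (A b) * cadj (D2 c) * W c = cadj (A b) * (cadj (D2 c) * W c)"
      by (rule assoc_mult_mat[OF cA[OF ab(2)] _ W[OF c]]) (use D[OF c] in auto)
    finally show ?thesis .
  qed
  have "Y * H = msum d d (\<lambda>i. fproj i * H) L"
    unfolding Y_def by (rule msum_mult_right[OF _ cH]) (use cF L in auto)
  also have "\<dots> = cadj (A a) * Z1 + cadj (A b) * Z2"
  proof -
    have m1: "cadj (A a) * Z1 = msum d d (\<lambda>c. cadj (A a) * (cadj (D1 c) * W c)) L"
      unfolding Z1_def by (rule msum_mult_left[OF c1 cA[OF ab(1)]])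
    have m2: "cadj (A b) * Z2 = msum d d (\<lambda>c. cadj (A b) * (cadj (D2 c) * W c)) L"
      unfolding Z2_def by (rule msum_mult_left[OF c2 cA[OF ab(2)]])
    have t: "(fproj c * H) $$ (i,j) = (cadj (A a) * (cadj (D1 c) * W c)) $$ (i,j) + (cadj (A b) * (cadj (D2 c) * W c)) $$ (i,j)"
      if "c \<in> L" "i < d" "j < d" for c i j
      unfolding expand[OF that(1)] using that c1[OF that(1)] c2[OF that(1)] cA[OF ab(1)] cA[OF ab(2)]
      by (intro index_add_mat(1)) auto
    show ?thesis unfolding m1 m2
      by (intro eq_matI) (auto simp: t sum.distrib simp del: index_mult_mat(1))
  qed
  finally have YH: "Y * H = cadj (A a) * Z1 + cadj (A b) * Z2" .
  have Z: "Z1 \<in> carrier_mat (k a) d" "Z2 \<in> carrier_mat (k b) d" by (auto simp: Z1_def Z2_def)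
  obtain P Z where "P \<in> carrier_mat d (k a + k b)" "Z \<in> carrier_mat (k a + k b) d"
      "cadj (A a) * Z1 + cadj (A b) * Z2 = P * Z"
    by (rule add_mult_stacked[OF cA[OF ab(1)] cA[OF ab(2)] Z])
  then have "(Re (mtrace (Y * H)))\<^sup>2 \<le> real (k a + k b) * Re (mtrace (Y * H * (Y * H)))"
    using rank_trace_bound[OF Yh H] YH by metis
  then show ?thesis unfolding Y_def trace_msum_fproj[OF L] .
qed

text \<open>Summing \<open>line_trace_bound\<close> over all ordered pairs replaces
  \<open>k a + k b\<close> by its average \<open>2 * s / n\<close> and yields
  \<open>Q >= n * s / 2\<close>. The diagonal accounts for \<open>s\<close> of this. The constant
  1/4 is the best that this estimate gives for \<open>n = 3\<close>.\<close>

lemma line_overlap: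
  assumes L: "L \<subseteq> I" and r: "3 \<le> card L"
    and dep: "\<And>a b c. a \<in> L \<Longrightarrow> b \<in> L \<Longrightarrow> a \<noteq> b \<Longrightarrow> c \<in> L \<Longrightarrow>
      \<exists>D1\<in>carrier_mat (k c) (k a). \<exists>D2\<in>carrier_mat (k c) (k b). A c = D1 * A a + D2 * A b"
  shows "(\<Sum>a\<in>L. \<Sum>b\<in>L - {a}. real (k a) / 4) \<le> (\<Sum>a\<in>L. \<Sum>b\<in>L - {a}. overlap a b)"
proof -
  have fin: "finite L" using L finI finite_subset by blast
  define n where "n = real (card L)"
  define s where "s = (\<Sum>i\<in>L. real (k i))"
  define Q where "Q = (\<Sum>i\<in>L. \<Sum>j\<in>L. overlap i j)"
  have n: "3 \<le> n" using r by (simp add: n_def)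
  have card1: "real (card (L - {a})) = n - 1" if "a \<in> L" for a
    using that fin r by (simp add: n_def of_nat_diff)
  have off: "(\<Sum>b\<in>L - {a}. f b) = (\<Sum>b\<in>L. f b) - f a" if "a \<in> L" for a and f :: "'i \<Rightarrow> real"
    using sum.remove[OF fin that, of f] by simp
  have "(\<Sum>a\<in>L. \<Sum>b\<in>L - {a}. overlap a b) = (\<Sum>a\<in>L. (\<Sum>b\<in>L. overlap a b) - real (k a))"
    using L overlap_self by (intro sum.cong refl) (auto simp: off subset_iff)
  then have R: "(\<Sum>a\<in>L. \<Sum>b\<in>L - {a}. overlap a b) = Q - s" by (simp add: sum_subtractf Q_def s_def)
  have Lh: "(\<Sum>a\<in>L. \<Sum>b\<in>L - {a}. real (k a) / 4) = (n - 1) * s / 4"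
    using card1 by (simp add: s_def sum_distrib_left sum_divide_distrib)
  have s0: "0 \<le> s" unfolding s_def by (intro sum_nonneg) auto
  show ?thesis
  \<comment> \<open>All maps on the line may have rank 0; then the common factor \<open>s\<close>
    cannot be cancelled, but nonnegative overlaps suffice.\<close>
  proof (cases "s = 0")
    case True
    have "0 \<le> Q - s" unfolding R[symmetric] using L by (intro sum_nonneg overlap_nonneg) auto
    then show ?thesis unfolding R Lh using True by simp
  next
    case False
    then have sp: "0 < s" using s0 by simp
    have "(\<Sum>a\<in>L. \<Sum>b\<in>L - {a}. s\<^sup>2) \<le> (\<Sum>a\<in>L. \<Sum>b\<in>L - {a}. real (k a + k b) * Q)"
    proof (intro sum_mono)
      fix a b assume "a \<in> L" "b \<in> L - {a}"
      then show "s\<^sup>2 \<le> real (k a + k b) * Q"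
        unfolding s_def Q_def using L dep by (intro line_trace_bound) auto
    qed
    also have "(\<Sum>a\<in>L. \<Sum>b\<in>L - {a}. s\<^sup>2) = n * (n - 1) * s\<^sup>2"
      using card1 by (simp add: n_def)
    also have "(\<Sum>a\<in>L. \<Sum>b\<in>L - {a}. real (k a + k b) * Q) = (\<Sum>a\<in>L. ((n - 1) * real (k a) + (s - real (k a))) * Q)"
    proof (rule sum.cong[OF refl])
      fix a assume a: "a \<in> L"
      have "(\<Sum>b\<in>L - {a}. real (k a + k b) * Q) = (\<Sum>b\<in>L - {a}. real (k a) + real (k b)) * Q"
        by (simp only: sum_distrib_right of_nat_add)
      also have "(\<Sum>b\<in>L - {a}. real (k a) + real (k b)) = (n - 1) * real (k a) + (s - real (k a))"
        using card1[OF a] off[OF a, of "\<lambda>b. real (k b)"] by (simp add: sum.distrib s_def)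
      finally show "(\<Sum>b\<in>L - {a}. real (k a + k b) * Q) = ((n - 1) * real (k a) + (s - real (k a))) * Q" .
    qed
    also have "\<dots> = ((n - 1) * s + (n * s - s)) * Q"
      unfolding sum_distrib_right[symmetric]
      by (simp add: sum.distrib sum_subtractf sum_distrib_left[symmetric] s_def n_def)
    also have "\<dots> = 2 * (n - 1) * s * Q" by (simp add: algebra_simps)
    finally have "(n - 1) * s * (n * s) \<le> (n - 1) * s * (2 * Q)" by (simp add: power2_eq_square mult_ac)
    then have nQ: "n * s \<le> 2 * Q" using n sp by (simp add: mult_le_cancel_left_pos)
    \<comment> \<open>Here three members matter: \<open>n * s / 2 - s >= (n - 1) * s / 4\<close>
      amounts to \<open>n * s >= 3 * s\<close>.\<close>
    have "3 * s \<le> n * s" using n sp by simp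
    moreover have "(n - 1) * s = n * s - s" by (simp add: left_diff_distrib)
    ultimately have "(n - 1) * s / 4 \<le> Q - s" using nQ by linarith
    then show ?thesis unfolding R Lh .
  qed
qed

text \<open>The pairs in \<open>P\<close> are partitioned by the line \<open>lin p\<close> they span.\<close>

lemma slope_lower_bound_aux:
  assumes tr: "Re (mtrace (frame_op B * H * (frame_op B * H))) \<le> 2 * \<sigma>\<^sup>2 * real d"
    and P: "P \<subseteq> I \<times> I"
    and line: "\<And>p. p \<in> P \<Longrightarrow> lin p \<subseteq> I" "\<And>p. p \<in> P \<Longrightarrow> 3 \<le> card (lin p)"
    and mem: "\<And>a b. (a,b) \<in> P \<Longrightarrow> a \<in> lin (a,b) \<and> b \<in> lin (a,b) \<and> a \<noteq> b"
    and uniq: "\<And>p a b. p \<in> P \<Longrightarrow> a \<in> lin p \<Longrightarrow> b \<in> lin p \<Longrightarrow> a \<noteq> b \<Longrightarrow> (a,b) \<in> P \<and> lin (a,b) = lin p"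
    and dep: "\<And>a b c. (a,b) \<in> P \<Longrightarrow> c \<in> lin (a,b) \<Longrightarrow>
      \<exists>D1\<in>carrier_mat (k c) (k a). \<exists>D2\<in>carrier_mat (k c) (k b). A c = D1 * A a + D2 * A b"
    and deg: "\<And>a. a \<in> I \<Longrightarrow> t \<le> real (card {b. (a,b) \<in> P})"
  shows "t \<le> 8 * \<sigma>"
proof -
  have fP: "finite P" using P finI finite_subset by blast
  have fl: "finite (lin p)" if "p \<in> P" for p using line(1)[OF that] finI finite_subset by blast
  \<comment> \<open>The pairs spanning a given line are all ordered pairs of distinct members, by
    \<open>uniq\<close>; so a sum over \<open>P\<close> can be carried out line by line.\<close>
  have fibre: "{p \<in> P. lin p = L} = Sigma L (\<lambda>a. L - {a})" if LP: "L \<in> lin ` P" for L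
  proof -
    obtain q where q: "q \<in> P" "L = lin q" using LP by blast
    show ?thesis
    proof (intro equalityI subsetI)
      fix p assume "p \<in> {p \<in> P. lin p = L}"
      then show "p \<in> Sigma L (\<lambda>a. L - {a})" using mem[of "fst p" "snd p"] by (cases p) auto
    next
      fix p assume "p \<in> Sigma L (\<lambda>a. L - {a})"
      then show "p \<in> {p \<in> P. lin p = L}" using uniq[OF q(1), of "fst p" "snd p"] q(2) by (cases p) auto
    qed
  qed
  have group: "(\<Sum>(a,b)\<in>P. f a b) = (\<Sum>L\<in>lin ` P. \<Sum>a\<in>L. \<Sum>b\<in>L - {a}. f a b)" for f :: "'i \<Rightarrow> 'i \<Rightarrow> real"
  proof -
    have "(\<Sum>(a,b)\<in>P. f a b) = (\<Sum>L\<in>lin ` P. \<Sum>(a,b)\<in>{p \<in> P. lin p = L}. f a b)"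
      by (rule sum.image_gen[OF fP])
    also have "\<dots> = (\<Sum>L\<in>lin ` P. \<Sum>a\<in>L. \<Sum>b\<in>L - {a}. f a b)"
    proof (rule sum.cong[OF refl])
      fix L assume L: "L \<in> lin ` P"
      then have "finite L" using fl by blast
      then show "(\<Sum>(a,b)\<in>{p \<in> P. lin p = L}. f a b) = (\<Sum>a\<in>L. \<Sum>b\<in>L - {a}. f a b)"
        unfolding fibre[OF L] by (subst sum.Sigma) auto
    qed
    finally show ?thesis .
  qed
  have PS: "P = Sigma I (\<lambda>a. {b. (a,b) \<in> P})" using P by auto
  have "t * (\<Sum>a\<in>I. real (k a)) / 4 = (\<Sum>a\<in>I. t * (real (k a) / 4))"
    by (simp add: sum_distrib_left sum_divide_distrib)
  also have "\<dots> \<le> (\<Sum>a\<in>I. real (card {b. (a,b) \<in> P}) * (real (k a) / 4))"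
    using deg by (intro sum_mono mult_right_mono) auto
  also have "\<dots> = (\<Sum>a\<in>I. \<Sum>b\<in>{b. (a,b) \<in> P}. real (k a) / 4)" by simp
  also have "\<dots> = (\<Sum>(a,b)\<in>P. real (k a) / 4)"
  proof -
    have "finite {b. (a,b) \<in> P}" for a using finite_subset[of "{b. (a,b) \<in> P}" "snd ` P"] fP by force
    then show ?thesis by (subst (2) PS, subst sum.Sigma) (use finI in auto)
  qed
  also have "\<dots> = (\<Sum>L\<in>lin ` P. \<Sum>a\<in>L. \<Sum>b\<in>L - {a}. real (k a) / 4)" by (rule group)
  also have "\<dots> \<le> (\<Sum>L\<in>lin ` P. \<Sum>a\<in>L. \<Sum>b\<in>L - {a}. overlap a b)"
  proof (rule sum_mono)
    fix L assume "L \<in> lin ` P"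
    then obtain p where p: "p \<in> P" "L = lin p" by blast
    show "(\<Sum>a\<in>L. \<Sum>b\<in>L - {a}. real (k a) / 4) \<le> (\<Sum>a\<in>L. \<Sum>b\<in>L - {a}. overlap a b)"
    proof (rule line_overlap)
      fix a b c assume abc: "a \<in> L" "b \<in> L" "a \<noteq> b" "c \<in> L"
      then have "(a,b) \<in> P" "lin (a,b) = L" using uniq[OF p(1)] p(2) by auto
      then show "\<exists>D1\<in>carrier_mat (k c) (k a). \<exists>D2\<in>carrier_mat (k c) (k b). A c = D1 * A a + D2 * A b"
        using dep abc by blast
    qed (use p line in auto)
  qed
  also have "\<dots> = (\<Sum>(a,b)\<in>P. overlap a b)" by (rule group[symmetric])
  \<comment> \<open>Pairs outside \<open>P\<close>, including the diagonal, contribute nonnegative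
    overlaps.\<close>
  also have "\<dots> \<le> (\<Sum>(a,b)\<in>I \<times> I. overlap a b)"
    using P finI by (intro sum_mono2) (auto simp: overlap_nonneg)
  also have "\<dots> = (\<Sum>a\<in>I. \<Sum>b\<in>I. overlap a b)" by (simp add: sum.cartesian_product)
  also have "\<dots> = Re (mtrace (frame_op B * H * (frame_op B * H)))"
  proof -
    have "frame_op B = msum d d fproj I" unfolding frame_op_def by (rule msum_cong) (simp add: fproj_def)
    then show ?thesis using trace_msum_fproj(2)[OF order_refl] by simp
  qed
  also have "\<dots> \<le> 2 * \<sigma>\<^sup>2 * real d" by (rule tr)
  \<comment> \<open>The 8 is the 4 of \<open>line_overlap\<close> times the 2 of the trace bound;
    one factor \<sigma> times \<open>d\<close> comes from the sum of the ranks and cancels.\<close>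
  finally have "(\<sigma> * real d) * t \<le> (\<sigma> * real d) * (8 * \<sigma>)" unfolding slope by (simp add: power2_eq_square mult_ac)
  then show ?thesis using \<sigma> d by (simp add: mult_le_cancel_left_pos)
qed

end

lemma slope_lower_bound:
  assumes "P \<subseteq> I \<times> I"
    and "\<And>p. p \<in> P \<Longrightarrow> lin p \<subseteq> I" "\<And>p. p \<in> P \<Longrightarrow> 3 \<le> card (lin p)"
    and "\<And>a b. (a,b) \<in> P \<Longrightarrow> a \<in> lin (a,b) \<and> b \<in> lin (a,b) \<and> a \<noteq> b"
    and "\<And>p a b. p \<in> P \<Longrightarrow> a \<in> lin p \<Longrightarrow> b \<in> lin p \<Longrightarrow> a \<noteq> b \<Longrightarrow> (a,b) \<in> P \<and> lin (a,b) = lin p"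
    and "\<And>a b c. (a,b) \<in> P \<Longrightarrow> c \<in> lin (a,b) \<Longrightarrow>
      \<exists>D1\<in>carrier_mat (k c) (k a). \<exists>D2\<in>carrier_mat (k c) (k b). A c = D1 * A a + D2 * A b"
    and "\<And>a. a \<in> I \<Longrightarrow> t \<le> real (card {b. (a,b) \<in> P})"
  shows "t \<le> 8 * \<sigma>"
proof -
  obtain H B where HB: "pdef d H" "\<forall>i\<in>I. pdef (k i) (B i) \<and> A i * H * cadj (A i) * B i = 1\<^sub>m (k i) \<and>
      B i * (A i * H * cadj (A i)) = 1\<^sub>m (k i)"
    "Re (mtrace (frame_op B * H * (frame_op B * H))) \<le> 2 * \<sigma>\<^sup>2 * real d" by (rule almost_isotropic)
  show ?thesis by (rule slope_lower_bound_aux[OF HB assms])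
qed

end

section \<open>Linear algebra in coordinate space\<close>

interpretation cpair: vector_space_pair cscale cscale ..

abbreviation clinear :: "((nat \<Rightarrow> complex) \<Rightarrow> nat \<Rightarrow> complex) \<Rightarrow> bool" where
  "clinear \<equiv> Vector_Spaces.linear cscale cscale"

lemma clinearI:
  assumes "\<And>x y. f (x + y) = f x + f y" "\<And>c x. f (cscale c x) = cscale c (f x)"
  shows "clinear f"
  using assms by unfold_locales auto

lemma cspace_finite_basis:
  assumes "S \<subseteq> cspace l"
  obtains B where "B \<subseteq> S" "cvec.independent B" "S \<subseteq> cvec.span B" "card B = cvec.dim S" "finite B"
proof -
  obtain B where B: "B \<subseteq> S" "cvec.independent B" "S \<subseteq> cvec.span B" "card B = cvec.dim S"
    using cvec.basis_exists[of S] by metis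
  moreover have "finite B" using independent_cspace_finite[OF B(2)] B(1) assms by blast
  ultimately show ?thesis using that by blast
qed

lemma card_le_dim_cspace:
  assumes "T \<subseteq> cspace l" "cvec.independent S" "S \<subseteq> cvec.span T"
  shows "card S \<le> cvec.dim T"
proof -
  obtain B where B: "T \<subseteq> cvec.span B" "card B = cvec.dim T" "finite B"
    using cspace_finite_basis[OF assms(1)] by metis
  have "cvec.span T \<subseteq> cvec.span B" using B(1) cvec.span_minimal by blast
  then show ?thesis using cvec.independent_span_bound[OF B(3) assms(2)] assms(3) B(2) by auto
qed

lemma dim_linear_image_le:
  assumes "S \<subseteq> cspace l" "clinear f"
  shows "cvec.dim (f ` S) \<le> cvec.dim S"
proof -
  obtain B where B: "S \<subseteq> cvec.span B" "card B = cvec.dim S" "finite B"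
    using cspace_finite_basis[OF assms(1)] by metis
  have "f ` S \<subseteq> cvec.span (f ` B)" using B(1) cpair.linear_span_image[OF assms(2)] by blast
  then have "cvec.dim (f ` S) \<le> card (f ` B)" using B(3) by (intro cvec.dim_le_card) auto
  also have "\<dots> \<le> cvec.dim S" using B card_image_le by metis
  finally show ?thesis .
qed

lemma subspace_basis_family:
  assumes "cvec.subspace S" "S \<subseteq> cspace l" "cvec.dim S = m"
  obtains f where "inj_on f {..<m}" "cvec.independent (f ` {..<m})" "cvec.span (f ` {..<m}) = S"
proof -
  obtain B where B: "B \<subseteq> S" "cvec.independent B" "S \<subseteq> cvec.span B" "card B = cvec.dim S" "finite B"
    by (rule cspace_finite_basis[OF assms(2)])
  obtain f where f: "bij_betw f {..<m} B"
    using ex_bij_betw_nat_finite[OF B(5)] B(4) assms(3) by (metis atLeast0LessThan)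
  have "cvec.span B = S" using B(1,3) assms(1) cvec.span_minimal by blast
  then show ?thesis using that[of f] f B(2) by (simp add: bij_betw_def)
qed

lemma independent_familyI:
  fixes f :: "nat \<Rightarrow> nat \<Rightarrow> complex"
  assumes "\<And>c. (\<Sum>j<m. cscale (c j) (f j)) = 0 \<Longrightarrow> \<forall>j<m. c j = 0"
  shows "inj_on f {..<m}" "cvec.independent (f ` {..<m})"
proof -
  show inj: "inj_on f {..<m}"
  proof (rule inj_onI, rule ccontr)
    fix i j assume ij: "i \<in> {..<m}" "j \<in> {..<m}" "f i = f j" "i \<noteq> j"
    \<comment> \<open>A repeated vector is a relation with coefficients 1 and -1.\<close>
    define c :: "nat \<Rightarrow> complex" where "c t = (if t = i then 1 else if t = j then -1 else 0)" for t
    have "(\<Sum>t<m. cscale (c t) (f t)) = 0"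
    proof
      fix a
      have "(\<Sum>t<m. c t * f t a) = (\<Sum>t<m. (if t = i then f i a else 0) - (if t = j then f j a else 0))"
        using ij(4) by (intro sum.cong) (auto simp: c_def)
      also have "\<dots> = 0" using ij by (simp add: sum_subtractf)
      finally show "(\<Sum>t<m. cscale (c t) (f t)) a = 0 a" by (simp add: sum_cscale_apply)
    qed
    then have "\<forall>j<m. c j = 0" by (rule assms)
    then have "c i = 0" using ij(1) by blast
    then show False by (simp add: c_def)
  qed
  show "cvec.independent (f ` {..<m})"
  proof (rule cvec.independent_if_scalars_zero)
    fix u x assume u: "(\<Sum>x\<in>f ` {..<m}. cscale (u x) x) = 0" and x: "x \<in> f ` {..<m}"
    have "(\<Sum>j<m. cscale (u (f j)) (f j)) = 0" using u unfolding sum.reindex[OF inj] comp_def .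
    then have "\<forall>j<m. u (f j) = 0" by (rule assms)
    then show "u x = 0" using x by blast
  qed simp
qed

lemma span_family:
  assumes "x \<in> cvec.span (f ` J)" "finite J"
  obtains c where "x = (\<Sum>j\<in>J. cscale (c j) (f j))"
proof -
  have "\<exists>c. x = (\<Sum>j\<in>J. cscale (c j) (f j))"
    using assms(1)
  proof (induction rule: cvec.span_induct_alt)
    case base
    have "0 = (\<Sum>j\<in>J. cscale 0 (f j))" by (simp add: cscale_def zero_fun_def[symmetric])
    then show ?case by (intro exI[of _ "\<lambda>_. 0"])
  next
    case (step e y z)
    then obtain i c where "y = f i" "i \<in> J" "z = (\<Sum>j\<in>J. cscale (c j) (f j))" by auto
    then have "cscale e y + z = (\<Sum>j\<in>J. cscale (if j = i then e + c j else c j) (f j))"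
    proof -
      have "(\<Sum>j\<in>J. cscale (if j = i then e + c j else c j) (f j))
          = cscale (e + c i) (f i) + (\<Sum>j\<in>J - {i}. cscale (c j) (f j))"
        using \<open>i \<in> J\<close> assms(2) by (subst sum.remove[of _ i]) auto
      moreover have "z = cscale (c i) (f i) + (\<Sum>j\<in>J - {i}. cscale (c j) (f j))"
        using \<open>z = _\<close> \<open>i \<in> J\<close> assms(2) by (subst (asm) sum.remove[of _ i]) auto
      ultimately show ?thesis using \<open>y = f i\<close> by (simp add: cvec.scale_left_distrib add.assoc)
    qed
    then show ?case by (intro exI[of _ "\<lambda>j. if j = i then e + c j else c j"])
  qed
  with that show ?thesis by blast
qed

text \<open>The Moore-Penrose inverse: \<open>cadj F * F\<close> is definite when \<open>F\<close>
  is injective.\<close>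

lemma injective_left_inverse:
  fixes F :: "complex mat"
  assumes F: "F \<in> carrier_mat m q" and inj: "\<And>v. v \<in> carrier_vec q \<Longrightarrow> F *\<^sub>v v = 0\<^sub>v m \<Longrightarrow> v = 0\<^sub>v q"
  obtains E where "E \<in> carrier_mat q m" "E * F = 1\<^sub>m q"
proof -
  have cF: "cadj F \<in> carrier_mat q m" using F by simp
  have "pdef q (cadj F * 1\<^sub>m m * cadj (cadj F))"
    by (rule pdef_congruence[OF pdef_one cF]) (use inj in simp)
  then have "pdef q (cadj F * F)" using cF by simp
  then obtain T where T: "pdef q T" "T * (cadj F * F) = 1\<^sub>m q" by (rule pdef_inverse)
  have "T * cadj F * F = 1\<^sub>m q" using T(2) assoc_mult_mat[OF pdef_carrier[OF T(1)] cF F] by simp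
  then show ?thesis using that[of "T * cadj F"] mult_carrier_mat[OF pdef_carrier[OF T(1)] cF] by blast
qed

text \<open>The pivot columns form \<open>F\<close>, and \<open>A\<close> holds the coordinates of
  all columns in them. This replaces the restriction matrices by matrices of full row rank, while
  the left inverse \<open>E\<close> recovers \<open>A\<close> from \<open>R\<close>.\<close>

lemma rank_factorization:
  assumes R: "R \<in> carrier_mat m d" and q: "q = cvec.dim (colf R ` {..<d})"
  obtains F A E where "F \<in> carrier_mat m q" "A \<in> carrier_mat q d" "E \<in> carrier_mat q m"
    "R = F * A" "E * F = 1\<^sub>m q"
proof -
  let ?J = "greedy R"
  let ?s = "sorted_list_of_set ?J"
  have dims: "dim_row R = m" "dim_col R = d" using R by auto
  have JJ: "?J \<inter> {..<d} = ?J" using greedy_subset[of R] dims by auto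
  have cJ: "card ?J = q" using card_greedy[of d R] JJ dims q by simp
  define F where "F = submat_cols R ?J"
  have F: "F \<in> carrier_mat m q" using cJ dims by (simp add: F_def submat_cols_def)
  have "\<And>v. v \<in> carrier_vec q \<Longrightarrow> F *\<^sub>v v = 0\<^sub>v m \<Longrightarrow> v = 0\<^sub>v q"
    using submat_greedy_inj[of _ R] cJ dims by (simp add: F_def)
  from injective_left_inverse[OF F this] obtain E where E: "E \<in> carrier_mat q m" "E * F = 1\<^sub>m q" by blast
  have bij: "bij_betw ((!) ?s) {..<q} ?J" using bij_betw_sorted_list[of ?J] cJ by simp
  have "\<exists>c. colf R j = (\<Sum>g\<in>?J. cscale (c g) (colf R g))" if "j < d" for j
  proof -
    have "colf R j \<in> cvec.span (colf R ` {..<d})" using that by (intro cvec.span_base) auto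
    also have "\<dots> = cvec.span (colf R ` ?J)" using greedy_independent[of d R] dims unfolding JJ by simp
    finally show ?thesis using span_family[of "colf R j" "colf R" ?J] by (metis finite_greedy)
  qed
  then obtain c where c: "\<And>j. j < d \<Longrightarrow> colf R j = (\<Sum>g\<in>?J. cscale (c j g) (colf R g))" by metis
  define A where "A = mat q d (\<lambda>(b,j). c j (?s ! b))"
  have A: "A \<in> carrier_mat q d" by (simp add: A_def)
  have "R = F * A"
  proof (rule eq_matI)
    fix a j assume "a < dim_row (F * A)" "j < dim_col (F * A)"
    then have aj: "a < m" "j < d" using F A by auto
    have "R $$ (a,j) = colf R j a" using aj dims by (simp add: colf_def)
    also have "\<dots> = (\<Sum>g\<in>?J. c j g * colf R g a)" unfolding c[OF aj(2)] by (rule sum_cscale_apply)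
    also have "\<dots> = (\<Sum>b<q. c j (?s ! b) * colf R (?s ! b) a)"
      using sum.reindex_bij_betw[OF bij, of "\<lambda>g. c j g * colf R g a"] by simp
    also have "\<dots> = (\<Sum>b<q. F $$ (a,b) * A $$ (b,j))"
      using aj dims cJ by (intro sum.cong) (auto simp: F_def A_def submat_cols_def colf_def)
    also have "\<dots> = (F * A) $$ (a,j)" by (rule mult_mat_index[OF F A aj, symmetric])
    finally show "R $$ (a,j) = (F * A) $$ (a,j)" .
  qed (use R F A in auto)
  with that[OF F A E(1) _ E(2)] show ?thesis by blast
qed

lemma dim_colf_mult_le:
  assumes F: "F \<in> carrier_mat m q" and M: "M \<in> carrier_mat q d" and "s \<le> d"
  shows "cvec.dim (colf (F * M) ` {..<s}) \<le> cvec.dim (colf M ` {..<s})"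
proof -
  define f :: "(nat \<Rightarrow> complex) \<Rightarrow> nat \<Rightarrow> complex" where
    "f x = (\<lambda>a. if a < m then \<Sum>b<q. F $$ (a,b) * x b else 0)" for x
  have lin: "clinear f"
    by (rule clinearI) (auto simp: f_def cscale_def fun_eq_iff algebra_simps sum.distrib sum_distrib_left)
  have "colf (F * M) j = f (colf M j)" if "j < d" for j
    using F M that by (auto simp: colf_def f_def mult_mat_index[OF F M] simp del: index_mult_mat(1))
  then have "colf (F * M) ` {..<s} = f ` colf M ` {..<s}" using assms(3) by (auto simp: image_image)
  moreover have "colf M ` {..<s} \<subseteq> cspace q" using colf_cspace[of M] M by auto
  ultimately show ?thesis using dim_linear_image_le[OF _ lin] by simp
qed

text \<open>A dimension count: \<open>V1\<close> and \<open>V2\<close> are complementary and give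
  \<open>2 * m\<close> independent vectors in a space spanned by \<open>2 * m\<close> vectors. This
  is the axiom that two distinct members of a line determine it.\<close>

lemma span_Un_eq_if_trivial_Int:
  assumes U: "cvec.subspace U1" "U1 \<subseteq> cspace l" "cvec.dim U1 = m" "cvec.subspace U2" "U2 \<subseteq> cspace l" "cvec.dim U2 = m"
    and V: "cvec.subspace V1" "V1 \<subseteq> cspace l" "cvec.dim V1 = m" "cvec.subspace V2" "V2 \<subseteq> cspace l" "cvec.dim V2 = m"
    and int: "V1 \<inter> V2 = {0}" and sub: "V1 \<subseteq> cvec.span (U1 \<union> U2)" "V2 \<subseteq> cvec.span (U1 \<union> U2)"
  shows "cvec.span (V1 \<union> V2) = cvec.span (U1 \<union> U2)"
proof -
  obtain f1 where f1: "inj_on f1 {..<m}" "cvec.independent (f1 ` {..<m})" "cvec.span (f1 ` {..<m}) = V1"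
    by (rule subspace_basis_family[OF V(1-3)])
  obtain f2 where f2: "inj_on f2 {..<m}" "cvec.independent (f2 ` {..<m})" "cvec.span (f2 ` {..<m}) = V2"
    by (rule subspace_basis_family[OF V(4-6)])
  obtain g1 where g1: "cvec.span (g1 ` {..<m}) = U1" by (rule subspace_basis_family[OF U(1-3)])
  obtain g2 where g2: "cvec.span (g2 ` {..<m}) = U2" by (rule subspace_basis_family[OF U(4-6)])
  define f where "f j = (if j < m then f1 j else f2 (j - m))" for j
  have "\<forall>j<m + m. c j = 0" if "(\<Sum>j<m + m. cscale (c j) (f j)) = 0" for c
  proof -
    have split: "(\<Sum>j<m + s. h j) = (\<Sum>j<m. h j) + (\<Sum>j<s. h (m + j))" for s and h :: "nat \<Rightarrow> nat \<Rightarrow> complex"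
      by (induction s) (auto simp: add.assoc)
    define x where "x = (\<Sum>j<m. cscale (c j) (f1 j))"
    define y where "y = (\<Sum>j<m. cscale (c (m + j)) (f2 j))"
    have xy: "x + y = 0" using that unfolding split x_def y_def by (simp add: f_def)
    have x1: "x \<in> V1" unfolding x_def f1(3)[symmetric] by (intro cvec.span_sum cvec.span_scale cvec.span_base) auto
    have y2: "y \<in> V2" unfolding y_def f2(3)[symmetric] by (intro cvec.span_sum cvec.span_scale cvec.span_base) auto
    have "x = - y" using xy by (simp add: eq_neg_iff_add_eq_0)
    then have "x \<in> V2" using y2 V(4) cvec.subspace_neg by blast
    then have x0: "x = 0" using x1 int by blast
    then have y0: "y = 0" using xy by simp
    have "c j = 0" if "j < m" for j
      by (rule independent_family_zero[OF f1(2,1) finite_lessThan x0[unfolded x_def]]) (use that in simp)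
    moreover have "c (m + j) = 0" if "j < m" for j
      by (rule independent_family_zero[OF f2(2,1) finite_lessThan y0[unfolded y_def], of j]) (use that in simp)
    ultimately show ?thesis by (metis add_diff_inverse_nat nat_add_left_cancel_less)
  qed
  note ind = independent_familyI[where m = "m + m" and f = f, OF this]
  have fV: "f ` {..<m + m} \<subseteq> cvec.span (V1 \<union> V2)"
  proof
    fix z assume "z \<in> f ` {..<m + m}"
    then obtain j where j: "j < m + m" "z = f j" by auto
    have "f1 j \<in> V1" if "j < m" using f1(3) that cvec.span_base[of "f1 j" "f1 ` {..<m}"] by auto
    moreover have "f2 (j - m) \<in> V2" if "\<not> j < m" using f2(3) that j(1) cvec.span_base[of "f2 (j - m)" "f2 ` {..<m}"] by auto
    ultimately have "z \<in> V1 \<union> V2" using j(2) by (auto simp: f_def)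
    then show "z \<in> cvec.span (V1 \<union> V2)" by (rule cvec.span_base)
  qed
  have VU: "cvec.span (V1 \<union> V2) \<subseteq> cvec.span (U1 \<union> U2)" using sub by (intro cvec.span_minimal) auto
  have UG: "cvec.span (U1 \<union> U2) \<subseteq> cvec.span (g1 ` {..<m} \<union> g2 ` {..<m})"
  proof (rule cvec.span_minimal)
    show "U1 \<union> U2 \<subseteq> cvec.span (g1 ` {..<m} \<union> g2 ` {..<m})"
      using cvec.span_mono[of "g1 ` {..<m}" "g1 ` {..<m} \<union> g2 ` {..<m}"] cvec.span_mono[of "g2 ` {..<m}" "g1 ` {..<m} \<union> g2 ` {..<m}"] g1 g2 by auto
  qed simp
  have "x \<in> cvec.span (V1 \<union> V2)" if x: "x \<in> cvec.span (U1 \<union> U2)" for x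
  proof (rule ccontr)
    \<comment> \<open>Such an \<open>x\<close> would extend the \<open>2 * m\<close> independent
      vectors to \<open>2 * m + 1\<close>.\<close>
    assume "x \<notin> cvec.span (V1 \<union> V2)"
    then have nx: "x \<notin> cvec.span (f ` {..<m + m})"
      using fV cvec.span_minimal[OF fV] by auto
    have "cvec.independent (insert x (f ` {..<m + m}))" by (rule cvec.independent_insertI[OF nx ind(2)])
    moreover have "insert x (f ` {..<m + m}) \<subseteq> cvec.span (g1 ` {..<m} \<union> g2 ` {..<m})"
      using x fV VU UG by blast
    ultimately have "card (insert x (f ` {..<m + m})) \<le> card (g1 ` {..<m} \<union> g2 ` {..<m})"
      using cvec.independent_span_bound[of "g1 ` {..<m} \<union> g2 ` {..<m}"] by blast
    also have "\<dots> \<le> card (g1 ` {..<m}) + card (g2 ` {..<m})" by (rule card_Un_le)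
    also have "\<dots> \<le> m + m" using card_image_le[of "{..<m}" g1] card_image_le[of "{..<m}" g2] by simp
    finally have "card (insert x (f ` {..<m + m})) \<le> m + m" .
    moreover have "x \<notin> f ` {..<m + m}" using nx cvec.span_base[of x "f ` {..<m + m}"] by (rule contrapos_nn)
    ultimately show False using card_image[OF ind(1)] by simp
  qed
  with VU show ?thesis by blast
qed

section \<open>Arrangements of subspaces\<close>

definition ip :: "nat \<Rightarrow> (nat \<Rightarrow> complex) \<Rightarrow> (nat \<Rightarrow> complex) \<Rightarrow> complex" where
  "ip l y v = (\<Sum>j<l. y j * cnj (v j))"

lemma ip_sum_left: "ip l (\<Sum>t\<in>T. cscale (c t) (f t)) v = (\<Sum>t\<in>T. c t * ip l (f t) v)"
  unfolding ip_def sum_cscale_apply sum_distrib_left sum_distrib_right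
  by (subst sum.swap) (simp add: mult.assoc)

lemma ip_sum_right: "ip l y (\<Sum>t\<in>T. cscale (c t) (f t)) = (\<Sum>t\<in>T. cnj (c t) * ip l y (f t))"
  unfolding ip_def sum_cscale_apply sum_distrib_left sum_distrib_right cnj_sum
  by (subst sum.swap) (simp add: mult_ac)

lemma ip_add_right: "ip l y (v + w) = ip l y v + ip l y w"
  by (simp add: ip_def algebra_simps sum.distrib)

lemma ip_self_zero:
  assumes "y \<in> cspace l" "ip l y y = 0" shows "y = 0"
proof -
  have "complex_of_real (\<Sum>j<l. (norm (y j))\<^sup>2) = 0"
    using assms(2) by (simp add: ip_def complex_nonneg_sq)
  then have "(\<Sum>j<l. (norm (y j))\<^sup>2) = 0" using of_real_eq_0_iff by blast
  then have "\<forall>j<l. y j = 0" by (subst (asm) sum_nonneg_eq_0_iff) auto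
  then have "y j = 0" for j using assms(1) by (cases "j < l") (auto simp: cspace_def)
  then show ?thesis by (simp add: fun_eq_iff)
qed

locale arrangement =
  fixes I :: "nat set" and V :: "nat \<Rightarrow> (nat \<Rightarrow> complex) set" and k l :: nat
  assumes finI: "finite I"
    and V: "\<And>i. i \<in> I \<Longrightarrow> cvec.subspace (V i)" "\<And>i. i \<in> I \<Longrightarrow> V i \<subseteq> cspace l" "\<And>i. i \<in> I \<Longrightarrow> cvec.dim (V i) = k"
begin

definition X :: "(nat \<Rightarrow> complex) set" where "X = cvec.span (\<Union>i\<in>I. V i)"

lemma X_cspace: "X \<subseteq> cspace l"
  unfolding X_def using V(2) by (intro cvec.span_minimal subspace_cspace) auto

text \<open>A subspace \<open>Y\<close> of least slope plays the role of the last quotient of a Harder-Narasimhan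
  filtration. Functionals on \<open>X\<close> are identified with vectors of \<open>X\<close> through \<open>ip\<close>, so that \<open>Y\<close> is a
  subspace of \<open>X\<close> itself.\<close>

lemma semistable_reduction:
  assumes pos: "0 < cvec.dim X"
  obtains d A \<kappa> \<sigma> where "semistable I A \<kappa> d \<sigma>" "\<sigma> * real (cvec.dim X) \<le> real k * real (card I)"
    "\<forall>a\<in>I. \<forall>b\<in>I. \<forall>c\<in>I. V c \<subseteq> cvec.span (V a \<union> V b) \<longrightarrow>
      (\<exists>D1\<in>carrier_mat (\<kappa> c) (\<kappa> a). \<exists>D2\<in>carrier_mat (\<kappa> c) (\<kappa> b). A c = D1 * A a + D2 * A b)"
proof -
  have "\<forall>i\<in>I. \<exists>f. cvec.span (f ` {..<k}) = V i"
    using subspace_basis_family[OF V] by metis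
  then obtain v where v: "\<And>i. i \<in> I \<Longrightarrow> cvec.span (v i ` {..<k}) = V i" by metis
  \<comment> \<open>The functional given by \<open>y\<close>, restricted to \<open>V i\<close> and
    recorded through its values on the spanning family \<open>v i\<close>.\<close>
  define r where "r i y = (\<lambda>a. if a < k then ip l y (v i a) else 0)" for i y
  have rlin: "clinear (r i)" for i
    by (rule clinearI) (auto simp: r_def ip_def cscale_def fun_eq_iff algebra_simps sum.distrib sum_distrib_left)
  have rk: "r i ` Y \<subseteq> cspace k" for i Y by (auto simp: r_def cspace_def)
  \<comment> \<open>A vector of \<open>X\<close> orthogonal to every \<open>V i\<close> is
    orthogonal to itself.\<close>
  have rinj: "y = 0" if y: "y \<in> X" "\<And>i. i \<in> I \<Longrightarrow> r i y = 0" for y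
  proof -
    have V0: "ip l y w = 0" if w: "w \<in> V i" "i \<in> I" for w i
    proof -
      obtain c where c: "w = (\<Sum>t<k. cscale (c t) (v i t))"
        using span_family[of w "v i" "{..<k}"] v[OF w(2)] w(1) by auto
      have "ip l y (v i t) = 0" if "t < k" for t
        using fun_cong[OF y(2)[OF w(2)], of t] that by (simp add: r_def)
      then show ?thesis unfolding c ip_sum_right by simp
    qed
    have "ip l y w = 0" if "w \<in> X" for w
      using that unfolding X_def
    proof (induction rule: cvec.span_induct_alt)
      case base show ?case by (simp add: ip_def)
    next
      case (step c x z)
      then have "ip l y x = 0" using V0 by auto
      moreover have "ip l y (cscale c x) = cnj c * ip l y x"
        using ip_sum_right[of l y "\<lambda>_. c" "\<lambda>_. x" "{0::nat}"] by simp
      ultimately show ?case unfolding ip_add_right using step by simp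
    qed
    then have "ip l y y = 0" using y(1) by blast
    then show ?thesis using y(1) X_cspace ip_self_zero by blast
  qed
  define R where "R Y = (\<Sum>i\<in>I. cvec.dim (r i ` Y))" for Y
  define slp where "slp Y = real (R Y) / real (cvec.dim Y)" for Y
  define \<Y> where "\<Y> = {Y. cvec.subspace Y \<and> Y \<subseteq> X \<and> 0 < cvec.dim Y}"
  have XY: "X \<in> \<Y>" using pos by (simp add: \<Y>_def X_def)
  have Rle: "R Y \<le> k * card I" for Y
  proof -
    have "R Y \<le> (\<Sum>i\<in>I. k)" unfolding R_def by (intro sum_mono dim_cspace_le rk)
    then show ?thesis by (simp add: mult.commute)
  qed
  \<comment> \<open>There may be infinitely many subspaces, but numerators and denominators of
    slopes are bounded integers, so a least slope exists.\<close>
  have "slp ` \<Y> \<subseteq> (\<lambda>(a,b). real a / real b) ` ({..k * card I} \<times> {..l})"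
  proof (rule image_subsetI)
    fix Y assume "Y \<in> \<Y>"
    then have "cvec.dim Y \<le> l" using X_cspace by (intro dim_cspace_le) (auto simp: \<Y>_def)
    then show "slp Y \<in> (\<lambda>(a,b). real a / real b) ` ({..k * card I} \<times> {..l})"
      using Rle[of Y] by (intro image_eqI[of _ _ "(R Y, cvec.dim Y)"]) (auto simp: slp_def)
  qed
  then have fin: "finite (slp ` \<Y>)" by (rule finite_subset) simp
  have "Min (slp ` \<Y>) \<in> slp ` \<Y>" using fin XY by (intro Min_in) auto
  then obtain Y0 where Y0: "Y0 \<in> \<Y>" "slp Y0 = Min (slp ` \<Y>)" by auto
  have Ymin: "slp Y0 \<le> slp Y" if "Y \<in> \<Y>" for Y unfolding Y0(2) using fin that by simp
  define \<sigma> where "\<sigma> = slp Y0"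
  define d where "d = cvec.dim Y0"
  have Y0': "cvec.subspace Y0" "Y0 \<subseteq> X" "0 < d" using Y0(1) by (auto simp: \<Y>_def d_def)
  have Y0l: "Y0 \<subseteq> cspace l" using Y0'(2) X_cspace by blast
  have \<sigma>d: "\<sigma> * real d = real (R Y0)" using Y0'(3) by (simp add: \<sigma>_def slp_def d_def)
  obtain \<eta> where \<eta>: "inj_on \<eta> {..<d}" "cvec.independent (\<eta> ` {..<d})" "cvec.span (\<eta> ` {..<d}) = Y0"
    by (rule subspace_basis_family[OF Y0'(1) Y0l d_def[symmetric]])
  have \<sigma>_X: "\<sigma> * real (cvec.dim X) \<le> real k * real (card I)"
  proof -
    have "\<sigma> * real (cvec.dim X) \<le> slp X * real (cvec.dim X)" unfolding \<sigma>_def by (intro mult_right_mono Ymin XY) simp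
    also have "\<dots> = real (R X)" using pos by (simp add: slp_def)
    also have "\<dots> \<le> real (k * card I)" using Rle by (simp only: of_nat_le_iff)
    finally show ?thesis by simp
  qed
  define M where "M i = mat k d (\<lambda>(a,j). ip l (\<eta> j) (v i a))" for i
  have M: "M i \<in> carrier_mat k d" for i by (simp add: M_def)
  define comb where "comb L j = (\<Sum>c<d. cscale (L $$ (c,j)) (\<eta> c))" for L :: "complex mat" and j :: nat
  have colM: "colf (M i * L) j = r i (comb L j)" if "L \<in> carrier_mat d d" "j < d" for i L j
  proof
    fix a show "colf (M i * L) j a = r i (comb L j) a"
    proof (cases "a < k")
      case True
      have "(M i * L) $$ (a,j) = (\<Sum>c<d. M i $$ (a,c) * L $$ (c,j))" by (rule mult_mat_index[OF M that(1) True that(2)])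
      also have "\<dots> = ip l (comb L j) (v i a)"
        unfolding comb_def ip_sum_left using True by (intro sum.cong) (auto simp: M_def)
      finally show ?thesis using True by (simp add: colf_def r_def M_def)
    qed (simp add: colf_def r_def M_def)
  qed
  \<comment> \<open>The leading columns of an invertible \<open>L\<close>, read as coordinates in
    the basis \<eta>, span an \<open>m\<close>-dimensional subspace of \<open>Y0\<close>; the claim
    is minimality of the slope of \<open>Y0\<close> against it.\<close>
  have semi: "\<sigma> * real m \<le> (\<Sum>i\<in>I. real (cvec.dim (colf (M i * L) ` {..<m})))"
    if L: "L \<in> carrier_mat d d" "det L \<noteq> 0" and m: "m \<le> d" for L m
  proof (cases "m = 0")
    case False
    have zero: "\<forall>j<m. c j = 0" if c: "(\<Sum>j<m. cscale (c j) (comb L j)) = 0" for c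
    proof -
      define w where "w = vec d (\<lambda>j. if j < m then c j else 0)"
      have w: "w \<in> carrier_vec d" by (simp add: w_def)
      have Lw: "(L *\<^sub>v w) $ t = (\<Sum>j<m. L $$ (t,j) * c j)" if "t < d" for t
      proof -
        have "(L *\<^sub>v w) $ t = (\<Sum>j<d. L $$ (t,j) * w $ j)" by (rule mult_mat_vec_index_sum[OF L(1) w that])
        also have "\<dots> = (\<Sum>j<m. L $$ (t,j) * w $ j)" using m by (intro sum.mono_neutral_right) (auto simp: w_def)
        also have "\<dots> = (\<Sum>j<m. L $$ (t,j) * c j)" using m by (intro sum.cong) (auto simp: w_def)
        finally show ?thesis .
      qed
      have "(\<Sum>t<d. cscale ((L *\<^sub>v w) $ t) (\<eta> t)) = (\<Sum>j<m. cscale (c j) (comb L j))"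
      proof
        fix a
        have "(\<Sum>t<d. (L *\<^sub>v w) $ t * \<eta> t a) = (\<Sum>t<d. \<Sum>j<m. L $$ (t,j) * c j * \<eta> t a)"
          using Lw by (intro sum.cong) (auto simp: sum_distrib_right simp del: index_mult_mat_vec)
        also have "\<dots> = (\<Sum>j<m. \<Sum>t<d. L $$ (t,j) * c j * \<eta> t a)" by (rule sum.swap)
        also have "\<dots> = (\<Sum>j<m. c j * comb L j a)"
          by (simp add: comb_def sum_cscale_apply sum_distrib_left mult_ac)
        finally show "(\<Sum>t<d. cscale ((L *\<^sub>v w) $ t) (\<eta> t)) a = (\<Sum>j<m. cscale (c j) (comb L j)) a"
          by (simp only: sum_cscale_apply)
      qed
      then have "(\<Sum>t<d. cscale ((L *\<^sub>v w) $ t) (\<eta> t)) = 0" using c by simp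
      then have "(L *\<^sub>v w) $ t = 0" if "t < d" for t
        by (rule independent_family_zero[OF \<eta>(2,1) finite_lessThan]) (use that in simp)
      then have "L *\<^sub>v w = 0\<^sub>v d" using L(1) by (intro eq_vecI) (auto simp del: index_mult_mat_vec)
      then have "w = 0\<^sub>v d" using det_0_iff_vec_prod_zero_field[OF L(1)] L(2) w by blast
      then have w0: "w $ j = 0" if "j < d" for j using that by simp
      show ?thesis
      proof (intro allI impI)
        fix j assume "j < m"
        then show "c j = 0" using w0[of j] m by (simp add: w_def)
      qed
    qed
    note ind = independent_familyI[where m = m and f = "comb L", OF zero]
    define Y where "Y = cvec.span (comb L ` {..<m})"
    have "comb L j \<in> Y0" for j
      unfolding comb_def \<eta>(3)[symmetric] by (intro cvec.span_sum cvec.span_scale cvec.span_base) auto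
    then have "Y \<subseteq> Y0" unfolding Y_def using Y0'(1) by (intro cvec.span_minimal) auto
    moreover have dY: "cvec.dim Y = m"
      unfolding Y_def using cvec.dim_span_eq_card_independent[OF ind(2)] card_image[OF ind(1)] by simp
    ultimately have "Y \<in> \<Y>" using False Y0'(2) by (auto simp: \<Y>_def Y_def)
    then have "\<sigma> \<le> slp Y" unfolding \<sigma>_def by (rule Ymin)
    then have "\<sigma> * real m \<le> real (R Y)" using False dY by (simp add: slp_def field_simps)
    also have "\<dots> = (\<Sum>i\<in>I. real (cvec.dim (colf (M i * L) ` {..<m})))"
    proof -
      have "r i ` Y = cvec.span (colf (M i * L) ` {..<m})" for i
      proof -
        have "colf (M i * L) ` {..<m} = r i ` comb L ` {..<m}"
          using colM[OF L(1)] m by (auto simp: image_image)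
        then show ?thesis unfolding Y_def using cpair.linear_span_image[OF rlin] by metis
      qed
      then show ?thesis by (simp add: R_def)
    qed
    finally show ?thesis .
  qed simp
  \<comment> \<open>On \<open>Y0\<close> the restriction maps may lose rank, so \<kappa> varies with
    \<open>i\<close>; the factorisation below removes the redundant rows.\<close>
  define \<kappa> where "\<kappa> i = cvec.dim (colf (M i) ` {..<d})" for i
  have "\<exists>F A E. F \<in> carrier_mat k (\<kappa> i) \<and> A \<in> carrier_mat (\<kappa> i) d \<and> E \<in> carrier_mat (\<kappa> i) k \<and>
      M i = F * A \<and> E * F = 1\<^sub>m (\<kappa> i)" for i
    using rank_factorization[OF M \<kappa>_def] by metis
  then obtain F A E where FAE: "\<And>i. F i \<in> carrier_mat k (\<kappa> i)" "\<And>i. A i \<in> carrier_mat (\<kappa> i) d"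
    "\<And>i. E i \<in> carrier_mat (\<kappa> i) k" "\<And>i. M i = F i * A i" "\<And>i. E i * F i = 1\<^sub>m (\<kappa> i)" by metis
  have AE: "A i = E i * M i" for i
    unfolding FAE(4) using assoc_mult_mat[OF FAE(3)[of i] FAE(1)[of i] FAE(2)[of i]] FAE(5) FAE(2)[of i] by simp
  have comb1: "comb (1\<^sub>m d) j = \<eta> j" if "j < d" for j
  proof
    fix a
    have "comb (1\<^sub>m d) j a = (\<Sum>c<d. if c = j then \<eta> j a else 0)"
      unfolding comb_def sum_cscale_apply using that by (intro sum.cong) auto
    then show "comb (1\<^sub>m d) j a = \<eta> j a" using that by simp
  qed
  have \<kappa>_r: "\<kappa> i = cvec.dim (r i ` Y0)" for i
  proof -
    have "M i * 1\<^sub>m d = M i" by (rule right_mult_one_mat[OF M])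
    then have "colf (M i) ` {..<d} = r i ` \<eta> ` {..<d}"
      using colM[of "1\<^sub>m d" _ i] comb1 by (auto simp: image_image)
    then have "cvec.span (colf (M i) ` {..<d}) = r i ` Y0"
      using cpair.linear_span_image[OF rlin] \<eta>(3) by metis
    then show ?thesis unfolding \<kappa>_def by (metis cvec.dim_span)
  qed
  have "semistable I A \<kappa> d \<sigma>"
  proof
    show "finite I" by (rule finI)
    show "A i \<in> carrier_mat (\<kappa> i) d" for i by (rule FAE(2))
    show "0 < d" by (rule Y0'(3))
    show slope: "(\<Sum>i\<in>I. real (\<kappa> i)) = \<sigma> * real d" unfolding \<sigma>d R_def \<kappa>_r by simp
    show "u = 0\<^sub>v d" if u: "u \<in> carrier_vec d" "\<And>i. i \<in> I \<Longrightarrow> A i *\<^sub>v u = 0\<^sub>v (\<kappa> i)" for u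
    proof -
      define y where "y = (\<Sum>c<d. cscale (u $ c) (\<eta> c))"
      have "y \<in> Y0" unfolding y_def \<eta>(3)[symmetric] by (intro cvec.span_sum cvec.span_scale cvec.span_base) auto
      then have yX: "y \<in> X" using Y0'(2) by blast
      have "r i y = 0" if i: "i \<in> I" for i
      proof
        fix a show "r i y a = 0 a"
        proof (cases "a < k")
          case True
          have "M i *\<^sub>v u = F i *\<^sub>v (A i *\<^sub>v u)" unfolding FAE(4) by (rule assoc_mult_mat_vec[OF FAE(1) FAE(2) u(1)])
          also have "\<dots> = 0\<^sub>v k" unfolding u(2)[OF i] using FAE(1)[of i] by (intro eq_vecI) auto
          finally have "(M i *\<^sub>v u) $ a = 0" using True by simp
          moreover have "(M i *\<^sub>v u) $ a = (\<Sum>c<d. M i $$ (a,c) * u $ c)" by (rule mult_mat_vec_index_sum[OF M u(1) True])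
          moreover have "\<dots> = ip l y (v i a)"
            unfolding y_def ip_sum_left using True by (intro sum.cong) (auto simp: M_def)
          ultimately show ?thesis using True by (simp add: r_def)
        qed (simp add: r_def)
      qed
      then have "y = 0" using rinj yX by blast
      then have "u $ c = 0" if "c < d" for c unfolding y_def
        by (rule independent_family_zero[OF \<eta>(2,1) finite_lessThan]) (use that in simp)
      then show ?thesis using u(1) by (intro eq_vecI) auto
    qed
    show "\<sigma> * real m \<le> (\<Sum>i\<in>I. real (cvec.dim (colf (A i * L) ` {..<m})))"
      if L: "L \<in> carrier_mat d d" "det L \<noteq> 0" "m \<le> d" for L m
    proof -
      have "\<sigma> * real m \<le> (\<Sum>i\<in>I. real (cvec.dim (colf (M i * L) ` {..<m})))" by (rule semi[OF L])
      also have "\<dots> \<le> (\<Sum>i\<in>I. real (cvec.dim (colf (A i * L) ` {..<m})))"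
      proof (intro sum_mono, unfold of_nat_le_iff)
        fix i
        have "M i * L = F i * (A i * L)" unfolding FAE(4) by (rule assoc_mult_mat[OF FAE(1) FAE(2) L(1)])
        then show "cvec.dim (colf (M i * L) ` {..<m}) \<le> cvec.dim (colf (A i * L) ` {..<m})"
          using dim_colf_mult_le[OF FAE(1)[of i] mult_carrier_mat[OF FAE(2)[of i] L(1)] L(3)] by simp
      qed
      finally show ?thesis .
    qed
    show "0 < \<sigma>"
    proof -
      \<comment> \<open>If all restrictions of \<open>Y0\<close> vanished, a basis vector of
        \<open>Y0\<close> would be orthogonal to all of \<open>X\<close>.\<close>
      have "0 < R Y0"
      proof (rule ccontr)
        assume "\<not> 0 < R Y0"
        then have z: "cvec.dim (r i ` Y0) = 0" if "i \<in> I" for i using that finI by (simp add: R_def)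
        have \<eta>0: "\<eta> 0 \<in> Y0" unfolding \<eta>(3)[symmetric] using Y0'(3) by (intro cvec.span_base) auto
        have "r i (\<eta> 0) = 0" if i: "i \<in> I" for i
        proof (rule ccontr)
          assume "r i (\<eta> 0) \<noteq> 0"
          then have "cvec.independent {r i (\<eta> 0)}" by simp
          then have "card {r i (\<eta> 0)} \<le> cvec.dim (r i ` Y0)"
            using \<eta>0 by (intro card_le_dim_cspace[OF rk]) (auto intro!: cvec.span_base)
          then show False using z[OF i] by simp
        qed
        then have "\<eta> 0 = 0" using rinj \<eta>0 Y0'(2) by blast
        then have "0 \<in> \<eta> ` {..<d}" using Y0'(3) by (metis image_eqI lessThan_iff)
        then have "cvec.dependent (\<eta> ` {..<d})" by (rule cvec.dependent_zero)
        then show False using \<eta>(2) by simp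
      qed
      then show ?thesis using \<sigma>d Y0'(3) by (metis mult_pos_pos of_nat_0_less_iff zero_less_mult_pos2)
    qed
  qed
  moreover have "\<forall>a\<in>I. \<forall>b\<in>I. \<forall>c\<in>I. V c \<subseteq> cvec.span (V a \<union> V b) \<longrightarrow>
      (\<exists>D1\<in>carrier_mat (\<kappa> c) (\<kappa> a). \<exists>D2\<in>carrier_mat (\<kappa> c) (\<kappa> b). A c = D1 * A a + D2 * A b)"
  proof (intro ballI impI)
    fix a b c assume abc: "a \<in> I" "b \<in> I" "c \<in> I" and sub: "V c \<subseteq> cvec.span (V a \<union> V b)"
    have "\<exists>\<alpha> \<beta>. v c t = (\<Sum>s<k. cscale (\<alpha> s) (v a s)) + (\<Sum>s<k. cscale (\<beta> s) (v b s))" if "t < k" for t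
    proof -
      have "v c t \<in> V c" unfolding v[OF abc(3), symmetric] using that by (intro cvec.span_base) auto
      then have "v c t \<in> cvec.span (V a \<union> V b)" using sub by blast
      moreover have "cvec.span (V a) = V a" "cvec.span (V b) = V b" using V(1) abc by auto
      ultimately obtain x y where xy: "x \<in> V a" "y \<in> V b" "v c t = x + y" by (auto simp: cvec.span_Un)
      obtain \<alpha> where "x = (\<Sum>s<k. cscale (\<alpha> s) (v a s))"
        using span_family[of x "v a" "{..<k}"] v[OF abc(1)] xy(1) by auto
      moreover obtain \<beta> where "y = (\<Sum>s<k. cscale (\<beta> s) (v b s))"
        using span_family[of y "v b" "{..<k}"] v[OF abc(2)] xy(2) by auto
      ultimately show ?thesis using xy(3) by blast
    qed
    then obtain \<alpha> \<beta> where ab: "\<And>t. t < k \<Longrightarrow> v c t = (\<Sum>s<k. cscale (\<alpha> t s) (v a s)) + (\<Sum>s<k. cscale (\<beta> t s) (v b s))"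
      by metis
    \<comment> \<open>The coefficients are conjugated because \<open>ip\<close> is conjugate linear
      in its second argument.\<close>
    define C1 where "C1 = mat k k (\<lambda>(t,s). cnj (\<alpha> t s))"
    define C2 where "C2 = mat k k (\<lambda>(t,s). cnj (\<beta> t s))"
    have C: "C1 \<in> carrier_mat k k" "C2 \<in> carrier_mat k k" by (auto simp: C1_def C2_def)
    have Mc: "M c = C1 * M a + C2 * M b"
    proof (rule eq_matI)
      fix t j assume "t < dim_row (C1 * M a + C2 * M b)" "j < dim_col (C1 * M a + C2 * M b)"
      then have tj: "t < k" "j < d" using C M[of a] M[of b] by (auto simp: M_def)
      have "M c $$ (t,j) = (\<Sum>s<k. cnj (\<alpha> t s) * ip l (\<eta> j) (v a s)) + (\<Sum>s<k. cnj (\<beta> t s) * ip l (\<eta> j) (v b s))"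
        using tj ab[OF tj(1)] by (simp add: M_def ip_add_right ip_sum_right)
      also have "\<dots> = (C1 * M a) $$ (t,j) + (C2 * M b) $$ (t,j)"
        unfolding mult_mat_index[OF C(1) M tj] mult_mat_index[OF C(2) M tj] using tj by (simp add: C1_def C2_def M_def)
      finally show "M c $$ (t,j) = (C1 * M a + C2 * M b) $$ (t,j)" using tj C M[of a] M[of b] by (simp add: M_def)
    qed (use C M[of a] M[of b] M[of c] in auto)
    have EC: "E c * C1 \<in> carrier_mat (\<kappa> c) k" "E c * C2 \<in> carrier_mat (\<kappa> c) k" using FAE(3)[of c] C by auto
    have "A c = E c * (C1 * M a) + E c * (C2 * M b)"
      unfolding AE[of c] Mc by (rule mult_add_distrib_mat[OF FAE(3) mult_carrier_mat[OF C(1) M] mult_carrier_mat[OF C(2) M]])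
    also have "E c * (C1 * M a) = E c * C1 * F a * A a"
      using assoc_mult_mat[OF FAE(3)[of c] C(1) M[of a]] assoc_mult_mat[OF EC(1) FAE(1)[of a] FAE(2)[of a]] FAE(4)[of a] by simp
    also have "E c * (C2 * M b) = E c * C2 * F b * A b"
      using assoc_mult_mat[OF FAE(3)[of c] C(2) M[of b]] assoc_mult_mat[OF EC(2) FAE(1)[of b] FAE(2)[of b]] FAE(4)[of b] by simp
    finally show "\<exists>D1\<in>carrier_mat (\<kappa> c) (\<kappa> a). \<exists>D2\<in>carrier_mat (\<kappa> c) (\<kappa> b). A c = D1 * A a + D2 * A b"
      using mult_carrier_mat[OF EC(1) FAE(1)] mult_carrier_mat[OF EC(2) FAE(1)] by blast
  qed
  ultimately show ?thesis using \<sigma>_X that by blast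
qed

end

text \<open>The slope is bounded below by the number of pairs on lines and above by comparison with
  all of \<open>X\<close>; both bounds are proportional to \<open>n\<close>, which cancels.\<close>

lemma dim_span_arrangement_le:
  fixes V :: "nat \<Rightarrow> (nat \<Rightarrow> complex) set" and \<delta> :: real
  assumes n: "0 < n"
    and V: "\<forall>i\<in>{1..n}. cvec.subspace (V i) \<and> V i \<subseteq> cspace l \<and> cvec.dim (V i) = k"
    and int: "\<forall>i\<in>{1..n}. \<forall>i'\<in>{1..n}. i \<noteq> i' \<longrightarrow> V i \<inter> V i' = {0}"
    and many: "\<forall>i1\<in>{1..n}. real (card {i2 \<in> {1..n} - {i1}.
        \<exists>i3\<in>{1..n} - {i1, i2}. V i3 \<subseteq> cvec.span (V i1 \<union> V i2)}) \<ge> \<delta> * real n"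
  shows "\<delta> * real (cvec.dim (cvec.span (\<Union>i\<in>{1..n}. V i))) \<le> 8 * real k"
proof -
  let ?I = "{1..n}"
  interpret arrangement ?I V k l using V by unfold_locales auto
  show ?thesis
  proof (cases "cvec.dim X = 0")
    case False
    then have "0 < cvec.dim X" by simp
    then obtain d A \<kappa> \<sigma> where ss: "semistable ?I A \<kappa> d \<sigma>"
      and \<sigma>: "\<sigma> * real (cvec.dim X) \<le> real k * real (card ?I)"
      and dep: "\<forall>a\<in>?I. \<forall>b\<in>?I. \<forall>c\<in>?I. V c \<subseteq> cvec.span (V a \<union> V b) \<longrightarrow>
      (\<exists>D1\<in>carrier_mat (\<kappa> c) (\<kappa> a). \<exists>D2\<in>carrier_mat (\<kappa> c) (\<kappa> b). A c = D1 * A a + D2 * A b)"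
      by (rule semistable_reduction)
    define lin where "lin = (\<lambda>(a,b). {c \<in> ?I. V c \<subseteq> cvec.span (V a \<union> V b)})"
    define P where "P = {(a,b). a \<in> ?I \<and> b \<in> ?I \<and> a \<noteq> b \<and> (\<exists>c\<in>?I - {a,b}. V c \<subseteq> cvec.span (V a \<union> V b))}"
    have self: "V a \<subseteq> cvec.span (V a \<union> V b)" "V b \<subseteq> cvec.span (V a \<union> V b)" for a b
      using cvec.span_superset[of "V a \<union> V b"] by auto
    have linP: "a \<in> lin (a,b)" "b \<in> lin (a,b)" "a \<noteq> b" "3 \<le> card (lin (a,b))" if ab: "(a,b) \<in> P" for a b
    proof -
      show 1: "a \<in> lin (a,b)" "b \<in> lin (a,b)" "a \<noteq> b" using ab self by (auto simp: P_def lin_def)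
      obtain c where "c \<in> ?I - {a,b}" "V c \<subseteq> cvec.span (V a \<union> V b)" using ab unfolding P_def by blast
      then have "{a,b,c} \<subseteq> lin (a,b)" "card {a,b,c} = 3" using 1 by (auto simp: lin_def)
      moreover have "finite (lin (a,b))" by (simp add: lin_def)
      ultimately show "3 \<le> card (lin (a,b))" by (metis card_mono)
    qed
    have same: "(c,e) \<in> P \<and> lin (c,e) = lin (a,b)" if ab: "(a,b) \<in> P" and ce: "c \<in> lin (a,b)" "e \<in> lin (a,b)" "c \<noteq> e" for a b c e
    proof -
      have I: "a \<in> ?I" "b \<in> ?I" "c \<in> ?I" "e \<in> ?I" using ab ce by (auto simp: P_def lin_def)
      have "cvec.span (V c \<union> V e) = cvec.span (V a \<union> V b)"
      proof (rule span_Un_eq_if_trivial_Int)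
        show "V c \<inter> V e = {0}" using int I ce(3) by blast
        show "V c \<subseteq> cvec.span (V a \<union> V b)" "V e \<subseteq> cvec.span (V a \<union> V b)" using ce by (auto simp: lin_def)
      qed (use V I in blast)+
      then have eq: "lin (c,e) = lin (a,b)" by (simp add: lin_def)
      \<comment> \<open>At least three members lie on the line, so some member other than
        \<open>c\<close> and \<open>e\<close> witnesses that the new pair is in
        \<open>P\<close>.\<close>
      have "card {c,e} < card (lin (a,b))" using linP(4)[OF ab] by (simp add: card_insert_if)
      then have "\<not> lin (a,b) \<subseteq> {c,e}" by (metis card_mono finite.emptyI finite.insertI not_less)
      then obtain f where "f \<in> lin (c,e)" "f \<notin> {c,e}" using eq by blast
      then have "(c,e) \<in> P" using I ce(3) by (auto simp: P_def lin_def)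
      with eq show ?thesis by blast
    qed
    have deg: "\<delta> * real n \<le> real (card {b. (a,b) \<in> P})" if a: "a \<in> ?I" for a
    proof -
      have "{b. (a,b) \<in> P} = {b \<in> ?I - {a}. \<exists>c\<in>?I - {a,b}. V c \<subseteq> cvec.span (V a \<union> V b)}"
        using a by (auto simp: P_def)
      then show ?thesis using many a by simp
    qed
    have "\<delta> * real n \<le> 8 * \<sigma>"
    proof (rule semistable.slope_lower_bound[OF ss, of P lin])
      show "P \<subseteq> ?I \<times> ?I" by (auto simp: P_def)
      show "lin p \<subseteq> ?I" for p by (cases p) (auto simp: lin_def)
      show "3 \<le> card (lin p)" if "p \<in> P" for p using linP(4)[of "fst p" "snd p"] that by simp
      show "a \<in> lin (a,b) \<and> b \<in> lin (a,b) \<and> a \<noteq> b" if "(a,b) \<in> P" for a b using linP[OF that] by blast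
      show "(a,b) \<in> P \<and> lin (a,b) = lin p" if "p \<in> P" "a \<in> lin p" "b \<in> lin p" "a \<noteq> b" for p a b
        using same[of "fst p" "snd p" a b] that by simp
      show "\<exists>D1\<in>carrier_mat (\<kappa> c) (\<kappa> a). \<exists>D2\<in>carrier_mat (\<kappa> c) (\<kappa> b). A c = D1 * A a + D2 * A b"
        if "(a,b) \<in> P" "c \<in> lin (a,b)" for a b c
      proof -
        have "a \<in> ?I" "b \<in> ?I" "c \<in> ?I" "V c \<subseteq> cvec.span (V a \<union> V b)" using that by (auto simp: P_def lin_def)
        then show ?thesis using dep by blast
      qed
      show "\<delta> * real n \<le> real (card {b. (a,b) \<in> P})" if "a \<in> ?I" for a using deg[OF that] .
    qed
    then have "\<delta> * real n * real (cvec.dim X) \<le> 8 * \<sigma> * real (cvec.dim X)" by (rule mult_right_mono) simp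
    also have "\<dots> \<le> 8 * (real k * real n)" using \<sigma> by simp
    finally have "real n * (\<delta> * real (cvec.dim X)) \<le> real n * (8 * real k)" by (simp add: mult_ac)
    then have "\<delta> * real (cvec.dim X) \<le> 8 * real k" using n by (simp add: mult_le_cancel_left_pos)
    then show ?thesis unfolding X_def .
  next
    case True
    then show ?thesis unfolding X_def by simp
  qed
qed

theorem theorem2:
  "\<exists>C::real. C > 0 \<and>
    (\<forall>(k::nat) (n::nat) (l::nat) (\<delta>::real) (V :: nat \<Rightarrow> (nat \<Rightarrow> complex) set).
      k > 0 \<longrightarrow> n > 0 \<longrightarrow> l > 0 \<longrightarrow> \<delta> > 0 \<longrightarrow>
      (\<forall>i\<in>{1..n}. cvec.subspace (V i) \<and> V i \<subseteq> cspace l \<and> cvec.dim (V i) = k) \<longrightarrow>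
      (\<forall>i\<in>{1..n}. \<forall>i'\<in>{1..n}. i \<noteq> i' \<longrightarrow> V i \<inter> V i' = {0}) \<longrightarrow>
      (\<forall>i1\<in>{1..n}.
         real (card {i2 \<in> {1..n} - {i1}.
                 \<exists>i3\<in>{1..n} - {i1, i2}. V i3 \<subseteq> cvec.span (V i1 \<union> V i2)}) \<ge> \<delta> * real n) \<longrightarrow>
      real (cvec.dim (cvec.span (\<Union>i\<in>{1..n}. V i))) \<le> C * real k ^ 4 / \<delta>\<^sup>2)"
proof (intro exI[of _ 8] conjI allI impI)
  show "(0::real) < 8" by simp
  fix k n l :: nat and \<delta> :: real and V :: "nat \<Rightarrow> (nat \<Rightarrow> complex) set"
  assume pos: "k > 0" "n > 0" "l > 0" "\<delta> > 0"
    and V: "\<forall>i\<in>{1..n}. cvec.subspace (V i) \<and> V i \<subseteq> cspace l \<and> cvec.dim (V i) = k"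
      "\<forall>i\<in>{1..n}. \<forall>i'\<in>{1..n}. i \<noteq> i' \<longrightarrow> V i \<inter> V i' = {0}"
    and many: "\<forall>i1\<in>{1..n}. real (card {i2 \<in> {1..n} - {i1}.
        \<exists>i3\<in>{1..n} - {i1, i2}. V i3 \<subseteq> cvec.span (V i1 \<union> V i2)}) \<ge> \<delta> * real n"
  let ?D = "real (cvec.dim (cvec.span (\<Union>i\<in>{1..n}. V i)))"
  have "\<delta> * ?D \<le> 8 * real k" by (rule dim_span_arrangement_le[OF pos(2) V many])
  moreover have "\<delta> \<le> 1"
  proof -
    let ?S = "{i2 \<in> {1..n} - {1}. \<exists>i3\<in>{1..n} - {1, i2}. V i3 \<subseteq> cvec.span (V 1 \<union> V i2)}"
    have "1 \<in> {1..n}" using pos by simp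
    then have "\<delta> * real n \<le> real (card ?S)" using many by blast
    also have "\<dots> \<le> real (card {1..n})" by (intro of_nat_mono card_mono) auto
    finally show ?thesis using pos by simp
  qed
  then have "\<delta> * (\<delta> * ?D) \<le> 1 * (\<delta> * ?D)" using pos by (intro mult_right_mono) auto
  ultimately have "\<delta>\<^sup>2 * ?D \<le> 8 * real k" unfolding power2_eq_square mult.assoc by linarith
  also have "\<dots> \<le> 8 * real k ^ 4"
  proof -
    have "real k ^ 1 \<le> real k ^ 4" using pos by (intro power_increasing) auto
    then show ?thesis by simp
  qed
  finally show "?D \<le> 8 * real k ^ 4 / \<delta>\<^sup>2" using pos by (simp add: field_simps)
qed

end
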